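(* Let $G$ be a Lie group. The assignment $M\mapsto\mathrm{Trans}_G(M)$ extends to a contravariant functor, that is, a strict presheaf of groupoids $$\mathrm{Trans}_G:\mathsf{Man}^{op}\to\mathsf{Groupoid}$$ from the category of manifolds to the category of groupoids.
   Context: Diffeology. A diffeology on a set $X$ is a collection of maps $U\to X$ ("plots"), $U$ ranging over open subsets of $\mathbb{R}^n$, $n\ge 0$, which contains all constant maps, is closed under precomposition with smooth maps $V\to U$ of such open sets, and is local (a map $U\to X$ that restricts to a plot on each member of an open cover of $U$ is a plot). A map of diffeological spaces is smooth if it sends plots to plots by composition. A manifold is a diffeological space whose plots are the smooth maps. Subspace diffeology on $Y\subset X$: plots of $X$ with image in $Y$. Quotient diffeology on $X/R$: maps $U\to X/R$ that locally on $U$ lift to plots of $X$. Thin fundamental groupoid. A path with sitting instances in a manifold $M$ is a smooth map $\gamma:[0,1]\to M$ that is constant near $0$ and near $1$; $\mathcal{P}(M)$ is the set of these, with the diffeology in which $p:U\to\mathcal{P}(M)$ is a plot iff $(u,t)\mapsto p(u)(t)$ is a smooth map $U\times[0,1]\to M$. Two such paths $\gamma_0,\gamma_1$ with the same endpoints are thinly homotopic if there is a smooth $H:[0,1]^2\to M$ with $H(s,0)=\gamma_0(s)$, $H(s,1)=\gamma_1(s)$, $H(0,t)=\gamma_0(0)$, $H(1,t)=\gamma_0(1)$, with $\mathrm{rank}(dH)\le 1$ everywhere, and with $H$ constant in $s$ near $\{0,1\}\times[0,1]$ and constant in $t$ near $[0,1]\times\{0,1\}$. This is an equivalence relation $\sim$.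 $\Pi^{\mathrm{thin}}(M)$ is the groupoid with objects the points of $M$, arrows $\mathcal{P}(M)/_\sim$ (quotient diffeology), source $[\gamma]\mapsto\gamma(0)$, target $[\gamma]\mapsto\gamma(1)$, composition $[\gamma][\tau]=[\gamma\tau]$ where $\gamma\tau$ is the concatenation ($\tau$ first, then $\gamma$, each at double speed), units the constant paths, inverses the reversed paths. $\pi_1^{\mathrm{thin}}(M,x)$ is the automorphism group of $x$ in $\Pi^{\mathrm{thin}}(M)$, with the subspace diffeology. Transport functors. $G\text{-}\mathsf{tors}$ is the groupoid of $G$-torsors (manifolds with a smooth free transitive right $G$-action such that $X\times G\to X\times X$, $(x,g)\mapsto(x,x\cdot g)$, is a diffeomorphism) and $G$-equivariant maps. For a $G$-torsor $X$, $\mathrm{Aut}(X)$ is a Lie group via the isomorphism $\mathrm{Aut}(X)\to G$, $f\mapsto d(x,f(x))$, where $x\in X$ is any point and $x\cdot d(x,y)=y$. A functor $F:\Pi^{\mathrm{thin}}(M)\to G\text{-}\mathsf{tors}$ is a transport functor if for every $x\in M$ the map $F|_{\pi_1^{\mathrm{thin}}(M,x)}:\pi_1^{\mathrm{thin}}(M,x)\to\mathrm{Aut}(F(x))$ is smooth. $\mathrm{Trans}_G(M)$ is the groupoid whose objects are transport functors on $M$ and whose morphisms are arbitrary natural transformations. *)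

theory Defs
  imports "HOL-Analysis.Analysis" "HOL-Library.Function_Algebras" "HOL-Algebra.Group"
begin

section \<open>Categories, functors, groupoids\<close>

record ('o, 'a) cat =
  Obj :: "'o set"
  Arr :: "'a set"
  Src :: "'a \<Rightarrow> 'o"
  Tgt :: "'a \<Rightarrow> 'o"
  Ident :: "'o \<Rightarrow> 'a"
  Comp :: "'a \<Rightarrow> 'a \<Rightarrow> 'a"

text \<open>\<open>Comp C g f\<close> is ``\<open>f\<close> first, then \<open>g\<close>''; it is only meaningful if
  \<open>Src C g = Tgt C f\<close>.\<close>

definition category :: "('o, 'a) cat \<Rightarrow> bool" where
  "category C \<longleftrightarrow>
     (\<forall>f\<in>Arr C. Src C f \<in> Obj C \<and> Tgt C f \<in> Obj C) \<and>
     (\<forall>x\<in>Obj C. Ident C x \<in> Arr C \<and> Src C (Ident C x) = x \<and> Tgt C (Ident C x) = x) \<and>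
     (\<forall>f\<in>Arr C. \<forall>g\<in>Arr C. Src C g = Tgt C f \<longrightarrow>
        Comp C g f \<in> Arr C \<and> Src C (Comp C g f) = Src C f \<and> Tgt C (Comp C g f) = Tgt C g) \<and>
     (\<forall>f\<in>Arr C. Comp C f (Ident C (Src C f)) = f \<and> Comp C (Ident C (Tgt C f)) f = f) \<and>
     (\<forall>f\<in>Arr C. \<forall>g\<in>Arr C. \<forall>h\<in>Arr C. Src C g = Tgt C f \<and> Src C h = Tgt C g \<longrightarrow>
        Comp C h (Comp C g f) = Comp C (Comp C h g) f)"

definition groupoid :: "('o, 'a) cat \<Rightarrow> bool" where
  "groupoid C \<longleftrightarrow> category C \<and>
     (\<forall>f\<in>Arr C. \<exists>g\<in>Arr C. Src C g = Tgt C f \<and> Tgt C g = Src C f \<and>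
        Comp C g f = Ident C (Src C f) \<and> Comp C f g = Ident C (Tgt C f))"

definition op_cat :: "('o, 'a) cat \<Rightarrow> ('o, 'a) cat" where
  "op_cat C = \<lparr>Obj = Obj C, Arr = Arr C, Src = Tgt C, Tgt = Src C, Ident = Ident C,
                Comp = (\<lambda>g f. Comp C f g)\<rparr>"

text \<open>The two components of a functor are extensional, so that equality of functors is
  equality on objects and on arrows.\<close>

record ('o, 'a, 'p, 'b) ftr =
  fobj :: "'o \<Rightarrow> 'p"
  farr :: "'a \<Rightarrow> 'b"

definition is_functor :: "('o, 'a) cat \<Rightarrow> ('p, 'b) cat \<Rightarrow> ('o, 'a, 'p, 'b) ftr \<Rightarrow> bool" where
  "is_functor C D F \<longleftrightarrow>
     fobj F \<in> Obj C \<rightarrow>\<^sub>E Obj D \<and>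
     farr F \<in> Arr C \<rightarrow>\<^sub>E Arr D \<and>
     (\<forall>f\<in>Arr C. Src D (farr F f) = fobj F (Src C f) \<and> Tgt D (farr F f) = fobj F (Tgt C f)) \<and>
     (\<forall>x\<in>Obj C. farr F (Ident C x) = Ident D (fobj F x)) \<and>
     (\<forall>f\<in>Arr C. \<forall>g\<in>Arr C. Src C g = Tgt C f \<longrightarrow>
        farr F (Comp C g f) = Comp D (farr F g) (farr F f))"

definition id_ftr :: "('o, 'a) cat \<Rightarrow> ('o, 'a, 'o, 'a) ftr" where
  "id_ftr C = \<lparr>fobj = (\<lambda>x\<in>Obj C. x), farr = (\<lambda>f\<in>Arr C. f)\<rparr>"

definition comp_ftr ::
    "('o, 'a) cat \<Rightarrow> ('p, 'b, 'q, 'c) ftr \<Rightarrow> ('o, 'a, 'p, 'b) ftr \<Rightarrow> ('o, 'a, 'q, 'c) ftr" where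
  "comp_ftr C G F =
     \<lparr>fobj = compose (Obj C) (fobj G) (fobj F), farr = compose (Arr C) (farr G) (farr F)\<rparr>"

definition is_nat_transf ::
    "('o, 'a) cat \<Rightarrow> ('p, 'b) cat \<Rightarrow> ('o, 'a, 'p, 'b) ftr \<Rightarrow> ('o \<Rightarrow> 'b) \<Rightarrow> ('o, 'a, 'p, 'b) ftr \<Rightarrow> bool"
  where
  "is_nat_transf C D F \<eta> F' \<longleftrightarrow>
     \<eta> \<in> Obj C \<rightarrow>\<^sub>E Arr D \<and>
     (\<forall>x\<in>Obj C. Src D (\<eta> x) = fobj F x \<and> Tgt D (\<eta> x) = fobj F' x) \<and>
     (\<forall>f\<in>Arr C. Comp D (\<eta> (Tgt C f)) (farr F f) = Comp D (farr F' f) (\<eta> (Src C f)))"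

text \<open>The category of groupoids (on the given types of objects and arrows) and functors.\<close>

type_synonym ('o, 'a) gpd_arr = "('o, 'a) cat \<times> ('o, 'a, 'o, 'a) ftr \<times> ('o, 'a) cat"

definition gpd_cat :: "(('o, 'a) cat, ('o, 'a) gpd_arr) cat" where
  "gpd_cat =
     \<lparr>Obj = {C. groupoid C},
      Arr = {(C, F, D). groupoid C \<and> groupoid D \<and> is_functor C D F},
      Src = (\<lambda>(C, F, D). C),
      Tgt = (\<lambda>(C, F, D). D),
      Ident = (\<lambda>C. (C, id_ftr C, C)),
      Comp = (\<lambda>(D', G, E) (C, F, D). (C, comp_ftr C G F, E))\<rparr>"

section \<open>Smooth maps between open subsets of Euclidean spaces\<close>

text \<open>\<open>Euclidean_space n\<close> is $\mathbb{R}^n$, realised as the space of real sequences vanishing from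
  index \<open>n\<close> on. A real function on an open set is of class $C^{k+1}$ if it is continuous and all its
  partial derivatives exist and are of class $C^k$.\<close>

primrec Ck_on :: "nat \<Rightarrow> nat \<Rightarrow> (nat \<Rightarrow> real) set \<Rightarrow> ((nat \<Rightarrow> real) \<Rightarrow> real) \<Rightarrow> bool" where
  "Ck_on 0 n U f \<longleftrightarrow> continuous_map (subtopology (Euclidean_space n) U) euclideanreal f"
| "Ck_on (Suc k) n U f \<longleftrightarrow>
     continuous_map (subtopology (Euclidean_space n) U) euclideanreal f \<and>
     (\<forall>i<n. \<exists>g. (\<forall>x\<in>U. ((\<lambda>t. f (x(i := t))) has_real_derivative g x) (at (x i))) \<and> Ck_on k n U g)"

definition smooth_eucl ::
    "nat \<Rightarrow> (nat \<Rightarrow> real) set \<Rightarrow> nat \<Rightarrow> ((nat \<Rightarrow> real) \<Rightarrow> (nat \<Rightarrow> real)) \<Rightarrow> bool" where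
  "smooth_eucl n U m f \<longleftrightarrow>
     openin (Euclidean_space n) U \<and> f \<in> U \<rightarrow> topspace (Euclidean_space m) \<and>
     (\<forall>j<m. \<forall>k. Ck_on k n U (\<lambda>x. f x j))"

section \<open>Manifolds\<close>

record 'm mfd =
  mtop :: "'m topology"
  mdim :: nat
  atlas :: "('m set \<times> ('m \<Rightarrow> nat \<Rightarrow> real)) set"

abbreviation pts :: "'m mfd \<Rightarrow> 'm set" where
  "pts M \<equiv> topspace (mtop M)"

definition is_chart :: "'m topology \<Rightarrow> nat \<Rightarrow> 'm set \<times> ('m \<Rightarrow> nat \<Rightarrow> real) \<Rightarrow> bool" where
  "is_chart T n = (\<lambda>(W, \<phi>). openin T W \<and> \<phi> \<in> extensional W \<and>
     openin (Euclidean_space n) (\<phi> ` W) \<and>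
     homeomorphic_map (subtopology T W) (subtopology (Euclidean_space n) (\<phi> ` W)) \<phi>)"

definition compatible ::
    "nat \<Rightarrow> 'm set \<times> ('m \<Rightarrow> nat \<Rightarrow> real) \<Rightarrow> 'm set \<times> ('m \<Rightarrow> nat \<Rightarrow> real) \<Rightarrow> bool" where
  "compatible n = (\<lambda>(W, \<phi>) (V, \<psi>).
     smooth_eucl n (\<phi> ` (W \<inter> V)) n (\<psi> \<circ> inv_into W \<phi>) \<and>
     smooth_eucl n (\<psi> ` (W \<inter> V)) n (\<phi> \<circ> inv_into V \<psi>))"

text \<open>The atlas of a manifold is maximal, so that it is determined by the smooth structure.\<close>

definition manifold :: "'m mfd \<Rightarrow> bool" where
  "manifold M \<longleftrightarrow>
     Hausdorff_space (mtop M) \<and> second_countable (mtop M) \<and>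
     (\<forall>c\<in>atlas M. is_chart (mtop M) (mdim M) c) \<and>
     (\<Union>c\<in>atlas M. fst c) = pts M \<and>
     (\<forall>c\<in>atlas M. \<forall>d\<in>atlas M. compatible (mdim M) c d) \<and>
     (\<forall>c. is_chart (mtop M) (mdim M) c \<and> (\<forall>d\<in>atlas M. compatible (mdim M) c d) \<longrightarrow> c \<in> atlas M)"

section \<open>Diffeologies\<close>

text \<open>A diffeological space is given by its set of points and its plots; \<open>dplot D n U p\<close> says
  that \<open>U\<close> is open in $\mathbb{R}^n$ and that the restriction of \<open>p\<close> to \<open>U\<close> is a plot
  $U \to$ \<open>dset D\<close>.\<close>

record 'x diffeol =
  dset :: "'x set"
  dplot :: "nat \<Rightarrow> (nat \<Rightarrow> real) set \<Rightarrow> ((nat \<Rightarrow> real) \<Rightarrow> 'x) \<Rightarrow> bool"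

definition dsmooth :: "'x diffeol \<Rightarrow> 'y diffeol \<Rightarrow> ('x \<Rightarrow> 'y) \<Rightarrow> bool" where
  "dsmooth A B f \<longleftrightarrow> f \<in> dset A \<rightarrow> dset B \<and> (\<forall>n U p. dplot A n U p \<longrightarrow> dplot B n U (f \<circ> p))"

definition diffeomorphism :: "'x diffeol \<Rightarrow> 'y diffeol \<Rightarrow> ('x \<Rightarrow> 'y) \<Rightarrow> bool" where
  "diffeomorphism A B f \<longleftrightarrow>
     bij_betw f (dset A) (dset B) \<and> dsmooth A B f \<and> dsmooth B A (inv_into (dset A) f)"

definition sub_diff :: "'x diffeol \<Rightarrow> 'x set \<Rightarrow> 'x diffeol" where
  "sub_diff D Y = \<lparr>dset = dset D \<inter> Y, dplot = (\<lambda>n U p. dplot D n U p \<and> p ` U \<subseteq> Y)\<rparr>"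

definition quot_diff :: "'x diffeol \<Rightarrow> ('x \<times> 'x) set \<Rightarrow> 'x set diffeol" where
  "quot_diff D R =
     \<lparr>dset = dset D // R,
      dplot = (\<lambda>n U p. openin (Euclidean_space n) U \<and>
        (\<forall>u\<in>U. \<exists>V q. u \<in> V \<and> V \<subseteq> U \<and> dplot D n V q \<and> (\<forall>v\<in>V. p v = R `` {q v})))\<rparr>"

definition prod_diff :: "'x diffeol \<Rightarrow> 'y diffeol \<Rightarrow> ('x \<times> 'y) diffeol" where
  "prod_diff A B =
     \<lparr>dset = dset A \<times> dset B,
      dplot = (\<lambda>n U p. dplot A n U (fst \<circ> p) \<and> dplot B n U (snd \<circ> p))\<rparr>"

text \<open>The plots of a manifold are the smooth maps.\<close>

definition mfd_diff :: "'m mfd \<Rightarrow> 'm diffeol" where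
  "mfd_diff M =
     \<lparr>dset = pts M,
      dplot = (\<lambda>n U p. openin (Euclidean_space n) U \<and>
        continuous_map (subtopology (Euclidean_space n) U) (mtop M) p \<and>
        (\<forall>(W, \<phi>)\<in>atlas M. smooth_eucl n {u \<in> U. p u \<in> W} (mdim M) (\<phi> \<circ> p)))\<rparr>"

text \<open>The category of manifolds with points in the given type, which plays the role of a universe
  (with \<open>real\<close> for \<open>'m\<close> it already contains every manifold up to diffeomorphism).\<close>

type_synonym 'm man_arr = "'m mfd \<times> ('m \<Rightarrow> 'm) \<times> 'm mfd"

definition man_cat :: "('m mfd, 'm man_arr) cat" where
  "man_cat =
     \<lparr>Obj = {M. manifold M},
      Arr = {(M, f, N). manifold M \<and> manifold N \<and> f \<in> extensional (pts M) \<and>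
                        dsmooth (mfd_diff M) (mfd_diff N) f},
      Src = (\<lambda>(M, f, N). M),
      Tgt = (\<lambda>(M, f, N). N),
      Ident = (\<lambda>M. (M, \<lambda>x\<in>pts M. x, M)),
      Comp = (\<lambda>(N', g, K) (M, f, N). (M, compose (pts M) g f, K))\<rparr>"

section \<open>The thin fundamental groupoid\<close>

text \<open>Smoothness on a subset of $\mathbb{R}^n$ that need not be open, such as $U\times[0,1]$: the
  map extends locally to a smooth map on an open set.\<close>

definition smooth_on_set ::
    "nat \<Rightarrow> (nat \<Rightarrow> real) set \<Rightarrow> 'm mfd \<Rightarrow> ((nat \<Rightarrow> real) \<Rightarrow> 'm) \<Rightarrow> bool" where
  "smooth_on_set n S M f \<longleftrightarrow> S \<subseteq> topspace (Euclidean_space n) \<and>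
     (\<forall>x\<in>S. \<exists>V p. x \<in> V \<and> dplot (mfd_diff M) n V p \<and> (\<forall>y\<in>S \<inter> V. f y = p y))"

definition sitting_paths :: "'m mfd \<Rightarrow> (real \<Rightarrow> 'm) set" where
  "sitting_paths M = {\<gamma> \<in> {0..1} \<rightarrow>\<^sub>E pts M.
     smooth_on_set 1 {x \<in> topspace (Euclidean_space 1). x 0 \<in> {0..1}} M (\<lambda>x. \<gamma> (x 0)) \<and>
     (\<exists>\<epsilon>>0. \<forall>t\<in>{0..1}. (t < \<epsilon> \<longrightarrow> \<gamma> t = \<gamma> 0) \<and> (t > 1 - \<epsilon> \<longrightarrow> \<gamma> t = \<gamma> 1))}"

text \<open>A point $(u,t)$ of $\mathbb{R}^n\times\mathbb{R}=\mathbb{R}^{n+1}$ is the sequence \<open>x\<close> with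
  \<open>u = x(n := 0)\<close> and \<open>t = x n\<close>.\<close>

definition path_diff :: "'m mfd \<Rightarrow> (real \<Rightarrow> 'm) diffeol" where
  "path_diff M =
     \<lparr>dset = sitting_paths M,
      dplot = (\<lambda>n U p. openin (Euclidean_space n) U \<and> p \<in> U \<rightarrow> sitting_paths M \<and>
        smooth_on_set (Suc n)
          {x \<in> topspace (Euclidean_space (Suc n)). x(n := 0) \<in> U \<and> x n \<in> {0..1}} M
          (\<lambda>x. p (x(n := 0)) (x n)))\<rparr>"

text \<open>The rank of the differential of \<open>H\<close> at \<open>(s, t)\<close>, read in the chart \<open>\<phi>\<close> around \<open>H s t\<close>:
  the dimension of the image of $(a,b)\mapsto a\,\partial_s+b\,\partial_t$. At the boundary
  of the square the partial derivatives are one-sided.\<close>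

definition rank_d :: "('m \<Rightarrow> nat \<Rightarrow> real) \<Rightarrow> (real \<Rightarrow> real \<Rightarrow> 'm) \<Rightarrow> real \<Rightarrow> real \<Rightarrow> nat" where
  "rank_d \<phi> H s t =
     (let ds = (\<lambda>j. vector_derivative (\<lambda>\<sigma>. \<phi> (H \<sigma> t) j) (at s within {0..1}));
          dt = (\<lambda>j. vector_derivative (\<lambda>\<tau>. \<phi> (H s \<tau>) j) (at t within {0..1}))
      in vector_space.dim (\<lambda>(c::real) (v::nat \<Rightarrow> real). \<lambda>j. c * v j)
           (range (\<lambda>(a, b). \<lambda>j. a * ds j + b * dt j)))"

definition thin_homotopy ::
    "'m mfd \<Rightarrow> (real \<Rightarrow> 'm) \<Rightarrow> (real \<Rightarrow> 'm) \<Rightarrow> (real \<Rightarrow> real \<Rightarrow> 'm) \<Rightarrow> bool" where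
  "thin_homotopy M \<gamma>\<^sub>0 \<gamma>\<^sub>1 H \<longleftrightarrow>
     smooth_on_set 2 {x \<in> topspace (Euclidean_space 2). x 0 \<in> {0..1} \<and> x 1 \<in> {0..1}} M
       (\<lambda>x. H (x 0) (x 1)) \<and>
     (\<forall>s\<in>{0..1}. H s 0 = \<gamma>\<^sub>0 s \<and> H s 1 = \<gamma>\<^sub>1 s) \<and>
     (\<forall>t\<in>{0..1}. H 0 t = \<gamma>\<^sub>0 0 \<and> H 1 t = \<gamma>\<^sub>0 1) \<and>
     (\<forall>s\<in>{0..1}. \<forall>t\<in>{0..1}. \<forall>(W, \<phi>)\<in>atlas M. H s t \<in> W \<longrightarrow> rank_d \<phi> H s t \<le> 1) \<and>
     (\<exists>\<epsilon>>0. \<forall>s\<in>{0..1}. \<forall>t\<in>{0..1}.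
        (s < \<epsilon> \<longrightarrow> H s t = H 0 t) \<and> (s > 1 - \<epsilon> \<longrightarrow> H s t = H 1 t) \<and>
        (t < \<epsilon> \<longrightarrow> H s t = H s 0) \<and> (t > 1 - \<epsilon> \<longrightarrow> H s t = H s 1))"

definition thin_rel :: "'m mfd \<Rightarrow> ((real \<Rightarrow> 'm) \<times> (real \<Rightarrow> 'm)) set" where
  "thin_rel M = {(\<gamma>\<^sub>0, \<gamma>\<^sub>1). \<gamma>\<^sub>0 \<in> sitting_paths M \<and> \<gamma>\<^sub>1 \<in> sitting_paths M \<and>
     \<gamma>\<^sub>0 0 = \<gamma>\<^sub>1 0 \<and> \<gamma>\<^sub>0 1 = \<gamma>\<^sub>1 1 \<and> (\<exists>H. thin_homotopy M \<gamma>\<^sub>0 \<gamma>\<^sub>1 H)}"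

text \<open>\<open>path_concat \<gamma> \<tau>\<close> runs through \<open>\<tau>\<close> first.\<close>

definition path_concat :: "(real \<Rightarrow> 'm) \<Rightarrow> (real \<Rightarrow> 'm) \<Rightarrow> (real \<Rightarrow> 'm)" where
  "path_concat \<gamma> \<tau> = (\<lambda>t\<in>{0..1}. if t \<le> 1/2 then \<tau> (2 * t) else \<gamma> (2 * t - 1))"

type_synonym 'm thin_arr = "(real \<Rightarrow> 'm) set"

text \<open>Source, target and composition of classes are given by arbitrary representatives.\<close>

definition thin_gpd :: "'m mfd \<Rightarrow> ('m, 'm thin_arr) cat" where
  "thin_gpd M =
     \<lparr>Obj = pts M,
      Arr = sitting_paths M // thin_rel M,
      Src = (\<lambda>c. (SOME \<gamma>. \<gamma> \<in> c) 0),
      Tgt = (\<lambda>c. (SOME \<gamma>. \<gamma> \<in> c) 1),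
      Ident = (\<lambda>x. thin_rel M `` {\<lambda>t\<in>{0..1}. x}),
      Comp = (\<lambda>c d. thin_rel M `` {path_concat \<gamma> \<tau> |\<gamma> \<tau>. \<gamma> \<in> c \<and> \<tau> \<in> d})\<rparr>"

definition thin_diff :: "'m mfd \<Rightarrow> 'm thin_arr diffeol" where
  "thin_diff M = quot_diff (path_diff M) (thin_rel M)"

definition thin_pi1 :: "'m mfd \<Rightarrow> 'm \<Rightarrow> 'm thin_arr diffeol" where
  "thin_pi1 M x = sub_diff (thin_diff M)
     {c \<in> Arr (thin_gpd M). Src (thin_gpd M) c = x \<and> Tgt (thin_gpd M) c = x}"

text \<open>The functor $[\gamma]\mapsto[f\circ\gamma]$ induced by a smooth map \<open>f\<close> from \<open>M\<close> to \<open>N\<close>.\<close>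

definition thin_map :: "'m man_arr \<Rightarrow> ('m, 'm thin_arr, 'm, 'm thin_arr) ftr" where
  "thin_map = (\<lambda>(M, f, N).
     \<lparr>fobj = (\<lambda>x\<in>pts M. f x),
      farr = (\<lambda>c\<in>Arr (thin_gpd M). thin_rel N `` (compose {0..1} f ` c))\<rparr>)"

section \<open>Lie groups and torsors\<close>

record 'g lie = "'g monoid" +
  lie_mfd :: "'g mfd"

definition lie_group :: "'g lie \<Rightarrow> bool" where
  "lie_group G \<longleftrightarrow> group G \<and> manifold (lie_mfd G) \<and> carrier G = pts (lie_mfd G) \<and>
     dsmooth (prod_diff (mfd_diff (lie_mfd G)) (mfd_diff (lie_mfd G))) (mfd_diff (lie_mfd G))
       (\<lambda>(g, h). g \<otimes>\<^bsub>G\<^esub> h) \<and>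
     dsmooth (mfd_diff (lie_mfd G)) (mfd_diff (lie_mfd G)) (\<lambda>g. inv\<^bsub>G\<^esub> g)"

record ('t, 'g) torsor =
  tmfd :: "'t mfd"
  act :: "'t \<times> 'g \<Rightarrow> 't"

definition is_torsor :: "'g lie \<Rightarrow> ('t, 'g) torsor \<Rightarrow> bool" where
  "is_torsor G X \<longleftrightarrow>
     manifold (tmfd X) \<and> pts (tmfd X) \<noteq> {} \<and>
     act X \<in> pts (tmfd X) \<times> carrier G \<rightarrow>\<^sub>E pts (tmfd X) \<and>
     (\<forall>x\<in>pts (tmfd X). act X (x, \<one>\<^bsub>G\<^esub>) = x) \<and>
     (\<forall>x\<in>pts (tmfd X). \<forall>g\<in>carrier G. \<forall>h\<in>carrier G.
        act X (act X (x, g), h) = act X (x, g \<otimes>\<^bsub>G\<^esub> h)) \<and>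
     dsmooth (prod_diff (mfd_diff (tmfd X)) (mfd_diff (lie_mfd G))) (mfd_diff (tmfd X)) (act X) \<and>
     (\<forall>x\<in>pts (tmfd X). \<forall>g\<in>carrier G. act X (x, g) = x \<longrightarrow> g = \<one>\<^bsub>G\<^esub>) \<and>
     (\<forall>x\<in>pts (tmfd X). \<forall>y\<in>pts (tmfd X). \<exists>g\<in>carrier G. act X (x, g) = y) \<and>
     diffeomorphism
       (prod_diff (mfd_diff (tmfd X)) (mfd_diff (lie_mfd G)))
       (prod_diff (mfd_diff (tmfd X)) (mfd_diff (tmfd X)))
       (\<lambda>(x, g). (x, act X (x, g)))"

text \<open>The element \<open>g\<close> of the group with $x\cdot g = y$.\<close>

definition torsor_diff :: "'g lie \<Rightarrow> ('t, 'g) torsor \<Rightarrow> 't \<Rightarrow> 't \<Rightarrow> 'g" where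
  "torsor_diff G X x y = (THE g. g \<in> carrier G \<and> act X (x, g) = y)"

type_synonym ('t, 'g) tors_arr = "('t, 'g) torsor \<times> ('t \<Rightarrow> 't) \<times> ('t, 'g) torsor"

definition tors_cat :: "'g lie \<Rightarrow> (('t, 'g) torsor, ('t, 'g) tors_arr) cat" where
  "tors_cat G =
     \<lparr>Obj = {X. is_torsor G X},
      Arr = {(X, f, Y). is_torsor G X \<and> is_torsor G Y \<and> f \<in> pts (tmfd X) \<rightarrow>\<^sub>E pts (tmfd Y) \<and>
               (\<forall>x\<in>pts (tmfd X). \<forall>g\<in>carrier G. f (act X (x, g)) = act Y (f x, g))},
      Src = (\<lambda>(X, f, Y). X),
      Tgt = (\<lambda>(X, f, Y). Y),
      Ident = (\<lambda>X. (X, \<lambda>x\<in>pts (tmfd X). x, X)),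
      Comp = (\<lambda>(Y', g, Z) (X, f, Y). (X, compose (pts (tmfd X)) g f, Z))\<rparr>"

text \<open>The diffeology on the automorphisms of a torsor \<open>X\<close> for which $f\mapsto d(x,f(x))$ is a
  diffeomorphism onto \<open>G\<close>. It does not depend on the point \<open>x\<close>, as another choice of \<open>x\<close>
  changes this map by conjugation with a fixed element of \<open>G\<close>; so we ask for all \<open>x\<close>.\<close>

definition aut_diff :: "'g lie \<Rightarrow> ('t, 'g) torsor \<Rightarrow> ('t, 'g) tors_arr diffeol" where
  "aut_diff G X =
     (let A = {a \<in> Arr (tors_cat G). Src (tors_cat G) a = X \<and> Tgt (tors_cat G) a = X}
      in \<lparr>dset = A,
          dplot = (\<lambda>n U p. p \<in> U \<rightarrow> A \<and>
            (\<forall>x\<in>pts (tmfd X).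
               dplot (mfd_diff (lie_mfd G)) n U (\<lambda>u. torsor_diff G X x (fst (snd (p u)) x))))\<rparr>)"

section \<open>Transport functors\<close>

type_synonym ('m, 't, 'g) trans_obj = "('m, 'm thin_arr, ('t, 'g) torsor, ('t, 'g) tors_arr) ftr"

type_synonym ('m, 't, 'g) trans_arr =
  "('m, 't, 'g) trans_obj \<times> ('m \<Rightarrow> ('t, 'g) tors_arr) \<times> ('m, 't, 'g) trans_obj"

definition is_transport :: "'g lie \<Rightarrow> 'm mfd \<Rightarrow> ('m, 't, 'g) trans_obj \<Rightarrow> bool" where
  "is_transport G M F \<longleftrightarrow> is_functor (thin_gpd M) (tors_cat G) F \<and>
     (\<forall>x\<in>pts M. dsmooth (thin_pi1 M x) (aut_diff G (fobj F x)) (farr F))"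

definition trans_cat ::
    "'g lie \<Rightarrow> 'm mfd \<Rightarrow> (('m, 't, 'g) trans_obj, ('m, 't, 'g) trans_arr) cat" where
  "trans_cat G M =
     \<lparr>Obj = {F. is_transport G M F},
      Arr = {(F, \<eta>, F'). is_transport G M F \<and> is_transport G M F' \<and>
                         is_nat_transf (thin_gpd M) (tors_cat G) F \<eta> F'},
      Src = (\<lambda>(F, \<eta>, F'). F),
      Tgt = (\<lambda>(F, \<eta>, F'). F'),
      Ident = (\<lambda>F. (F, \<lambda>x\<in>pts M. Ident (tors_cat G) (fobj F x), F)),
      Comp = (\<lambda>(E, \<theta>, F'') (F, \<eta>, F'). (F, \<lambda>x\<in>pts M. Comp (tors_cat G) (\<theta> x) (\<eta> x), F''))\<rparr>"

text \<open>Pullback of transport functors and of their natural transformations along a smooth map: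
  precomposition with \<open>thin_map\<close>.\<close>

definition pullback ::
    "'g lie \<Rightarrow> 'm man_arr \<Rightarrow>
     (('m, 't, 'g) trans_obj, ('m, 't, 'g) trans_arr,
      ('m, 't, 'g) trans_obj, ('m, 't, 'g) trans_arr) ftr" where
  "pullback G = (\<lambda>(M, f, N).
     let pb = (\<lambda>F. comp_ftr (thin_gpd M) F (thin_map (M, f, N)))
     in \<lparr>fobj = (\<lambda>F\<in>Obj (trans_cat G N). pb F),
         farr = (\<lambda>(F, \<eta>, F')\<in>Arr (trans_cat G N). (pb F, \<lambda>x\<in>pts M. \<eta> (f x), pb F'))\<rparr>)"

end

theory Submission
  imports Defs
begin

text \<open>A smooth map \<open>f\<close> sends thin homotopies to thin homotopies, because in charts the chain rule
  turns a linear dependency between the two partial derivatives of \<open>H\<close> into one for \<open>f \<circ> H\<close>. Hence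
  $[\gamma]\mapsto[f\circ\gamma]$ is a functor between thin fundamental groupoids that is strictly
  functorial in \<open>f\<close> and smooth on the thin fundamental groups, and precomposition with it preserves
  transport functors and natural transformations. The fibre \<open>Trans\<^sub>G(M)\<close> is a groupoid because
  equivariant maps of torsors are bijective.\<close>

section \<open>Categories and functors\<close>

text \<open>\<open>Ck_on\<close> provides partial derivatives only, so a differential has to be
  built: continuity of the partial derivatives gives a first-order expansion, and this gives a chain
  rule along curves whose coefficients \<open>L\<close> depend on the point and not on the curve.
  Both partial derivatives of a homotopy are then multiplied by the same matrix, which is why one
  pair of scalars serves before and after applying \<open>f\<close>. Derivatives are taken within an
  arbitrary set, which covers the edges of the square, where they are one-sided.

  Reparametrising paths and homotopies requires smoothness of all orders, but only along maps whose
  components are affine in one variable each; for these the chain rule in one variable suffices for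
  every \<open>k\<close>.

  Strictness, as opposed to functoriality up to isomorphism, has two sources: \<open>f\<close> is
  composed with representatives without touching their parametrisation, and the functions that make
  up functors and natural transformations are extensional, so that agreement on objects and arrows
  is equality.\<close>

lemma groupoidI:
  assumes "category C"
    and "\<And>f. f \<in> Arr C \<Longrightarrow> \<exists>g\<in>Arr C. Src C g = Tgt C f \<and> Tgt C g = Src C f \<and>
           Comp C g f = Ident C (Src C f) \<and> Comp C f g = Ident C (Tgt C f)"
  shows "groupoid C"
  using assms unfolding groupoid_def by blast

lemma categoryD:
  assumes "category C"
  shows "f \<in> Arr C \<Longrightarrow> Src C f \<in> Obj C"
    and "f \<in> Arr C \<Longrightarrow> Tgt C f \<in> Obj C"
    and "x \<in> Obj C \<Longrightarrow> Ident C x \<in> Arr C"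
    and "x \<in> Obj C \<Longrightarrow> Src C (Ident C x) = x"
    and "x \<in> Obj C \<Longrightarrow> Tgt C (Ident C x) = x"
    and "\<lbrakk>f \<in> Arr C; g \<in> Arr C; Src C g = Tgt C f\<rbrakk> \<Longrightarrow> Comp C g f \<in> Arr C"
    and "\<lbrakk>f \<in> Arr C; g \<in> Arr C; Src C g = Tgt C f\<rbrakk> \<Longrightarrow> Src C (Comp C g f) = Src C f"
    and "\<lbrakk>f \<in> Arr C; g \<in> Arr C; Src C g = Tgt C f\<rbrakk> \<Longrightarrow> Tgt C (Comp C g f) = Tgt C g"
    and "f \<in> Arr C \<Longrightarrow> Comp C f (Ident C (Src C f)) = f"
    and "f \<in> Arr C \<Longrightarrow> Comp C (Ident C (Tgt C f)) f = f"
    and "\<lbrakk>f \<in> Arr C; g \<in> Arr C; h \<in> Arr C; Src C g = Tgt C f; Src C h = Tgt C g\<rbrakk> \<Longrightarrow>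
           Comp C h (Comp C g f) = Comp C (Comp C h g) f"
  using assms unfolding category_def by auto

lemma is_functorD:
  assumes "is_functor C D F"
  shows "x \<in> Obj C \<Longrightarrow> fobj F x \<in> Obj D"
    and "f \<in> Arr C \<Longrightarrow> farr F f \<in> Arr D"
    and "fobj F \<in> extensional (Obj C)"
    and "farr F \<in> extensional (Arr C)"
    and "f \<in> Arr C \<Longrightarrow> Src D (farr F f) = fobj F (Src C f)"
    and "f \<in> Arr C \<Longrightarrow> Tgt D (farr F f) = fobj F (Tgt C f)"
    and "x \<in> Obj C \<Longrightarrow> farr F (Ident C x) = Ident D (fobj F x)"
    and "\<lbrakk>f \<in> Arr C; g \<in> Arr C; Src C g = Tgt C f\<rbrakk> \<Longrightarrow>
           farr F (Comp C g f) = Comp D (farr F g) (farr F f)"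
  using assms unfolding is_functor_def by (auto simp: PiE_iff)

lemma is_functor_id_ftr:
  assumes "category C"
  shows "is_functor C C (id_ftr C)"
  using categoryD[OF assms] by (auto simp: is_functor_def id_ftr_def)

lemma comp_ftr_sel [simp]:
  "fobj (comp_ftr C G F) = compose (Obj C) (fobj G) (fobj F)"
  "farr (comp_ftr C G F) = compose (Arr C) (farr G) (farr F)"
  by (simp_all add: comp_ftr_def)

lemma comp_ftr_id_right:
  assumes "is_functor C D F"
  shows "comp_ftr C F (id_ftr C) = F"
  using is_functorD(3,4)[OF assms]
  by (intro ftr.equality) (auto simp: id_ftr_def compose_def fun_eq_iff extensional_def)

lemma comp_ftr_id_left:
  assumes "is_functor C D F"
  shows "comp_ftr C (id_ftr D) F = F"
  using is_functorD(1-4)[OF assms]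
  by (intro ftr.equality) (auto simp: id_ftr_def compose_def fun_eq_iff extensional_def)

text \<open>Equality on the nose, because \<open>F\<close> maps \<open>C\<close> into
  \<open>D\<close>, where the restriction hidden in \<open>comp_ftr D H G\<close> has no
  effect.\<close>

lemma comp_ftr_assoc:
  assumes "is_functor C D F"
  shows "comp_ftr C (comp_ftr D H G) F = comp_ftr C H (comp_ftr C G F)"
  using is_functorD(1,2)[OF assms]
  by (auto simp: comp_ftr_def compose_def fun_eq_iff)

text \<open>The source is described by closure under endpoints, identities and composites, the three
  facts that \<open>thin_gpd_closed\<close> supplies for \<open>thin_gpd M\<close>.\<close>

lemma is_functor_comp_ftr:
  assumes C: "\<And>f. f \<in> Arr C \<Longrightarrow> Src C f \<in> Obj C \<and> Tgt C f \<in> Obj C"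
    and id: "\<And>x. x \<in> Obj C \<Longrightarrow> Ident C x \<in> Arr C"
    and cl: "\<And>f g. \<lbrakk>f \<in> Arr C; g \<in> Arr C; Src C g = Tgt C f\<rbrakk> \<Longrightarrow> Comp C g f \<in> Arr C"
    and F: "is_functor C D F" and G: "is_functor D E G"
  shows "is_functor C E (comp_ftr C G F)"
  using C id cl is_functorD[OF F] is_functorD[OF G]
  by (auto simp: is_functor_def compose_def)

lemma category_gpd_cat: "category (gpd_cat :: (('o, 'a) cat, ('o, 'a) gpd_arr) cat)"
proof -
  have comp: "is_functor C E (comp_ftr C G F)"
    if "groupoid C" "is_functor C D F" "is_functor D E G"
    for C D E :: "('o, 'a) cat" and F G
    using that by (intro is_functor_comp_ftr) (auto simp: groupoid_def dest: categoryD)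
  show ?thesis
    unfolding category_def gpd_cat_def
    by (auto simp: comp_ftr_assoc comp_ftr_id_left comp_ftr_id_right groupoid_def
        intro: is_functor_id_ftr comp[unfolded groupoid_def])
qed

section \<open>Natural transformations\<close>

lemma is_nat_transfD:
  assumes "is_nat_transf C D F \<eta> F'"
  shows "x \<in> Obj C \<Longrightarrow> \<eta> x \<in> Arr D"
    and "\<eta> \<in> extensional (Obj C)"
    and "x \<in> Obj C \<Longrightarrow> Src D (\<eta> x) = fobj F x"
    and "x \<in> Obj C \<Longrightarrow> Tgt D (\<eta> x) = fobj F' x"
    and "f \<in> Arr C \<Longrightarrow> Comp D (\<eta> (Tgt C f)) (farr F f) = Comp D (farr F' f) (\<eta> (Src C f))"
  using assms unfolding is_nat_transf_def by (auto simp: PiE_iff)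

lemma is_nat_transf_id:
  assumes C: "\<And>f. f \<in> Arr C \<Longrightarrow> Src C f \<in> Obj C \<and> Tgt C f \<in> Obj C"
    and D: "category D" and F: "is_functor C D F"
  shows "is_nat_transf C D F (\<lambda>x\<in>Obj C. Ident D (fobj F x)) F"
proof -
  note d = categoryD[OF D]
  note f = is_functorD[OF F]
  have "Comp D (Ident D (fobj F (Tgt C a))) (farr F a) = Comp D (farr F a) (Ident D (fobj F (Src C a)))"
    if "a \<in> Arr C" for a
    using d(9,10)[OF f(2)[OF that]] f(5,6)[OF that] by simp
  then show ?thesis
    using C f d by (auto simp: is_nat_transf_def)
qed

text \<open>The naturality squares of \<open>\<eta>\<close> and \<open>\<theta>\<close> are pasted
  along \<open>farr F' a\<close>; the rest is associativity in \<open>D\<close>.\<close>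

lemma is_nat_transf_comp:
  assumes C: "\<And>f. f \<in> Arr C \<Longrightarrow> Src C f \<in> Obj C \<and> Tgt C f \<in> Obj C"
    and D: "category D"
    and F: "is_functor C D F" and F': "is_functor C D F'" and F'': "is_functor C D F''"
    and \<eta>: "is_nat_transf C D F \<eta> F'" and \<theta>: "is_nat_transf C D F' \<theta> F''"
  shows "is_nat_transf C D F (\<lambda>x\<in>Obj C. Comp D (\<theta> x) (\<eta> x)) F''"
proof -
  note d = categoryD[OF D]
  note e = is_nat_transfD[OF \<eta>] and t = is_nat_transfD[OF \<theta>]
  note f = is_functorD[OF F] and f' = is_functorD[OF F'] and f'' = is_functorD[OF F'']
  have "Comp D (Comp D (\<theta> (Tgt C a)) (\<eta> (Tgt C a))) (farr F a) =
        Comp D (farr F'' a) (Comp D (\<theta> (Src C a)) (\<eta> (Src C a)))" if a: "a \<in> Arr C" for a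
  proof -
    have s: "Src C a \<in> Obj C" and u: "Tgt C a \<in> Obj C" using C[OF a] by auto
    have "Comp D (Comp D (\<theta> (Tgt C a)) (\<eta> (Tgt C a))) (farr F a) =
          Comp D (\<theta> (Tgt C a)) (Comp D (\<eta> (Tgt C a)) (farr F a))"
      by (intro d(11)[symmetric]) (simp_all add: a s u e t f)
    also have "\<dots> = Comp D (\<theta> (Tgt C a)) (Comp D (farr F' a) (\<eta> (Src C a)))"
      by (simp only: e(5)[OF a])
    also have "\<dots> = Comp D (Comp D (\<theta> (Tgt C a)) (farr F' a)) (\<eta> (Src C a))"
      by (intro d(11)) (simp_all add: a s u e t f')
    also have "\<dots> = Comp D (Comp D (farr F'' a) (\<theta> (Src C a))) (\<eta> (Src C a))"
      by (simp only: t(5)[OF a])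
    also have "\<dots> = Comp D (farr F'' a) (Comp D (\<theta> (Src C a)) (\<eta> (Src C a)))"
      by (intro d(11)[symmetric]) (simp_all add: a s u e t f'')
    finally show ?thesis .
  qed
  then show ?thesis
    using C e t d by (auto simp: is_nat_transf_def)
qed

text \<open>Componentwise inverses are automatically natural: insert \<open>\<eta>\<close> after
  \<open>\<theta>\<close> at the source of \<open>a\<close>, pull \<open>\<eta>\<close> through by
  naturality, and cancel it against \<open>\<theta>\<close> at the target.\<close>

lemma is_nat_transf_inverse:
  assumes C: "\<And>f. f \<in> Arr C \<Longrightarrow> Src C f \<in> Obj C \<and> Tgt C f \<in> Obj C"
    and D: "groupoid D"
    and F: "is_functor C D F" and F': "is_functor C D F'"
    and \<eta>: "is_nat_transf C D F \<eta> F'"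
  obtains \<theta> where "is_nat_transf C D F' \<theta> F"
    and "\<And>x. x \<in> Obj C \<Longrightarrow> Comp D (\<theta> x) (\<eta> x) = Ident D (fobj F x)"
    and "\<And>x. x \<in> Obj C \<Longrightarrow> Comp D (\<eta> x) (\<theta> x) = Ident D (fobj F' x)"
proof -
  have cat: "category D" using D by (simp add: groupoid_def)
  note d = categoryD[OF cat]
  note e = is_nat_transfD[OF \<eta>]
  note f = is_functorD[OF F] and f' = is_functorD[OF F']
  have "\<forall>x\<in>Obj C. \<exists>g. g \<in> Arr D \<and> Src D g = fobj F' x \<and> Tgt D g = fobj F x \<and>
          Comp D g (\<eta> x) = Ident D (fobj F x) \<and> Comp D (\<eta> x) g = Ident D (fobj F' x)"
    using D e unfolding groupoid_def by (metis (no_types, lifting))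
  then obtain \<theta>0 where \<theta>0: "\<forall>x\<in>Obj C. \<theta>0 x \<in> Arr D \<and> Src D (\<theta>0 x) = fobj F' x \<and>
      Tgt D (\<theta>0 x) = fobj F x \<and> Comp D (\<theta>0 x) (\<eta> x) = Ident D (fobj F x) \<and>
      Comp D (\<eta> x) (\<theta>0 x) = Ident D (fobj F' x)"
    by metis
  \<comment> \<open>Choice leaves the values outside \<open>Obj C\<close> arbitrary, whereas
    \<open>is_nat_transf\<close> asks for extensional families.\<close>
  define \<theta> where "\<theta> = restrict \<theta>0 (Obj C)"
  have t: "\<theta> x \<in> Arr D" "Src D (\<theta> x) = fobj F' x" "Tgt D (\<theta> x) = fobj F x"
      "Comp D (\<theta> x) (\<eta> x) = Ident D (fobj F x)" "Comp D (\<eta> x) (\<theta> x) = Ident D (fobj F' x)"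
    if "x \<in> Obj C" for x
    using \<theta>0 that by (simp_all add: \<theta>_def)
  have "Comp D (\<theta> (Tgt C a)) (farr F' a) = Comp D (farr F a) (\<theta> (Src C a))"
    if a: "a \<in> Arr C" for a
  proof -
    have s: "Src C a \<in> Obj C" and u: "Tgt C a \<in> Obj C" using C[OF a] by auto
    have "Comp D (\<theta> (Tgt C a)) (farr F' a) =
          Comp D (\<theta> (Tgt C a)) (Comp D (farr F' a) (Comp D (\<eta> (Src C a)) (\<theta> (Src C a))))"
      using d(9)[OF f'(2)[OF a]] f'(5)[OF a] t(5)[OF s] by simp
    also have "\<dots> = Comp D (\<theta> (Tgt C a)) (Comp D (Comp D (farr F' a) (\<eta> (Src C a))) (\<theta> (Src C a)))"
      by (subst d(11)) (simp_all add: a s u e t f')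
    also have "\<dots> = Comp D (\<theta> (Tgt C a)) (Comp D (Comp D (\<eta> (Tgt C a)) (farr F a)) (\<theta> (Src C a)))"
      by (simp only: e(5)[OF a])
    also have "\<dots> = Comp D (\<theta> (Tgt C a)) (Comp D (\<eta> (Tgt C a)) (Comp D (farr F a) (\<theta> (Src C a))))"
      by (subst d(11)) (simp_all add: a s u e t f)
    also have "\<dots> = Comp D (Comp D (\<theta> (Tgt C a)) (\<eta> (Tgt C a))) (Comp D (farr F a) (\<theta> (Src C a)))"
      by (intro d(11)) (simp_all add: a s u e t f d)
    also have "\<dots> = Comp D (farr F a) (\<theta> (Src C a))"
    proof -
      have 1: "Comp D (farr F a) (\<theta> (Src C a)) \<in> Arr D"
        by (intro d(6)) (simp_all add: a s t f)
      have 2: "Tgt D (Comp D (farr F a) (\<theta> (Src C a))) = fobj F (Tgt C a)"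
        by (subst d(8)) (simp_all add: a s t f)
      show ?thesis using d(10)[OF 1] by (simp add: 2 t(4)[OF u])
    qed
    finally show ?thesis .
  qed
  then have "is_nat_transf C D F' \<theta> F"
    using t by (auto simp: is_nat_transf_def \<theta>_def)
  then show ?thesis using that t by blast
qed

section \<open>Torsors and transport functors\<close>

lemma is_torsorD:
  assumes "is_torsor G X"
  shows "pts (tmfd X) \<noteq> {}"
    and "\<lbrakk>x \<in> pts (tmfd X); g \<in> carrier G\<rbrakk> \<Longrightarrow> act X (x, g) \<in> pts (tmfd X)"
    and "x \<in> pts (tmfd X) \<Longrightarrow> act X (x, \<one>\<^bsub>G\<^esub>) = x"
    and "\<lbrakk>x \<in> pts (tmfd X); g \<in> carrier G; act X (x, g) = x\<rbrakk> \<Longrightarrow> g = \<one>\<^bsub>G\<^esub>"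
    and "\<lbrakk>x \<in> pts (tmfd X); y \<in> pts (tmfd X)\<rbrakk> \<Longrightarrow> \<exists>g\<in>carrier G. act X (x, g) = y"
  using assms by (auto simp: is_torsor_def)

lemma category_tors_cat: "category (tors_cat G)"
  unfolding category_def tors_cat_def
  by (auto simp: is_torsorD compose_def fun_eq_iff PiE_iff extensional_def)

text \<open>Injective: if \<open>f x = f y\<close>, write \<open>y\<close> as \<open>x\<close> moved
  by \<open>g\<close>; equivariance makes \<open>g\<close> fix \<open>f x\<close>, so
  \<open>g\<close> is the unit because the action on \<open>Y\<close> is free. Surjective: the
  action on \<open>Y\<close> is transitive, so any \<open>y\<close> is reached from the image of one
  fixed point, and equivariance moves the group element into the argument of
  \<open>f\<close>.\<close>

lemma tors_cat_bij_betw: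
  assumes f: "(X, f, Y) \<in> Arr (tors_cat G)"
  shows "bij_betw f (pts (tmfd X)) (pts (tmfd Y))"
proof -
  have X: "is_torsor G X" and Y: "is_torsor G Y" and fP: "f \<in> pts (tmfd X) \<rightarrow>\<^sub>E pts (tmfd Y)"
    and eqv: "\<And>x g. x \<in> pts (tmfd X) \<Longrightarrow> g \<in> carrier G \<Longrightarrow> f (act X (x, g)) = act Y (f x, g)"
    using f by (auto simp: tors_cat_def)
  have "inj_on f (pts (tmfd X))"
  proof (rule inj_onI)
    fix x y assume x: "x \<in> pts (tmfd X)" and y: "y \<in> pts (tmfd X)" and eq: "f x = f y"
    obtain g where g: "g \<in> carrier G" "act X (x, g) = y"
      using is_torsorD(5)[OF X x y] by blast
    have "act Y (f x, g) = f x"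
      using eqv[OF x g(1)] g eq by simp
    moreover have "f x \<in> pts (tmfd Y)" using fP x by blast
    ultimately have "g = \<one>\<^bsub>G\<^esub>"
      using is_torsorD(4)[OF Y] g(1) by blast
    then show "x = y"
      using is_torsorD(3)[OF X x] g(2) by simp
  qed
  moreover have "pts (tmfd Y) \<subseteq> f ` pts (tmfd X)"
  proof
    fix y assume y: "y \<in> pts (tmfd Y)"
    obtain x where x: "x \<in> pts (tmfd X)"
      using is_torsorD(1)[OF X] by blast
    have "f x \<in> pts (tmfd Y)" using fP x by blast
    then obtain g where g: "g \<in> carrier G" "act Y (f x, g) = y"
      using is_torsorD(5)[OF Y _ y] by blast
    have "act X (x, g) \<in> pts (tmfd X)"
      using is_torsorD(2)[OF X x g(1)] .
    then show "y \<in> f ` pts (tmfd X)"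
      using eqv[OF x g(1)] g(2) by force
  qed
  ultimately show ?thesis
    using fP by (auto simp: bij_betw_def)
qed

text \<open>Arrows of \<open>tors_cat G\<close> are equivariant maps without a smoothness condition,
  so the inverse bijection has only to be equivariant.\<close>

lemma groupoid_tors_cat: "groupoid (tors_cat G)"
proof (rule groupoidI[OF category_tors_cat])
  fix a assume a: "a \<in> Arr (tors_cat G)"
  obtain X f Y where [simp]: "a = (X, f, Y)" by (cases a) auto
  have X: "is_torsor G X" and Y: "is_torsor G Y" and fP: "f \<in> pts (tmfd X) \<rightarrow>\<^sub>E pts (tmfd Y)"
    and eqv: "\<And>x g. x \<in> pts (tmfd X) \<Longrightarrow> g \<in> carrier G \<Longrightarrow> f (act X (x, g)) = act Y (f x, g)"
    using a by (auto simp: tors_cat_def)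
  have bij: "bij_betw f (pts (tmfd X)) (pts (tmfd Y))"
    using a tors_cat_bij_betw by simp
  define h where "h = restrict (inv_into (pts (tmfd X)) f) (pts (tmfd Y))"
  have hP: "h \<in> pts (tmfd Y) \<rightarrow>\<^sub>E pts (tmfd X)"
    using bij_betw_apply[OF bij_betw_inv_into[OF bij]] by (auto simp: h_def)
  have fh: "f (h y) = y" if "y \<in> pts (tmfd Y)" for y
    using bij that by (simp add: h_def bij_betw_inv_into_right)
  have hf: "h (f x) = x" if "x \<in> pts (tmfd X)" for x
    using bij that fP by (auto simp: h_def bij_betw_inv_into_left)
  \<comment> \<open>Apply \<open>h\<close> to \<open>f (act X (h y, g)) = act Y (y, g)\<close>,
    which is the equivariance of \<open>f\<close> at \<open>h y\<close>.\<close>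
  have "h (act Y (y, g)) = act X (h y, g)" if y: "y \<in> pts (tmfd Y)" and g: "g \<in> carrier G" for y g
  proof -
    have hy: "h y \<in> pts (tmfd X)" using hP y by blast
    then have "act X (h y, g) \<in> pts (tmfd X)"
      using is_torsorD(2)[OF X _ g] by blast
    then show ?thesis using hf eqv[OF hy g] fh[OF y] by metis
  qed
  then have "(Y, h, X) \<in> Arr (tors_cat G)"
    using X Y hP by (auto simp: tors_cat_def)
  moreover have "compose (pts (tmfd X)) h f = (\<lambda>x\<in>pts (tmfd X). x)"
    "compose (pts (tmfd Y)) f h = (\<lambda>x\<in>pts (tmfd Y). x)"
    using fh hf by (auto simp: compose_def fun_eq_iff)
  ultimately show "\<exists>b\<in>Arr (tors_cat G). Src (tors_cat G) b = Tgt (tors_cat G) a \<and>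
      Tgt (tors_cat G) b = Src (tors_cat G) a \<and>
      Comp (tors_cat G) b a = Ident (tors_cat G) (Src (tors_cat G) a) \<and>
      Comp (tors_cat G) a b = Ident (tors_cat G) (Tgt (tors_cat G) a)"
    by (intro bexI[of _ "(Y, h, X)"]) (auto simp: tors_cat_def)
qed

section \<open>The groupoid of transport functors on one manifold\<close>

lemma trans_cat_sel [simp]:
  "Obj (trans_cat G M) = {F. is_transport G M F}"
  "Src (trans_cat G M) (F, \<eta>, F') = F"
  "Tgt (trans_cat G M) (F, \<eta>, F') = F'"
  "Ident (trans_cat G M) F = (F, \<lambda>x\<in>pts M. Ident (tors_cat G) (fobj F x), F)"
  "Comp (trans_cat G M) (E, \<theta>, F'') (F, \<eta>, F') =
     (F, \<lambda>x\<in>pts M. Comp (tors_cat G) (\<theta> x) (\<eta> x), F'')"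
  "(F, \<eta>, F') \<in> Arr (trans_cat G M) \<longleftrightarrow> is_transport G M F \<and> is_transport G M F' \<and>
     is_nat_transf (thin_gpd M) (tors_cat G) F \<eta> F'"
  by (simp_all add: trans_cat_def)

lemma Obj_thin_gpd [simp]: "Obj (thin_gpd M) = pts M"
  by (simp add: thin_gpd_def)

lemma is_transport_functor: "is_transport G M F \<Longrightarrow> is_functor (thin_gpd M) (tors_cat G) F"
  by (simp add: is_transport_def)

text \<open>All laws hold componentwise in \<open>tors_cat G\<close>. The unit laws also use that a
  natural transformation is extensional on \<open>pts M\<close>, since every composite is a
  restriction to \<open>pts M\<close>.\<close>

lemma category_trans_cat:
  fixes G :: "'g lie" and M :: "'m mfd"
  assumes C: "\<And>c. c \<in> Arr (thin_gpd M) \<Longrightarrow> Src (thin_gpd M) c \<in> pts M \<and> Tgt (thin_gpd M) c \<in> pts M"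
  shows "category (trans_cat G M :: (('m, 't, 'g) trans_obj, ('m, 't, 'g) trans_arr) cat)"
    (is "category ?T")
proof -
  let ?C = "thin_gpd M" and ?D = "tors_cat G"
  note d = categoryD[OF category_tors_cat[of G]]
  have id: "is_nat_transf ?C ?D F (\<lambda>x\<in>pts M. Ident ?D (fobj F x)) F" if "is_transport G M F" for F
    using is_nat_transf_id[of ?C ?D F] C that category_tors_cat[of G]
    by (simp add: is_transport_functor)
  have comp: "is_nat_transf ?C ?D F (\<lambda>x\<in>pts M. Comp ?D (\<theta> x) (\<eta> x)) F''"
    if "is_transport G M F" "is_transport G M F'" "is_transport G M F''"
      "is_nat_transf ?C ?D F \<eta> F'" "is_nat_transf ?C ?D F' \<theta> F''" for F F' F'' \<eta> \<theta>
    using is_nat_transf_comp[of ?C ?D F F' F'' \<eta> \<theta>] C that category_tors_cat[of G]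
    by (simp add: is_transport_functor)
  have restr: "(\<lambda>x\<in>pts M. \<eta> x) = \<eta>" if "is_nat_transf ?C ?D F \<eta> F'" for F F' \<eta>
    using is_nat_transfD(2)[OF that] by (simp add: extensional_restrict)
  have right: "(\<lambda>x\<in>pts M. Comp ?D (\<eta> x) ((\<lambda>x\<in>pts M. Ident ?D (fobj F x)) x)) = \<eta>"
    if n: "is_nat_transf ?C ?D F \<eta> F'" for F F' \<eta>
  proof -
    have "Comp ?D (\<eta> x) (Ident ?D (fobj F x)) = \<eta> x" if "x \<in> pts M" for x
      using that is_nat_transfD[OF n] d(9)[of "\<eta> x"] by simp
    then show ?thesis by (subst (2) restr[OF n, symmetric]) (auto intro: restrict_ext)
  qed
  have left: "(\<lambda>x\<in>pts M. Comp ?D ((\<lambda>x\<in>pts M. Ident ?D (fobj F' x)) x) (\<eta> x)) = \<eta>"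
    if n: "is_nat_transf ?C ?D F \<eta> F'" for F F' \<eta>
  proof -
    have "Comp ?D (Ident ?D (fobj F' x)) (\<eta> x) = \<eta> x" if "x \<in> pts M" for x
      using that is_nat_transfD[OF n] d(10)[of "\<eta> x"] by simp
    then show ?thesis by (subst (2) restr[OF n, symmetric]) (auto intro: restrict_ext)
  qed
  have assoc: "Comp ?D (\<kappa> x) (Comp ?D (\<theta> x) (\<eta> x)) = Comp ?D (Comp ?D (\<kappa> x) (\<theta> x)) (\<eta> x)"
    if "is_nat_transf ?C ?D F \<eta> F'" "is_nat_transf ?C ?D F' \<theta> F''" "is_nat_transf ?C ?D F'' \<kappa> F'''"
      "x \<in> pts M" for F F' F'' F''' \<eta> \<theta> \<kappa> x
    using that by (intro d(11)) (simp_all add: is_nat_transfD)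
  show ?thesis
    unfolding category_def
  proof (intro conjI ballI impI)
    fix a assume a: "a \<in> Arr ?T"
    obtain F \<eta> F' where [simp]: "a = (F, \<eta>, F')" by (cases a) auto
    note a' = a[simplified]
    show "Src ?T a \<in> Obj ?T"
      "Tgt ?T a \<in> Obj ?T"
      using a' by simp_all
    show "Comp ?T a (Ident ?T (Src ?T a)) = a"
      "Comp ?T (Ident ?T (Tgt ?T a)) a = a"
      using a' left[of F \<eta> F'] right[of F \<eta> F'] by (simp_all only: trans_cat_sel \<open>a = (F, \<eta>, F')\<close>)
    fix b assume b: "b \<in> Arr ?T"
    obtain E \<theta> E' where [simp]: "b = (E, \<theta>, E')" by (cases b) auto
    note b' = b[simplified]
    { assume "Src ?T b = Tgt ?T a"
      then have [simp]: "E = F'" by simp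
      show "Comp ?T b a \<in> Arr ?T"
        using a' b' comp[of F F' E' \<eta> \<theta>] by simp
      show "Src ?T (Comp ?T b a) = Src ?T a"
        "Tgt ?T (Comp ?T b a) = Tgt ?T b"
        by simp_all }
    fix c assume c: "c \<in> Arr ?T"
    obtain K \<kappa> K' where [simp]: "c = (K, \<kappa>, K')" by (cases c) auto
    assume "Src ?T b = Tgt ?T a \<and> Src ?T c = Tgt ?T b"
    then show "Comp ?T c (Comp ?T b a) =
        Comp ?T (Comp ?T c b) a"
      using a' b' c by (auto simp: fun_eq_iff assoc)
  next
    fix F assume "F \<in> Obj ?T"
    then show "Ident ?T F \<in> Arr ?T"
      "Src ?T (Ident ?T F) = F"
      "Tgt ?T (Ident ?T F) = F"
      using id by simp_all
  qed
qed

text \<open>Morphisms are arbitrary natural transformations, so the componentwise inverse in the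
  groupoid \<open>tors_cat G\<close> is again a morphism.\<close>

lemma groupoid_trans_cat:
  fixes G :: "'g lie" and M :: "'m mfd"
  assumes C: "\<And>c. c \<in> Arr (thin_gpd M) \<Longrightarrow> Src (thin_gpd M) c \<in> pts M \<and> Tgt (thin_gpd M) c \<in> pts M"
  shows "groupoid (trans_cat G M :: (('m, 't, 'g) trans_obj, ('m, 't, 'g) trans_arr) cat)"
    (is "groupoid ?T")
proof (rule groupoidI[OF category_trans_cat[OF C]])
  fix a assume a: "a \<in> Arr ?T"
  obtain F \<eta> F' where [simp]: "a = (F, \<eta>, F')" by (cases a) auto
  note a' = a[simplified]
  obtain \<theta> where \<theta>: "is_nat_transf (thin_gpd M) (tors_cat G) F' \<theta> F"
    "\<And>x. x \<in> Obj (thin_gpd M) \<Longrightarrow> Comp (tors_cat G) (\<theta> x) (\<eta> x) = Ident (tors_cat G) (fobj F x)"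
    "\<And>x. x \<in> Obj (thin_gpd M) \<Longrightarrow> Comp (tors_cat G) (\<eta> x) (\<theta> x) = Ident (tors_cat G) (fobj F' x)"
    using is_nat_transf_inverse[of "thin_gpd M" "tors_cat G" F F' \<eta>] C groupoid_tors_cat a'
    by (auto simp: is_transport_functor)
  show "\<exists>b\<in>Arr ?T. Src ?T b = Tgt ?T a \<and>
      Tgt ?T b = Src ?T a \<and>
      Comp ?T b a = Ident ?T (Src ?T a) \<and>
      Comp ?T a b = Ident ?T (Tgt ?T a)"
    using a' \<theta> by (intro bexI[of _ "(F', \<theta>, F)"]) (auto simp: fun_eq_iff)
qed

section \<open>Functions of class $C^k$ on open subsets of Euclidean space\<close>

lemma Euclidean_space_upd:
  "x \<in> topspace (Euclidean_space n) \<Longrightarrow> i < n \<Longrightarrow> x(i := t) \<in> topspace (Euclidean_space n)"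
  by (auto simp: topspace_Euclidean_space)

text \<open>An open set of the product topology contains a product of open sets around each of its
  points. The coordinates from \<open>n\<close> on are 0 for both points, so a common radius for the
  first \<open>n\<close> coordinates suffices.\<close>

lemma openin_Euclidean_space_box:
  assumes U: "openin (Euclidean_space n) U" and x: "x \<in> U"
  obtains \<delta> where "\<delta> > 0"
    and "\<And>y. y \<in> topspace (Euclidean_space n) \<Longrightarrow> (\<And>i. i < n \<Longrightarrow> \<bar>y i - x i\<bar> < \<delta>) \<Longrightarrow> y \<in> U"
proof -
  obtain T where T: "openin (powertop_real UNIV) T" and UT: "U = T \<inter> {x. \<forall>i\<ge>n. x i = 0}"
    using U by (auto simp: Euclidean_space_def openin_subtopology)
  have xT: "x \<in> T" and x0: "\<forall>i\<ge>n. x i = 0" using x UT by auto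
  obtain X where X: "finite {i. X i \<noteq> UNIV}" "\<And>i. open (X i)" "x \<in> Pi\<^sub>E UNIV X" "Pi\<^sub>E UNIV X \<subseteq> T"
    using T xT unfolding openin_product_topology_alt by auto
  have "\<forall>i. \<exists>e>0. ball (x i) e \<subseteq> X i"
    using X(2,3) open_contains_ball by (metis PiE_UNIV_domain Pi_iff UNIV_I)
  then obtain e where e: "\<And>i. e i > 0" "\<And>i. ball (x i) (e i) \<subseteq> X i" by metis
  \<comment> \<open>The element 1 keeps the set nonempty when \<open>n = 0\<close>.\<close>
  define \<delta> where "\<delta> = Min (insert 1 (e ` {..<n}))"
  have "\<delta> > 0" using e by (auto simp: \<delta>_def)
  moreover have "y \<in> U" if y: "y \<in> topspace (Euclidean_space n)"
    and le: "\<And>i. i < n \<Longrightarrow> \<bar>y i - x i\<bar> < \<delta>" for y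
  proof -
    have "y i \<in> X i" for i
    proof (cases "i < n")
      case True
      then have "\<delta> \<le> e i" by (auto simp: \<delta>_def)
      then show ?thesis using le[OF True] e(2)[of i] by (auto simp: dist_real_def abs_minus_commute)
    next
      case False
      then have "y i = x i" using y x0 by (auto simp: topspace_Euclidean_space)
      then show ?thesis using e[of i] by auto
    qed
    then show ?thesis using X(4) UT y by (auto simp: topspace_Euclidean_space)
  qed
  ultimately show ?thesis using that by blast
qed

lemma eventually_upd_in_openin:
  assumes "openin (Euclidean_space n) U" "x \<in> U" "i < n"
  shows "\<forall>\<^sub>F t in nhds (x i). x(i := t) \<in> U"
proof -
  obtain \<delta> where \<delta>: "\<delta> > 0"
    "\<And>y. y \<in> topspace (Euclidean_space n) \<Longrightarrow> (\<And>i. i < n \<Longrightarrow> \<bar>y i - x i\<bar> < \<delta>) \<Longrightarrow> y \<in> U"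
    using openin_Euclidean_space_box[OF assms(1,2)] by metis
  have x: "x \<in> topspace (Euclidean_space n)"
    using assms openin_subset by blast
  show ?thesis
    unfolding eventually_nhds_metric
    using \<delta> Euclidean_space_upd[OF x assms(3)] by (intro exI[of _ \<delta>]) (auto simp: dist_real_def)
qed

lemma Ck_on_continuous:
  "Ck_on k n U f \<Longrightarrow> continuous_map (subtopology (Euclidean_space n) U) euclideanreal f"
  by (cases k) auto

lemma Ck_on_SucD:
  assumes "Ck_on (Suc k) n U f" "i < n"
  shows "\<exists>g. (\<forall>x\<in>U. ((\<lambda>t. f (x(i := t))) has_real_derivative g x) (at (x i))) \<and> Ck_on k n U g"
  using assms unfolding Ck_on.simps by blast

text \<open>A partial derivative at a point of \<open>U\<close> sees only nearby points, and
  openness keeps \<open>x(i := t)\<close> in \<open>U\<close> for \<open>t\<close> near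
  \<open>x i\<close>. The partial derivatives of \<open>f\<close> therefore serve for
  \<open>f'\<close> unchanged, and no induction on \<open>k\<close> arises.\<close>

lemma Ck_on_cong:
  assumes "openin (Euclidean_space n) U" and eq: "\<And>x. x \<in> U \<Longrightarrow> f x = f' x" and f: "Ck_on k n U f"
  shows "Ck_on k n U f'"
proof -
  have "continuous_map (subtopology (Euclidean_space n) U) euclideanreal f'"
    using Ck_on_continuous[OF f] by (rule continuous_map_eq) (auto simp: eq)
  moreover have der: "((\<lambda>t. f' (x(i := t))) has_real_derivative D) (at (x i))"
    if "((\<lambda>t. f (x(i := t))) has_real_derivative D) (at (x i))" "x \<in> U" "i < n" for x i D
  proof -
    have "\<forall>\<^sub>F t in nhds (x i). f (x(i := t)) = f' (x(i := t))"
      using eventually_upd_in_openin[OF assms(1) that(2,3)] by eventually_elim (rule eq)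
    then show ?thesis using that(1) DERIV_cong_ev[OF refl _ refl] by metis
  qed
  moreover have "\<exists>g. (\<forall>x\<in>U. ((\<lambda>t. f' (x(i := t))) has_real_derivative g x) (at (x i))) \<and> Ck_on l n U g"
    if k: "k = Suc l" and i: "i < n" for l i
  proof -
    obtain g where g: "\<forall>x\<in>U. ((\<lambda>t. f (x(i := t))) has_real_derivative g x) (at (x i))"
      and "Ck_on l n U g"
      using Ck_on_SucD[OF f[unfolded k] i] by blast
    then show ?thesis using g der[OF _ _ i] by (intro exI[of _ g] conjI ballI) blast+
  qed
  ultimately show ?thesis by (cases k) simp_all
qed

lemma Ck_on_const: "Ck_on k n U (\<lambda>x. c)"
  by (induction k arbitrary: c) (auto intro!: exI[of _ "\<lambda>x. 0"])

lemma Ck_on_cmult: "Ck_on k n U f \<Longrightarrow> Ck_on k n U (\<lambda>x. c * f x)"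
proof (induction k arbitrary: f)
  case 0
  then show ?case by (auto intro: continuous_intros)
next
  case (Suc k)
  have "\<exists>h. (\<forall>x\<in>U. ((\<lambda>t. c * f (x(i := t))) has_real_derivative h x) (at (x i))) \<and> Ck_on k n U h"
    if "i < n" for i
  proof -
    obtain g where "\<forall>x\<in>U. ((\<lambda>t. f (x(i := t))) has_real_derivative g x) (at (x i))" "Ck_on k n U g"
      using Ck_on_SucD[OF Suc.prems \<open>i < n\<close>] by blast
    then show ?thesis using Suc.IH by (intro exI[of _ "\<lambda>x. c * g x"]) (auto intro: DERIV_cmult)
  qed
  then show ?case using Suc.prems by (auto intro: continuous_intros)
qed

text \<open>With \<open>a j = 0\<close> a coordinate is frozen, as at the seam of two glued paths;
  with \<open>m\<close> smaller than the dimension of the argument, variables are dropped, as for a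
  homotopy that is constant in one variable.\<close>

definition coord_affine ::
    "nat \<Rightarrow> (nat \<Rightarrow> nat) \<Rightarrow> (nat \<Rightarrow> real) \<Rightarrow> (nat \<Rightarrow> real) \<Rightarrow> (nat \<Rightarrow> real) \<Rightarrow> (nat \<Rightarrow> real)" where
  "coord_affine m \<sigma> a b x = (\<lambda>j. if j < m then a j * x (\<sigma> j) + b j else 0)"

lemma continuous_map_Euclidean_space_coord:
  "continuous_map (subtopology (Euclidean_space n) V) euclideanreal (\<lambda>x. x i)"
  unfolding Euclidean_space_def
  by (intro continuous_map_from_subtopology continuous_map_product_projection) auto

lemma continuous_map_coord_affine:
  "continuous_map (subtopology (Euclidean_space n) V) (Euclidean_space m) (coord_affine m \<sigma> a b)"
  unfolding coord_affine_def [abs_def] continuous_map_componentwise_Euclidean_space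
  by (intro allI impI continuous_intros continuous_map_Euclidean_space_coord)

lemma continuous_map_comp_coord_affine:
  assumes "coord_affine m \<sigma> a b ` V \<subseteq> U"
    and f: "continuous_map (subtopology (Euclidean_space m) U) X f"
  shows "continuous_map (subtopology (Euclidean_space n) V) X (\<lambda>x. f (coord_affine m \<sigma> a b x))"
proof -
  have "continuous_map (subtopology (Euclidean_space n) V) (subtopology (Euclidean_space m) U)
      (coord_affine m \<sigma> a b)"
    using assms(1) continuous_map_coord_affine by (auto simp: continuous_map_in_subtopology)
  from continuous_map_compose[OF this f] show ?thesis by (simp add: o_def)
qed

text \<open>As \<open>\<sigma>\<close> is injective, each variable enters at most one component of the affine map, so only
  the chain rule in one variable is needed.\<close>

lemma Ck_on_coord_affine:
  assumes \<sigma>: "inj_on \<sigma> {..<m}"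
    and V: "V \<subseteq> topspace (Euclidean_space n)"
    and VU: "coord_affine m \<sigma> a b ` V \<subseteq> U"
  shows "Ck_on k m U f \<Longrightarrow> Ck_on k n V (\<lambda>x. f (coord_affine m \<sigma> a b x))"
proof (induction k arbitrary: f)
  case 0
  then show ?case using continuous_map_comp_coord_affine[OF VU] by simp
next
  case (Suc k)
  have "\<exists>h. (\<forall>x\<in>V. ((\<lambda>t. f (coord_affine m \<sigma> a b (x(i := t)))) has_real_derivative h x) (at (x i)))
          \<and> Ck_on k n V h" for i
  proof (cases "\<exists>j<m. \<sigma> j = i")
    case True
    then obtain j where j: "j < m" "\<sigma> j = i" by blast
    obtain g where g: "\<forall>y\<in>U. ((\<lambda>t. f (y(j := t))) has_real_derivative g y) (at (y j))"
      and Cg: "Ck_on k m U g"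
      using Ck_on_SucD[OF Suc.prems j(1)] by blast
    have "((\<lambda>t. f (coord_affine m \<sigma> a b (x(i := t)))) has_real_derivative
            a j * g (coord_affine m \<sigma> a b x)) (at (x i))" if x: "x \<in> V" for x
    proof -
      have upd: "coord_affine m \<sigma> a b (x(i := t)) = (coord_affine m \<sigma> a b x)(j := a j * t + b j)" for t
        using j \<sigma> by (auto simp: coord_affine_def fun_eq_iff inj_on_def)
      have 1: "((\<lambda>t. f ((coord_affine m \<sigma> a b x)(j := t))) has_real_derivative
          g (coord_affine m \<sigma> a b x)) (at (a j * x i + b j))"
        using bspec[OF g, of "coord_affine m \<sigma> a b x"] VU x j by (auto simp: coord_affine_def)
      have 2: "((\<lambda>t. a j * t + b j) has_real_derivative a j) (at (x i))"
        by (auto intro!: derivative_eq_intros)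
      show ?thesis
        using DERIV_chain2[of "\<lambda>t. f ((coord_affine m \<sigma> a b x)(j := t))", OF 1 2] by (simp add: upd mult.commute)
    qed
    then show ?thesis
      using Ck_on_cmult[OF Suc.IH[OF Cg], of "a j"]
      by (intro exI[of _ "\<lambda>x. a j * g (coord_affine m \<sigma> a b x)"]) simp
  next
    case False
    then have "coord_affine m \<sigma> a b (x(i := t)) = coord_affine m \<sigma> a b x" for x t
      by (auto simp: coord_affine_def fun_eq_iff)
    then show ?thesis
      by (intro exI[of _ "\<lambda>x. 0"]) (simp add: Ck_on_const)
  qed
  moreover have "continuous_map (subtopology (Euclidean_space n) V) euclideanreal
      (\<lambda>x. f (coord_affine m \<sigma> a b x))"
    by (rule continuous_map_comp_coord_affine[OF VU Ck_on_continuous[OF Suc.prems]])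
  ultimately show ?case by simp
qed

text \<open>Differentiability from continuous partial derivatives: go from \<open>x\<close> to
  \<open>y\<close> changing one coordinate at a time. On each leg, \<open>f\<close> minus its linear
  part has a derivative of size at most \<open>e\<close>, and the errors add up.\<close>

lemma Ck_on_first_order:
  assumes U: "openin (Euclidean_space n) U" and x: "x \<in> U"
    and der: "\<And>i y. i < n \<Longrightarrow> y \<in> U \<Longrightarrow> ((\<lambda>t. f (y(i := t))) has_real_derivative g i y) (at (y i))"
    and cont: "\<And>i. i < n \<Longrightarrow> continuous_map (subtopology (Euclidean_space n) U) euclideanreal (g i)"
    and e: "e > 0"
  shows "\<exists>\<delta>>0. \<forall>y\<in>topspace (Euclidean_space n). (\<forall>i<n. \<bar>y i - x i\<bar> < \<delta>) \<longrightarrow>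
      y \<in> U \<and> \<bar>f y - f x - (\<Sum>i<n. g i x * (y i - x i))\<bar> \<le> e * (\<Sum>i<n. \<bar>y i - x i\<bar>)"
proof -
  have xE: "x \<in> topspace (Euclidean_space n)" using x U openin_subset by blast
  \<comment> \<open>On this neighbourhood all partial derivatives stay within \<open>e\<close> of
    their values at \<open>x\<close>.\<close>
  define V where "V = {y \<in> U. \<forall>i<n. g i y \<in> ball (g i x) e}"
  have "openin (Euclidean_space n) V"
  proof -
    have "openin (Euclidean_space n) {y \<in> U. g i y \<in> ball (g i x) e}" if "i < n" for i
    proof -
      have "openin (subtopology (Euclidean_space n) U)
          {y \<in> topspace (subtopology (Euclidean_space n) U). g i y \<in> ball (g i x) e}"
        using cont[OF that] by (rule openin_continuous_map_preimage) (simp add: open_openin[symmetric])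
      moreover have "topspace (subtopology (Euclidean_space n) U) = U"
        using U openin_subset by auto
      ultimately show ?thesis using U openin_trans_full by fastforce
    qed
    then have "openin (Euclidean_space n) (U \<inter> (\<Inter>i<n. {y \<in> U. g i y \<in> ball (g i x) e}))"
      using U by (cases "n = 0") (auto intro!: openin_Int openin_INT2)
    moreover have "U \<inter> (\<Inter>i<n. {y \<in> U. g i y \<in> ball (g i x) e}) = V"
      by (auto simp: V_def)
    ultimately show ?thesis by simp
  qed
  moreover have "x \<in> V" using x e by (simp add: V_def)
  ultimately obtain \<delta> where \<delta>: "\<delta> > 0"
    "\<And>y. y \<in> topspace (Euclidean_space n) \<Longrightarrow> (\<And>i. i < n \<Longrightarrow> \<bar>y i - x i\<bar> < \<delta>) \<Longrightarrow> y \<in> V"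
    using openin_Euclidean_space_box by metis
  show ?thesis
  proof (intro exI[of _ \<delta>] conjI[OF \<delta>(1)] ballI impI)
    fix y assume y: "y \<in> topspace (Euclidean_space n)" and "\<forall>i<n. \<bar>y i - x i\<bar> < \<delta>"
    then have lt: "\<bar>y i - x i\<bar> < \<delta>" if "i < n" for i using that by blast
    \<comment> \<open>The corners of a path from \<open>x\<close> to \<open>y\<close> parallel to
      the axes; leg \<open>k\<close> changes coordinate \<open>k\<close> only.\<close>
    define z where "z k = (\<lambda>i. if i < k then y i else x i)" for k
    have step: "\<bar>f (z (Suc k)) - f (z k) - g k x * (y k - x k)\<bar> \<le> e * \<bar>y k - x k\<bar>" if k: "k < n" for k
    proof -
      have zu: "z (Suc k) = (z k)(k := y k)" "z k = (z k)(k := x k)"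
        by (auto simp: z_def fun_eq_iff)
      have inV: "(z k)(k := t) \<in> V" if "t \<in> closed_segment (x k) (y k)" for t
      proof (rule \<delta>(2))
        show "(z k)(k := t) \<in> topspace (Euclidean_space n)"
          using xE y k by (auto simp: topspace_Euclidean_space z_def)
        have "\<bar>t - x k\<bar> \<le> \<bar>y k - x k\<bar>"
          using that by (auto simp: closed_segment_eq_real_ivl split: if_splits)
        then show "\<bar>((z k)(k := t)) i - x i\<bar> < \<delta>" if "i < n" for i
          using lt[OF that] lt[OF k] \<delta>(1) by (auto simp: z_def)
      qed
      \<comment> \<open>Mean value inequality in the variable \<open>k\<close>; the linear part is
        subtracted so that the remaining derivative is small.\<close>
      have "norm ((f ((z k)(k := y k)) - g k x * y k) - (f ((z k)(k := x k)) - g k x * x k))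
          \<le> e * norm (y k - x k)"
      proof (rule differentiable_bound[where S = "closed_segment (x k) (y k)" and
            f = "\<lambda>t. f ((z k)(k := t)) - g k x * t" and
            f' = "\<lambda>t h. (g k ((z k)(k := t)) - g k x) * h"])
        fix t assume t: "t \<in> closed_segment (x k) (y k)"
        have "((\<lambda>t. f ((z k)(k := t)) - g k x * t) has_real_derivative
            (g k ((z k)(k := t)) - g k x)) (at t)"
        proof -
          have "((\<lambda>t. f ((z k)(k := t))) has_real_derivative g k ((z k)(k := t))) (at t)"
            using der[OF k, of "(z k)(k := t)"] inV[OF t] by (auto simp: V_def)
          then show ?thesis by (auto intro!: derivative_eq_intros)
        qed
        then show "((\<lambda>t. f ((z k)(k := t)) - g k x * t) has_derivative
            (\<lambda>h. (g k ((z k)(k := t)) - g k x) * h)) (at t within closed_segment (x k) (y k))"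
          unfolding has_field_derivative_def by (rule has_derivative_at_withinI)
        show "onorm (\<lambda>h. (g k ((z k)(k := t)) - g k x) * h) \<le> e"
        proof (rule onorm_bound)
          have "\<bar>g k ((z k)(k := t)) - g k x\<bar> \<le> e"
            using inV[OF t] k by (auto simp: V_def dist_real_def abs_minus_commute intro: less_imp_le)
          then show "norm ((g k ((z k)(k := t)) - g k x) * h) \<le> e * norm h" for h
            by (simp add: abs_mult mult_right_mono)
        qed (use e in simp)
      qed auto
      then show ?thesis using zu by (simp add: algebra_simps)
    qed
    have ends: "z 0 = x" "z n = y"
      using xE y by (auto simp: z_def fun_eq_iff topspace_Euclidean_space)
    have "f y - f x - (\<Sum>i<n. g i x * (y i - x i)) =
        (\<Sum>k<n. f (z (Suc k)) - f (z k) - g k x * (y k - x k))"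
      using sum_lessThan_telescope[of "\<lambda>k. f (z k)" n] by (simp add: sum_subtractf ends)
    also have "\<bar>\<dots>\<bar> \<le> (\<Sum>k<n. e * \<bar>y k - x k\<bar>)"
      by (rule order_trans[OF sum_abs]) (auto intro!: sum_mono step)
    finally have "\<bar>f y - f x - (\<Sum>i<n. g i x * (y i - x i))\<bar> \<le> e * (\<Sum>i<n. \<bar>y i - x i\<bar>)"
      by (simp add: sum_distrib_left)
    moreover have "y \<in> U" using \<delta>(2)[OF y lt] by (simp add: V_def)
    ultimately show "y \<in> U \<and> \<bar>f y - f x - (\<Sum>i<n. g i x * (y i - x i))\<bar> \<le> e * (\<Sum>i<n. \<bar>y i - x i\<bar>)"
      by blast
  qed
qed

text \<open>\<open>L\<close> is quantified before the curve: it is the differential of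
  \<open>f\<close> at \<open>x\<close>, common to all curves through \<open>x\<close>. The expansion
  of \<open>f\<close> is divided by \<open>\<tau> - t\<close>; the remainder vanishes in the limit
  because the difference quotients of the curve are bounded.\<close>

lemma C1_chain_rule_curve:
  assumes U: "openin (Euclidean_space n) U" and f: "Ck_on 1 n U f" and x: "x \<in> U"
  shows "\<exists>L. \<forall>c c' t T. (\<forall>\<tau>\<in>T. c \<tau> \<in> topspace (Euclidean_space n)) \<longrightarrow> c t = x \<longrightarrow>
    (\<forall>i<n. ((\<lambda>\<tau>. c \<tau> i) has_real_derivative c' i) (at t within T)) \<longrightarrow>
    ((\<lambda>\<tau>. f (c \<tau>)) has_real_derivative (\<Sum>i<n. L i * c' i)) (at t within T)"
proof -
  have "\<forall>i. \<exists>g. i < n \<longrightarrow> (\<forall>y\<in>U. ((\<lambda>t. f (y(i := t))) has_real_derivative g y) (at (y i))) \<and>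
      continuous_map (subtopology (Euclidean_space n) U) euclideanreal g"
    using f unfolding One_nat_def Ck_on.simps by blast
  then obtain g where der: "\<And>i y. i < n \<Longrightarrow> y \<in> U \<Longrightarrow> ((\<lambda>t. f (y(i := t))) has_real_derivative g i y) (at (y i))"
    and cont: "\<And>i. i < n \<Longrightarrow> continuous_map (subtopology (Euclidean_space n) U) euclideanreal (g i)"
    by metis
  show ?thesis
  proof (intro exI[of _ "\<lambda>i. g i x"] allI impI)
    fix c c' t T
    assume "\<forall>\<tau>\<in>T. c \<tau> \<in> topspace (Euclidean_space n)" and ct: "c t = x"
      and "\<forall>i<n. ((\<lambda>\<tau>. c \<tau> i) has_real_derivative c' i) (at t within T)"
    then have cE: "\<And>\<tau>. \<tau> \<in> T \<Longrightarrow> c \<tau> \<in> topspace (Euclidean_space n)"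
      and c': "\<And>i. i < n \<Longrightarrow> ((\<lambda>\<tau>. c \<tau> i) has_real_derivative c' i) (at t within T)"
      by simp_all
    define R where "R \<tau> = f (c \<tau>) - f x - (\<Sum>i<n. g i x * (c \<tau> i - x i))" for \<tau>
    have quot: "((\<lambda>\<tau>. (c \<tau> i - x i) / (\<tau> - t)) \<longlongrightarrow> c' i) (at t within T)" if "i < n" for i
      using c'[OF that] ct by (simp add: has_field_derivative_iff)
    have eventually_at_in_self: "\<forall>\<^sub>F \<tau> in at t within T. \<tau> \<in> T \<and> \<tau> \<noteq> t"
      by (simp add: eventually_at_filter)
    \<comment> \<open>The summand 1 puts \<open>K\<close> strictly above the limit of the summed
      difference quotients, and above 0 even for a stationary curve.\<close>
    define K where "K = (\<Sum>i<n. \<bar>c' i\<bar>) + 1"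
    have K: "K > 0" by (simp add: K_def sum_nonneg add_nonneg_pos)
    have bound: "\<forall>\<^sub>F \<tau> in at t within T. (\<Sum>i<n. \<bar>(c \<tau> i - x i) / (\<tau> - t)\<bar>) < K"
    proof -
      have "((\<lambda>\<tau>. \<Sum>i<n. \<bar>(c \<tau> i - x i) / (\<tau> - t)\<bar>) \<longlongrightarrow> (\<Sum>i<n. \<bar>c' i\<bar>)) (at t within T)"
        by (intro tendsto_sum tendsto_rabs quot) simp
      then show ?thesis by (rule order_tendstoD) (simp add: K_def)
    qed
    have "((\<lambda>\<tau>. R \<tau> / (\<tau> - t)) \<longlongrightarrow> 0) (at t within T)"
    proof (rule tendstoI)
      fix e :: real assume e: "e > 0"
      \<comment> \<open>The expansion is used with error \<open>e / K\<close>, because the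
        difference quotients contribute a factor below \<open>K\<close>.\<close>
      have "e / K > 0" using e K by simp
      then obtain \<delta> where \<delta>: "\<delta> > 0"
        "\<forall>y\<in>topspace (Euclidean_space n). (\<forall>i<n. \<bar>y i - x i\<bar> < \<delta>) \<longrightarrow>
          y \<in> U \<and> \<bar>f y - f x - (\<Sum>i<n. g i x * (y i - x i))\<bar> \<le> e / K * (\<Sum>i<n. \<bar>y i - x i\<bar>)"
        using Ck_on_first_order[OF U x der cont \<open>e / K > 0\<close>] by blast
      have near: "\<forall>\<^sub>F \<tau> in at t within T. \<forall>i\<in>{..<n}. \<bar>c \<tau> i - x i\<bar> < \<delta>"
      proof (rule eventually_ball_finite)
        show "\<forall>i\<in>{..<n}. \<forall>\<^sub>F \<tau> in at t within T. \<bar>c \<tau> i - x i\<bar> < \<delta>"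
        proof
          fix i assume "i \<in> {..<n}"
          then have "((\<lambda>\<tau>. c \<tau> i) \<longlongrightarrow> c t i) (at t within T)"
            using c' has_field_derivative_imp_has_derivative has_derivative_continuous
            by (metis continuous_within lessThan_iff)
          then show "\<forall>\<^sub>F \<tau> in at t within T. \<bar>c \<tau> i - x i\<bar> < \<delta>"
            using \<delta>(1) ct by (auto simp: tendsto_iff dist_real_def)
        qed
      qed simp
      show "\<forall>\<^sub>F \<tau> in at t within T. dist (R \<tau> / (\<tau> - t)) 0 < e"
        using near bound eventually_at_in_self
      proof (eventually_elim)
        case (elim \<tau>)
        then have \<tau>: "\<tau> \<in> T" "\<tau> \<noteq> t" by auto
        have "\<bar>R \<tau>\<bar> \<le> e / K * (\<Sum>i<n. \<bar>c \<tau> i - x i\<bar>)"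
          unfolding R_def using bspec[OF \<delta>(2) cE[OF \<tau>(1)]] elim by blast
        then have "\<bar>R \<tau> / (\<tau> - t)\<bar> \<le> e / K * (\<Sum>i<n. \<bar>c \<tau> i - x i\<bar>) / \<bar>\<tau> - t\<bar>"
          unfolding abs_divide by (rule divide_right_mono) simp
        also have "\<dots> = e / K * (\<Sum>i<n. \<bar>(c \<tau> i - x i) / (\<tau> - t)\<bar>)"
          by (simp add: sum_divide_distrib[symmetric] mult.commute)
        also have "\<dots> < e / K * K"
          using elim e K by (intro mult_strict_left_mono) auto
        finally show ?case using K by simp
      qed
    qed
    then have "((\<lambda>\<tau>. (\<Sum>i<n. g i x * ((c \<tau> i - x i) / (\<tau> - t))) + R \<tau> / (\<tau> - t)) \<longlongrightarrow>
        (\<Sum>i<n. g i x * c' i) + 0) (at t within T)"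
      by (intro tendsto_add tendsto_sum tendsto_mult tendsto_const quot) simp_all
    \<comment> \<open>At \<open>\<tau> = t\<close> both sides are 0, since division by zero yields
      0.\<close>
    moreover have "(\<Sum>i<n. g i x * ((c \<tau> i - x i) / (\<tau> - t))) + R \<tau> / (\<tau> - t) =
        (f (c \<tau>) - f (c t)) / (\<tau> - t)" for \<tau>
      by (simp add: R_def ct diff_divide_distrib sum_divide_distrib right_diff_distrib)
    ultimately show "((\<lambda>\<tau>. f (c \<tau>)) has_real_derivative (\<Sum>i<n. g i x * c' i)) (at t within T)"
      by (simp add: has_field_derivative_iff)
  qed
qed

section \<open>Manifolds and their plots\<close>

lemma openin_Euclidean_space_slab:
  "openin (Euclidean_space n) {x \<in> topspace (Euclidean_space n). \<bar>x i - c\<bar> < \<delta>}"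
proof -
  have "continuous_map (Euclidean_space n) euclideanreal (\<lambda>x. x i)"
    using continuous_map_Euclidean_space_coord[of n UNIV i] by simp
  moreover have "openin euclideanreal (ball c \<delta>)" by simp
  ultimately have "openin (Euclidean_space n) {x \<in> topspace (Euclidean_space n). x i \<in> ball c \<delta>}"
    by (rule openin_continuous_map_preimage)
  then show ?thesis by (simp add: dist_real_def abs_minus_commute)
qed

lemma smooth_euclD:
  assumes "smooth_eucl n U m f"
  shows "openin (Euclidean_space n) U"
    and "u \<in> U \<Longrightarrow> f u \<in> topspace (Euclidean_space m)"
    and "j < m \<Longrightarrow> Ck_on k n U (\<lambda>x. f x j)"
  using assms unfolding smooth_eucl_def by blast+

lemma smooth_eucl_cong:
  assumes f: "smooth_eucl n U m f" and eq: "\<And>u. u \<in> U \<Longrightarrow> f u = f' u"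
  shows "smooth_eucl n U m f'"
  unfolding smooth_eucl_def
proof (intro conjI allI impI)
  show U: "openin (Euclidean_space n) U" by (rule smooth_euclD(1)[OF f])
  show "f' \<in> U \<rightarrow> topspace (Euclidean_space m)"
    using smooth_euclD(2)[OF f] eq by fastforce
  show "Ck_on k n U (\<lambda>x. f' x j)" if "j < m" for j k
    by (rule Ck_on_cong[OF U _ smooth_euclD(3)[OF f that]]) (simp add: eq)
qed

lemma dsmoothD:
  assumes "dsmooth A B f"
  shows "x \<in> dset A \<Longrightarrow> f x \<in> dset B"
    and "dplot A n U p \<Longrightarrow> dplot B n U (f \<circ> p)"
  using assms unfolding dsmooth_def by auto

lemma mfd_diff_sel:
  "dset (mfd_diff M) = pts M"
  "dplot (mfd_diff M) n U p \<longleftrightarrow> openin (Euclidean_space n) U \<and>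
     continuous_map (subtopology (Euclidean_space n) U) (mtop M) p \<and>
     (\<forall>(W, \<phi>)\<in>atlas M. smooth_eucl n {u \<in> U. p u \<in> W} (mdim M) (\<phi> \<circ> p))"
  by (simp_all add: mfd_diff_def)

lemma mfd_plotD:
  assumes "dplot (mfd_diff M) n U p"
  shows "openin (Euclidean_space n) U"
    and "continuous_map (subtopology (Euclidean_space n) U) (mtop M) p"
    and "(W, \<phi>) \<in> atlas M \<Longrightarrow> smooth_eucl n {u \<in> U. p u \<in> W} (mdim M) (\<phi> \<circ> p)"
  using assms by (auto simp: mfd_diff_sel)

lemma mfd_plotI:
  assumes "openin (Euclidean_space n) U"
    and "continuous_map (subtopology (Euclidean_space n) U) (mtop M) p"
    and "\<And>W \<phi>. (W, \<phi>) \<in> atlas M \<Longrightarrow> smooth_eucl n {u \<in> U. p u \<in> W} (mdim M) (\<phi> \<circ> p)"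
  shows "dplot (mfd_diff M) n U p"
  using assms by (auto simp: mfd_diff_sel)

lemma mfd_plot_in_pts:
  assumes "dplot (mfd_diff M) n U p" "u \<in> U"
  shows "p u \<in> pts M"
proof -
  have "u \<in> topspace (subtopology (Euclidean_space n) U)"
    using mfd_plotD(1)[OF assms(1)] assms(2) openin_subset by fastforce
  moreover have "p ` topspace (subtopology (Euclidean_space n) U) \<subseteq> pts M"
    by (rule continuous_map_image_subset_topspace[OF mfd_plotD(2)[OF assms(1)]])
  ultimately show ?thesis by blast
qed

lemma mfd_plot_cong:
  assumes p: "dplot (mfd_diff M) n U p" and eq: "\<And>u. u \<in> U \<Longrightarrow> p u = q u"
  shows "dplot (mfd_diff M) n U q"
proof (rule mfd_plotI[OF mfd_plotD(1)[OF p]])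
  show "continuous_map (subtopology (Euclidean_space n) U) (mtop M) q"
    using mfd_plotD(2)[OF p] by (rule continuous_map_eq) (simp add: eq)
  fix W \<phi> assume "(W, \<phi>) \<in> atlas M"
  moreover have "{u \<in> U. q u \<in> W} = {u \<in> U. p u \<in> W}" using eq by auto
  ultimately have "smooth_eucl n {u \<in> U. q u \<in> W} (mdim M) (\<phi> \<circ> p)"
    using mfd_plotD(3)[OF p] by simp
  then show "smooth_eucl n {u \<in> U. q u \<in> W} (mdim M) (\<phi> \<circ> q)"
    by (rule smooth_eucl_cong) (simp add: eq)
qed

text \<open>The closure of plots under precomposition, for those maps along which paths and
  homotopies are reparametrised; in each chart it is \<open>Ck_on_coord_affine\<close>.\<close>

lemma mfd_plot_coord_affine:
  assumes p: "dplot (mfd_diff M) m U p" and V: "openin (Euclidean_space n) V"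
    and \<sigma>: "inj_on \<sigma> {..<m}" and VU: "coord_affine m \<sigma> a b ` V \<subseteq> U"
  shows "dplot (mfd_diff M) n V (\<lambda>x. p (coord_affine m \<sigma> a b x))"
proof (rule mfd_plotI[OF V])
  let ?A = "coord_affine m \<sigma> a b"
  have VE: "V \<subseteq> topspace (Euclidean_space n)" using V openin_subset by blast
  show "continuous_map (subtopology (Euclidean_space n) V) (mtop M) (\<lambda>x. p (?A x))"
    by (rule continuous_map_comp_coord_affine[OF VU mfd_plotD(2)[OF p]])
  fix W \<phi> assume "(W, \<phi>) \<in> atlas M"
  then have s: "smooth_eucl m {u \<in> U. p u \<in> W} (mdim M) (\<phi> \<circ> p)"
    by (rule mfd_plotD(3)[OF p])
  let ?W = "{u \<in> V. p (?A u) \<in> W}"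
  have AW: "?A ` ?W \<subseteq> {u \<in> U. p u \<in> W}" using VU by auto
  show "smooth_eucl n ?W (mdim M) (\<phi> \<circ> (\<lambda>x. p (?A x)))"
    unfolding smooth_eucl_def
  proof (intro conjI allI impI)
    have "openin (subtopology (Euclidean_space n) V)
        {u \<in> topspace (subtopology (Euclidean_space n) V). ?A u \<in> {u \<in> U. p u \<in> W}}"
      by (rule openin_continuous_map_preimage[OF continuous_map_coord_affine smooth_euclD(1)[OF s]])
    moreover have "{u \<in> topspace (subtopology (Euclidean_space n) V). ?A u \<in> {u \<in> U. p u \<in> W}} = ?W"
      using VE VU by auto
    ultimately show "openin (Euclidean_space n) ?W"
      using V by (simp add: openin_open_subtopology)
    show "\<phi> \<circ> (\<lambda>x. p (?A x)) \<in> ?W \<rightarrow> topspace (Euclidean_space (mdim M))"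
      using smooth_euclD(2)[OF s] VU by fastforce
    fix j k assume "j < mdim M"
    then have "Ck_on k m {u \<in> U. p u \<in> W} (\<lambda>x. (\<phi> \<circ> p) x j)"
      by (rule smooth_euclD(3)[OF s])
    from Ck_on_coord_affine[OF \<sigma> _ AW this, of n] VE
    show "Ck_on k n ?W (\<lambda>x. (\<phi> \<circ> (\<lambda>x. p (?A x))) x j)" by auto
  qed
qed

section \<open>Charts, and smooth maps of manifolds\<close>

lemma is_chartD:
  assumes "manifold M" "(W, \<phi>) \<in> atlas M"
  shows "openin (mtop M) W"
    and "homeomorphic_map (subtopology (mtop M) W) (subtopology (Euclidean_space (mdim M)) (\<phi> ` W)) \<phi>"
    and "openin (Euclidean_space (mdim M)) (\<phi> ` W)"
  using assms by (auto simp: manifold_def is_chart_def)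

lemma manifold_chart_exists:
  assumes "manifold M" "x \<in> pts M"
  obtains W \<phi> where "(W, \<phi>) \<in> atlas M" "x \<in> W"
  using assms unfolding manifold_def by (metis UN_E prod.collapse)

lemma mfd_plot_const:
  assumes M: "manifold M" and x: "x \<in> pts M" and U: "openin (Euclidean_space n) U"
  shows "dplot (mfd_diff M) n U (\<lambda>u. x)"
proof (rule mfd_plotI[OF U])
  show "continuous_map (subtopology (Euclidean_space n) U) (mtop M) (\<lambda>u. x)"
    using x by simp
  fix W \<phi> assume "(W, \<phi>) \<in> atlas M"
  then have "\<phi> ` W \<subseteq> topspace (Euclidean_space (mdim M))"
    using is_chartD(3)[OF M] openin_subset by blast
  then show "smooth_eucl n {u \<in> U. x \<in> W} (mdim M) (\<phi> \<circ> (\<lambda>u. x))"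
    using U by (cases "x \<in> W") (auto simp: smooth_eucl_def Ck_on_const)
qed

lemma chart_inj_on:
  assumes "manifold M" "(W, \<phi>) \<in> atlas M"
  shows "inj_on \<phi> W"
proof -
  have "W \<subseteq> pts M" using is_chartD(1)[OF assms] openin_subset by blast
  then have "topspace (subtopology (mtop M) W) = W" by auto
  then show ?thesis
    using homeomorphic_imp_injective_map[OF is_chartD(2)[OF assms]] by simp
qed

text \<open>Read in a second chart, the inverse of a chart is a transition map, smooth by
  compatibility. Since \<open>dsmooth\<close> speaks of plots only, this is what gives access to the
  coordinate expression of a smooth map.\<close>

lemma chart_inverse_plot:
  assumes M: "manifold M" and c: "(W, \<phi>) \<in> atlas M"
  shows "dplot (mfd_diff M) (mdim M) (\<phi> ` W) (inv_into W \<phi>)"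
proof (rule mfd_plotI)
  have inj: "inj_on \<phi> W" by (rule chart_inj_on[OF M c])
  show op: "openin (Euclidean_space (mdim M)) (\<phi> ` W)" by (rule is_chartD(3)[OF M c])
  obtain h where h: "homeomorphic_maps (subtopology (mtop M) W)
      (subtopology (Euclidean_space (mdim M)) (\<phi> ` W)) \<phi> h"
    using is_chartD(2)[OF M c] homeomorphic_map_maps by blast
  have W: "W \<subseteq> pts M" using is_chartD(1)[OF M c] openin_subset by blast
  have "h u = inv_into W \<phi> u" if u: "u \<in> \<phi> ` W" for u
  proof -
    obtain w where w: "w \<in> W" "u = \<phi> w" using u by blast
    have "h (\<phi> w) = w" using h w(1) W by (auto simp: homeomorphic_maps_def)
    then show ?thesis using w inj by simp
  qed
  then have heq: "h u = inv_into W \<phi> u"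
    if "u \<in> topspace (subtopology (Euclidean_space (mdim M)) (\<phi> ` W))" for u
    using that by simp
  have "continuous_map (subtopology (Euclidean_space (mdim M)) (\<phi> ` W)) (mtop M) h"
    using h by (simp add: homeomorphic_maps_def continuous_map_in_subtopology)
  then show "continuous_map (subtopology (Euclidean_space (mdim M)) (\<phi> ` W)) (mtop M) (inv_into W \<phi>)"
    by (rule continuous_map_eq) (rule heq)
  fix V \<psi> assume d: "(V, \<psi>) \<in> atlas M"
  have "compatible (mdim M) (W, \<phi>) (V, \<psi>)"
    using M c d unfolding manifold_def by (elim conjE) (drule (1) bspec, drule (1) bspec)
  then have "smooth_eucl (mdim M) (\<phi> ` (W \<inter> V)) (mdim M) (\<psi> \<circ> inv_into W \<phi>)"
    by (simp add: compatible_def)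
  moreover have "{u \<in> \<phi> ` W. inv_into W \<phi> u \<in> V} = \<phi> ` (W \<inter> V)"
    using inj by auto
  ultimately show "smooth_eucl (mdim M) {u \<in> \<phi> ` W. inv_into W \<phi> u \<in> V} (mdim M) (\<psi> \<circ> inv_into W \<phi>)"
    by simp
qed

text \<open>Arrows of \<open>man_cat\<close> are extensional: \<open>restrict\<close> and
  \<open>compose\<close> alter a map outside the manifold, where plots never go.\<close>

lemma dsmooth_mfd_cong:
  assumes f: "dsmooth A (mfd_diff N) f" and pl: "\<And>n U p. dplot A n U p \<Longrightarrow> p ` U \<subseteq> dset A"
    and eq: "\<And>x. x \<in> dset A \<Longrightarrow> f x = g x"
  shows "dsmooth A (mfd_diff N) g"
  unfolding dsmooth_def
proof (intro conjI allI impI)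
  show "g \<in> dset A \<rightarrow> dset (mfd_diff N)" using dsmoothD(1)[OF f] eq by (intro Pi_I) metis
  fix n U p assume p: "dplot A n U p"
  then have "dplot (mfd_diff N) n U (f \<circ> p)" by (rule dsmoothD(2)[OF f])
  then show "dplot (mfd_diff N) n U (g \<circ> p)"
    by (rule mfd_plot_cong) (use pl[OF p] eq in auto)
qed

lemma dsmooth_mfd_diff_id: "dsmooth (mfd_diff M) (mfd_diff M) (\<lambda>x\<in>pts M. x)"
proof (rule dsmooth_mfd_cong)
  show "dsmooth (mfd_diff M) (mfd_diff M) (\<lambda>x. x)" by (simp add: dsmooth_def o_def)
qed (auto simp: mfd_diff_sel(1) dest: mfd_plot_in_pts)

lemma dsmooth_mfd_diff_compose:
  assumes "dsmooth (mfd_diff M) (mfd_diff N) f" "dsmooth (mfd_diff N) (mfd_diff K) g"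
  shows "dsmooth (mfd_diff M) (mfd_diff K) (compose (pts M) g f)"
proof (rule dsmooth_mfd_cong)
  show "dsmooth (mfd_diff M) (mfd_diff K) (g \<circ> f)"
    using assms by (auto simp: dsmooth_def comp_assoc)
qed (auto simp: mfd_diff_sel(1) compose_def dest: mfd_plot_in_pts)

lemma category_man_cat: "category man_cat"
proof -
  have "f x \<in> pts N" if "dsmooth (mfd_diff M) (mfd_diff N) f" "x \<in> pts M" for M N :: "'a mfd" and f x
    using that by (auto simp: dsmooth_def mfd_diff_sel)
  then show ?thesis
    unfolding category_def man_cat_def
    by (auto simp: dsmooth_mfd_diff_id dsmooth_mfd_diff_compose[unfolded compose_def] compose_def fun_eq_iff extensional_def)
qed

section \<open>Smooth maps on subsets of Euclidean space\<close>

lemma smooth_on_setD: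
  assumes "smooth_on_set n S M h" "x \<in> S"
  obtains V p where "x \<in> V" "dplot (mfd_diff M) n V p" "\<And>y. y \<in> S \<Longrightarrow> y \<in> V \<Longrightarrow> h y = p y"
  using assms unfolding smooth_on_set_def by blast

lemma smooth_on_set_in_pts:
  assumes "smooth_on_set n S M h" "x \<in> S"
  shows "h x \<in> pts M"
proof -
  obtain V p where "x \<in> V" "dplot (mfd_diff M) n V p" "\<And>y. y \<in> S \<Longrightarrow> y \<in> V \<Longrightarrow> h y = p y"
    using smooth_on_setD[OF assms] by blast
  then show ?thesis using mfd_plot_in_pts assms(2) by metis
qed

lemma smooth_on_set_compose:
  assumes f: "dsmooth (mfd_diff M) (mfd_diff N) f" and h: "smooth_on_set n S M h"
    and eq: "\<And>x. x \<in> S \<Longrightarrow> k x = f (h x)"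
  shows "smooth_on_set n S N k"
  unfolding smooth_on_set_def
proof (intro conjI ballI)
  show "S \<subseteq> topspace (Euclidean_space n)" using h by (simp add: smooth_on_set_def)
  fix x assume "x \<in> S"
  then obtain V p where V: "x \<in> V" "dplot (mfd_diff M) n V p" "\<And>y. y \<in> S \<Longrightarrow> y \<in> V \<Longrightarrow> h y = p y"
    using smooth_on_setD[OF h] by blast
  have "dplot (mfd_diff N) n V (f \<circ> p)"
    by (rule dsmoothD(2)[OF f V(2)])
  then show "\<exists>V p. x \<in> V \<and> dplot (mfd_diff N) n V p \<and> (\<forall>y\<in>S \<inter> V. k y = p y)"
    using V eq by (intro exI[of _ V] exI[of _ "f \<circ> p"]) auto
qed

text \<open>The conclusion is the clause of \<open>smooth_on_set\<close> at the single point
  \<open>x\<close>, so that different points of a glued map may use different pieces and different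
  affine maps. The extension of \<open>h\<close> near the image of \<open>x\<close> is pulled back
  to the preimage of its domain.\<close>

lemma smooth_on_set_local_affine:
  assumes h: "smooth_on_set m S' M h" and V: "openin (Euclidean_space n) V" "x \<in> V"
    and x: "x \<in> S" and \<sigma>: "inj_on \<sigma> {..<m}"
    and eq: "\<And>y. y \<in> S \<Longrightarrow> y \<in> V \<Longrightarrow> coord_affine m \<sigma> a b y \<in> S' \<and> f y = h (coord_affine m \<sigma> a b y)"
  shows "\<exists>V p. x \<in> V \<and> dplot (mfd_diff M) n V p \<and> (\<forall>y\<in>S \<inter> V. f y = p y)"
proof -
  let ?A = "coord_affine m \<sigma> a b"
  have "?A x \<in> S'" using eq x V by blast
  then obtain V' p where V': "?A x \<in> V'" "dplot (mfd_diff M) m V' p"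
    "\<And>y. y \<in> S' \<Longrightarrow> y \<in> V' \<Longrightarrow> h y = p y"
    using smooth_on_setD[OF h] by blast
  define V1 where "V1 = {y \<in> V. ?A y \<in> V'}"
  have VE: "V \<subseteq> topspace (Euclidean_space n)" using V(1) openin_subset by blast
  have "openin (subtopology (Euclidean_space n) V)
      {u \<in> topspace (subtopology (Euclidean_space n) V). ?A u \<in> V'}"
    by (rule openin_continuous_map_preimage[OF continuous_map_coord_affine mfd_plotD(1)[OF V'(2)]])
  moreover have "{u \<in> topspace (subtopology (Euclidean_space n) V). ?A u \<in> V'} = V1"
    using VE by (auto simp: V1_def)
  ultimately have V1: "openin (Euclidean_space n) V1"
    using V(1) by (simp add: openin_open_subtopology)
  have "dplot (mfd_diff M) n V1 (\<lambda>y. p (?A y))"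
    by (rule mfd_plot_coord_affine[OF V'(2) V1 \<sigma>]) (auto simp: V1_def)
  then show ?thesis
    using V(2) V'(1,3) eq by (intro exI[of _ V1] exI[of _ "\<lambda>y. p (?A y)"]) (auto simp: V1_def)
qed

text \<open>The derivative is that of a smooth extension to an open set, taken within
  \<open>T\<close>; at a boundary point it is one-sided.\<close>

lemma smooth_on_set_chart_line:
  assumes M: "manifold M" and h: "smooth_on_set n S M h" and x: "x \<in> S" and i: "i < n"
    and c: "(W, \<phi>) \<in> atlas M" "h x \<in> W"
    and T: "\<And>\<tau>. \<tau> \<in> T \<Longrightarrow> x(i := \<tau>) \<in> S"
  shows "\<forall>\<^sub>F \<tau> in at (x i) within T. h (x(i := \<tau>)) \<in> W"
    and "\<exists>D. \<forall>j. ((\<lambda>\<tau>. \<phi> (h (x(i := \<tau>))) j) has_real_derivative D j) (at (x i) within T)"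
proof -
  obtain V p where V: "x \<in> V" "dplot (mfd_diff M) n V p" "\<And>y. y \<in> S \<Longrightarrow> y \<in> V \<Longrightarrow> h y = p y"
    using smooth_on_setD[OF h x] by blast
  define U where "U = {u \<in> V. p u \<in> W}"
  have s: "smooth_eucl n U (mdim M) (\<phi> \<circ> p)"
    unfolding U_def by (rule mfd_plotD(3)[OF V(2) c(1)])
  have xU: "x \<in> U" using V x c(2) by (auto simp: U_def)
  have "\<forall>\<^sub>F \<tau> in at (x i) within T. x(i := \<tau>) \<in> U"
    using eventually_upd_in_openin[OF smooth_euclD(1)[OF s] xU i]
    unfolding eventually_at_filter by eventually_elim blast
  moreover have "\<forall>\<^sub>F \<tau> in at (x i) within T. \<tau> \<in> T"
    by (simp add: eventually_at_filter)
  ultimately have ev: "\<forall>\<^sub>F \<tau> in at (x i) within T. x(i := \<tau>) \<in> U \<and> h (x(i := \<tau>)) = p (x(i := \<tau>))"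
    by eventually_elim (use T V(3) in \<open>auto simp: U_def\<close>)
  then show "\<forall>\<^sub>F \<tau> in at (x i) within T. h (x(i := \<tau>)) \<in> W"
    by eventually_elim (simp add: U_def)
  have "\<exists>D. ((\<lambda>\<tau>. \<phi> (h (x(i := \<tau>))) j) has_real_derivative D) (at (x i) within T)" for j
  proof (cases "j < mdim M")
    case True
    have "Ck_on (Suc 0) n U (\<lambda>x. (\<phi> \<circ> p) x j)"
      by (rule smooth_euclD(3)[OF s True])
    then obtain g where g: "\<forall>y\<in>U. ((\<lambda>t. (\<phi> \<circ> p) (y(i := t)) j) has_real_derivative g y) (at (y i))"
      using Ck_on_SucD[OF _ i] by blast
    have d: "((\<lambda>t. \<phi> (p (x(i := t))) j) has_real_derivative g x) (at (x i) within T)"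
      using bspec[OF g xU] unfolding o_apply by (rule has_field_derivative_at_within)
    have e1: "\<forall>\<^sub>F \<tau> in at (x i) within T. \<phi> (h (x(i := \<tau>))) j = \<phi> (p (x(i := \<tau>))) j"
      using ev by eventually_elim simp
    have e2: "\<phi> (h (x(i := x i))) j = \<phi> (p (x(i := x i))) j"
      using V x by simp
    show ?thesis
      by (rule exI, rule iffD2[OF has_field_derivative_cong_eventually[OF e1 e2] d])
  next
    \<comment> \<open>Vectors are infinite sequences and \<open>rank_d\<close> reads all their
      entries; those from the dimension on vanish in a chart.\<close>
    case False
    have zero: "\<phi> (p u) j = 0" if "u \<in> U" for u
      using smooth_euclD(2)[OF s that] False by (auto simp: topspace_Euclidean_space)
    have e1: "\<forall>\<^sub>F \<tau> in at (x i) within T. \<phi> (h (x(i := \<tau>))) j = 0"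
      using ev by eventually_elim (simp add: zero)
    have e2: "\<phi> (h (x(i := x i))) j = 0"
      using V x zero[OF xU] by simp
    show ?thesis
      by (rule exI, rule iffD2[OF has_field_derivative_cong_eventually[OF e1 e2] DERIV_const])
  qed
  then have "\<forall>j. \<exists>D. ((\<lambda>\<tau>. \<phi> (h (x(i := \<tau>))) j) has_real_derivative D) (at (x i) within T)"
    by blast
  then show "\<exists>D. \<forall>j. ((\<lambda>\<tau>. \<phi> (h (x(i := \<tau>))) j) has_real_derivative D j) (at (x i) within T)"
    by (rule choice)
qed

text \<open>\<open>L\<close> is the Jacobian at \<open>\<phi> y\<close> of \<open>f\<close> read in
  the two charts, chosen before the curve \<open>\<gamma>\<close>. Applied to the two coordinate
  lines of a homotopy, it yields the same matrix for both partial derivatives.\<close>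

lemma dsmooth_chart_chain_rule:
  assumes M: "manifold M" and f: "dsmooth (mfd_diff M) (mfd_diff N) f"
    and c: "(W, \<phi>) \<in> atlas M" "y \<in> W" and d: "(W', \<psi>) \<in> atlas N" "f y \<in> W'"
  shows "\<exists>L. \<forall>\<gamma> \<gamma>' t T. (\<forall>\<^sub>F \<tau> in at t within T. \<gamma> \<tau> \<in> W \<and> f (\<gamma> \<tau>) \<in> W') \<longrightarrow> \<gamma> t = y \<longrightarrow>
    (\<forall>i. ((\<lambda>\<tau>. \<phi> (\<gamma> \<tau>) i) has_real_derivative \<gamma>' i) (at t within T)) \<longrightarrow>
    (\<forall>j. ((\<lambda>\<tau>. \<psi> (f (\<gamma> \<tau>)) j) has_real_derivative (\<Sum>i<mdim M. L j i * \<gamma>' i)) (at t within T))"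
proof -
  let ?m = "mdim M"
  define F where "F = \<psi> \<circ> (f \<circ> inv_into W \<phi>)"
  define U where "U = {u \<in> \<phi> ` W. (f \<circ> inv_into W \<phi>) u \<in> W'}"
  have inj: "inj_on \<phi> W" by (rule chart_inj_on[OF M c(1)])
  have "dplot (mfd_diff N) ?m (\<phi> ` W) (f \<circ> inv_into W \<phi>)"
    by (rule dsmoothD(2)[OF f chart_inverse_plot[OF M c(1)]])
  then have s: "smooth_eucl ?m U (mdim N) F"
    unfolding F_def U_def by (rule mfd_plotD(3)[OF _ d(1)])
  have yU: "\<phi> y \<in> U" using c d inj by (simp add: U_def)
  have WE: "\<phi> w \<in> topspace (Euclidean_space ?m)" if "w \<in> W" for w
    using is_chartD(3)[OF M c(1)] that openin_subset by blast
  have Fphi: "F (\<phi> w) = \<psi> (f w)" if "w \<in> W" for w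
    using that inj by (simp add: F_def)
  have "\<exists>L. \<forall>\<gamma> \<gamma>' t T. (\<forall>\<^sub>F \<tau> in at t within T. \<gamma> \<tau> \<in> W \<and> f (\<gamma> \<tau>) \<in> W') \<longrightarrow> \<gamma> t = y \<longrightarrow>
      (\<forall>i. ((\<lambda>\<tau>. \<phi> (\<gamma> \<tau>) i) has_real_derivative \<gamma>' i) (at t within T)) \<longrightarrow>
      ((\<lambda>\<tau>. \<psi> (f (\<gamma> \<tau>)) j) has_real_derivative (\<Sum>i<?m. L i * \<gamma>' i)) (at t within T)" for j
  proof (cases "j < mdim N")
    case True
    obtain L where L: "\<forall>c c' t T. (\<forall>\<tau>\<in>T. c \<tau> \<in> topspace (Euclidean_space ?m)) \<longrightarrow> c t = \<phi> y \<longrightarrow>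
        (\<forall>i<?m. ((\<lambda>\<tau>. c \<tau> i) has_real_derivative c' i) (at t within T)) \<longrightarrow>
        ((\<lambda>\<tau>. F (c \<tau>) j) has_real_derivative (\<Sum>i<?m. L i * c' i)) (at t within T)"
      using C1_chain_rule_curve[OF smooth_euclD(1)[OF s] smooth_euclD(3)[OF s True, of 1] yU]
      by (elim exE)
    have "((\<lambda>\<tau>. \<psi> (f (\<gamma> \<tau>)) j) has_real_derivative (\<Sum>i<?m. L i * \<gamma>' i)) (at t within T)"
      if ev: "\<forall>\<^sub>F \<tau> in at t within T. \<gamma> \<tau> \<in> W \<and> f (\<gamma> \<tau>) \<in> W'" and t: "\<gamma> t = y"
        and der: "\<forall>i. ((\<lambda>\<tau>. \<phi> (\<gamma> \<tau>) i) has_real_derivative \<gamma>' i) (at t within T)" for \<gamma> \<gamma>' t T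
    proof -
      \<comment> \<open>The chain rule in Euclidean space wants a curve with values there on all of
        \<open>T\<close>, while \<open>\<gamma>\<close> is in the chart domain only near
        \<open>t\<close>; the value 0 fills the rest and leaves the derivative unchanged.\<close>
      define k where "k \<tau> = (if \<gamma> \<tau> \<in> W then \<phi> (\<gamma> \<tau>) else (\<lambda>_. 0))" for \<tau>
      have kt: "k t = \<phi> y" using t c(2) by (simp add: k_def)
      have kE: "k \<tau> \<in> topspace (Euclidean_space ?m)" for \<tau>
        using WE by (auto simp: k_def topspace_Euclidean_space)
      have kder: "((\<lambda>\<tau>. k \<tau> i) has_real_derivative \<gamma>' i) (at t within T)" for i
      proof -
        have e1: "\<forall>\<^sub>F \<tau> in at t within T. k \<tau> i = \<phi> (\<gamma> \<tau>) i"
          using ev by eventually_elim (simp add: k_def)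
        have e2: "k t i = \<phi> (\<gamma> t) i" using kt t by simp
        show ?thesis
          by (rule iffD2[OF has_field_derivative_cong_eventually[OF e1 e2] der[rule_format]])
      qed
      have e1: "\<forall>\<^sub>F \<tau> in at t within T. \<psi> (f (\<gamma> \<tau>)) j = F (k \<tau>) j"
        using ev by eventually_elim (simp add: k_def Fphi)
      have e2: "\<psi> (f (\<gamma> t)) j = F (k t) j" using kt t Fphi[OF c(2)] by simp
      show ?thesis
        by (rule iffD2[OF has_field_derivative_cong_eventually[OF e1 e2] L[rule_format, OF kE kt kder]])
    qed
    then show ?thesis by (intro exI[of _ L] allI impI)
  next
    case False
    have zero: "\<psi> (f w) j = 0" if "w \<in> W" "f w \<in> W'" for w
    proof -
      have "\<phi> w \<in> U" using that inj by (simp add: U_def)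
      then have "F (\<phi> w) \<in> topspace (Euclidean_space (mdim N))" by (rule smooth_euclD(2)[OF s])
      then show ?thesis using False Fphi[OF that(1)] by (simp add: topspace_Euclidean_space)
    qed
    have "((\<lambda>\<tau>. \<psi> (f (\<gamma> \<tau>)) j) has_real_derivative 0) (at t within T)"
      if ev: "\<forall>\<^sub>F \<tau> in at t within T. \<gamma> \<tau> \<in> W \<and> f (\<gamma> \<tau>) \<in> W'" and t: "\<gamma> t = y"
      for t T and \<gamma> :: "real \<Rightarrow> 'a"
    proof -
      have e1: "\<forall>\<^sub>F \<tau> in at t within T. \<psi> (f (\<gamma> \<tau>)) j = 0"
        using ev by eventually_elim (simp add: zero)
      have e2: "\<psi> (f (\<gamma> t)) j = 0" using t zero c d by simp
      show ?thesis
        by (rule iffD2[OF has_field_derivative_cong_eventually[OF e1 e2] DERIV_const])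
    qed
    then show ?thesis by (intro exI[of _ "\<lambda>_. 0"]) simp
  qed
  then have "\<forall>j. \<exists>L. \<forall>\<gamma> \<gamma>' t T. (\<forall>\<^sub>F \<tau> in at t within T. \<gamma> \<tau> \<in> W \<and> f (\<gamma> \<tau>) \<in> W') \<longrightarrow> \<gamma> t = y \<longrightarrow>
      (\<forall>i. ((\<lambda>\<tau>. \<phi> (\<gamma> \<tau>) i) has_real_derivative \<gamma>' i) (at t within T)) \<longrightarrow>
      ((\<lambda>\<tau>. \<psi> (f (\<gamma> \<tau>)) j) has_real_derivative (\<Sum>i<?m. L i * \<gamma>' i)) (at t within T)" ..
  from choice[OF this] obtain L where L: "\<forall>j. \<forall>\<gamma> \<gamma>' t T.
      (\<forall>\<^sub>F \<tau> in at t within T. \<gamma> \<tau> \<in> W \<and> f (\<gamma> \<tau>) \<in> W') \<longrightarrow> \<gamma> t = y \<longrightarrow>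
      (\<forall>i. ((\<lambda>\<tau>. \<phi> (\<gamma> \<tau>) i) has_real_derivative \<gamma>' i) (at t within T)) \<longrightarrow>
      ((\<lambda>\<tau>. \<psi> (f (\<gamma> \<tau>)) j) has_real_derivative (\<Sum>i<?m. L j i * \<gamma>' i)) (at t within T)"
    by (elim exE)
  show ?thesis
    by (intro exI[of _ L] allI impI) (rule L[rule_format], assumption+, blast)
qed

section \<open>Thin homotopies\<close>

text \<open>Dimension at most 1 means that the span of \<open>v\<close> and \<open>w\<close> is
  contained in a line. A dependency with \<open>\<beta> \<noteq> 0\<close> puts \<open>w\<close> on
  the line of \<open>v\<close>, and one with \<open>\<beta> = 0\<close> forces \<open>v = 0\<close>.
  Conversely, if \<open>v\<close> and \<open>w\<close> are the multiples of \<open>z\<close> by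
  \<open>k\<close> and \<open>l\<close>, then \<open>l\<close> and \<open>- k\<close> are the
  coefficients of a dependency, unless both vanish.\<close>

lemma dim_range_le_1_iff:
  fixes v w :: "nat \<Rightarrow> real"
  shows "vector_space.dim (\<lambda>(c::real) (v::nat \<Rightarrow> real). \<lambda>j. c * v j)
           (range (\<lambda>(a, b). \<lambda>j. a * v j + b * w j)) \<le> 1 \<longleftrightarrow>
         (\<exists>\<alpha> \<beta>. (\<alpha> \<noteq> 0 \<or> \<beta> \<noteq> 0) \<and> (\<forall>j. \<alpha> * v j + \<beta> * w j = 0))"
    (is "vector_space.dim ?s ?R \<le> 1 \<longleftrightarrow> ?dep")
proof -
  interpret V: vector_space ?s
    by unfold_locales (auto simp: fun_eq_iff algebra_simps)
  have small: "V.dim ?R \<le> 1" if "?R \<subseteq> V.span {z}" for z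
    using V.dim_le_card[OF that] by simp
  show ?thesis
  proof
    assume "?dep"
    then obtain \<alpha> \<beta> where ne: "\<alpha> \<noteq> 0 \<or> \<beta> \<noteq> 0" and eq: "\<And>j. \<alpha> * v j + \<beta> * w j = 0" by blast
    show "V.dim ?R \<le> 1"
    proof (cases "\<beta> = 0")
      case False
      have w: "w j = - (\<alpha> / \<beta>) * v j" for j
        using eq[of j] False by (simp add: field_simps)
      have "?R \<subseteq> V.span {v}"
      proof
        fix u assume "u \<in> ?R"
        then obtain a b where "u = (\<lambda>j. a * v j + b * w j)" by auto
        then have "u = ?s (a - b * (\<alpha> / \<beta>)) v" by (simp add: fun_eq_iff w algebra_simps)
        then show "u \<in> V.span {v}" by (metis V.span_base V.span_scale singletonI)
      qed
      then show ?thesis by (rule small)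
    next
      case True
      then have v: "v j = 0" for j
        using eq[of j] ne by simp
      have "?R \<subseteq> V.span {w}"
      proof
        fix u assume "u \<in> ?R"
        then obtain a b where "u = (\<lambda>j. a * v j + b * w j)" by auto
        then have "u = ?s b w" by (simp add: fun_eq_iff v)
        then show "u \<in> V.span {w}" by (metis V.span_base V.span_scale singletonI)
      qed
      then show ?thesis by (rule small)
    qed
  next
    assume le: "V.dim ?R \<le> 1"
    obtain B where B: "B \<subseteq> ?R" "V.independent B" "?R \<subseteq> V.span B" "card B = V.dim ?R"
      using V.basis_exists by blast
    \<comment> \<open>\<open>card B \<le> 1\<close> bounds \<open>B\<close> only if \<open>B\<close>
      is finite, as infinite sets have cardinality 0. Independence inside the span of two vectors
      gives finiteness.\<close>
    have "?R \<subseteq> V.span {v, w}"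
    proof
      fix u assume "u \<in> ?R"
      then obtain a b where "u = (\<lambda>j. a * v j + b * w j)" by auto
      then have "u = ?s a v + ?s b w" by (simp add: fun_eq_iff)
      moreover have "?s a v + ?s b w \<in> V.span {v, w}"
        by (intro V.span_add V.span_scale V.span_base) auto
      ultimately show "u \<in> V.span {v, w}" by simp
    qed
    then have "B \<subseteq> V.span {v, w}" using B(1) by blast
    from V.independent_span_bound[OF _ B(2) this] have finB: "finite B" by simp
    have "B \<subseteq> {} \<or> (\<exists>z. B = {z})"
      using B(4) le finB by (cases "card B = 0") (auto simp: card_1_singleton_iff le_Suc_eq)
    then obtain z where "B \<subseteq> {z}" by auto
    then have "V.span B \<subseteq> V.span {z}" by (rule V.span_mono)
    then have Rz: "?R \<subseteq> V.span {z}" using B(3) by blast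
    have "v = (\<lambda>(a, b). \<lambda>j. a * v j + b * w j) (1, 0)" "w = (\<lambda>(a, b). \<lambda>j. a * v j + b * w j) (0, 1)"
      by (auto simp: fun_eq_iff)
    then have R: "v \<in> ?R" "w \<in> ?R" by blast+
    have "v \<in> V.span {z}" "w \<in> V.span {z}" by (rule subsetD[OF Rz R(1)], rule subsetD[OF Rz R(2)])
    then obtain k l where k: "v = ?s k z" and l: "w = ?s l z"
      unfolding V.span_singleton by blast
    show "?dep"
    proof (cases "k = 0 \<and> l = 0")
      case True
      then show ?thesis using k l by (intro exI[of _ 1] exI[of _ 0]) simp
    next
      case False
      then show ?thesis using k l by (intro exI[of _ l] exI[of _ "- k"]) auto
    qed
  qed
qed

text \<open>Derivatives within \<open>{0..1}\<close> are unique at every point of the interval, its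
  ends included, so \<open>vector_derivative\<close> returns the given \<open>ds\<close> and
  \<open>dt\<close>.\<close>

lemma rank_d_le_1_iff:
  assumes "s \<in> {0..1}" "t \<in> {0..1}"
    and ds: "\<And>j. ((\<lambda>\<sigma>. \<phi> (H \<sigma> t) j) has_real_derivative ds j) (at s within {0..1})"
    and dt: "\<And>j. ((\<lambda>\<tau>. \<phi> (H s \<tau>) j) has_real_derivative dt j) (at t within {0..1})"
  shows "rank_d \<phi> H s t \<le> 1 \<longleftrightarrow>
    (\<exists>\<alpha> \<beta>. (\<alpha> \<noteq> 0 \<or> \<beta> \<noteq> 0) \<and> (\<forall>j. \<alpha> * ds j + \<beta> * dt j = 0))"
proof -
  have "vector_derivative (\<lambda>\<sigma>. \<phi> (H \<sigma> t) j) (at s within {0..1}) = ds j" for j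
    using ds[of j] assms(1)
    by (intro vector_derivative_within_closed_interval)
      (auto simp: has_real_derivative_iff_has_vector_derivative)
  moreover have "vector_derivative (\<lambda>\<tau>. \<phi> (H s \<tau>) j) (at t within {0..1}) = dt j" for j
    using dt[of j] assms(2)
    by (intro vector_derivative_within_closed_interval)
      (auto simp: has_real_derivative_iff_has_vector_derivative)
  ultimately show ?thesis
    unfolding rank_d_def Let_def by (simp only: dim_range_le_1_iff)
qed

section \<open>Squares of rank at most one\<close>

definition unit_square :: "(nat \<Rightarrow> real) set" where
  "unit_square = {x \<in> topspace (Euclidean_space 2). x 0 \<in> {0..1} \<and> x 1 \<in> {0..1}}"

definition pt2 :: "real \<Rightarrow> real \<Rightarrow> nat \<Rightarrow> real" where
  "pt2 s t = (\<lambda>k. if k = 0 then s else if k = 1 then t else 0)"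

lemma pt2_simps [simp]:
  "pt2 s t 0 = s" "pt2 s t (Suc 0) = t" "(pt2 s t)(0 := u) = pt2 u t" "(pt2 s t)(Suc 0 := u) = pt2 s u"
  by (auto simp: pt2_def fun_eq_iff)

lemma pt2_in_unit_square [simp]: "pt2 s t \<in> unit_square \<longleftrightarrow> s \<in> {0..1} \<and> t \<in> {0..1}"
  by (auto simp: unit_square_def pt2_def topspace_Euclidean_space)

text \<open>The conditions of a thin homotopy that can be checked near each point of the square; the
  boundary values and collars are kept apart.\<close>

definition thin_square :: "'m mfd \<Rightarrow> (real \<Rightarrow> real \<Rightarrow> 'm) \<Rightarrow> bool" where
  "thin_square M H \<longleftrightarrow> smooth_on_set 2 unit_square M (\<lambda>x. H (x 0) (x 1)) \<and>
     (\<forall>s\<in>{0..1}. \<forall>t\<in>{0..1}. \<forall>(W, \<phi>)\<in>atlas M. H s t \<in> W \<longrightarrow> rank_d \<phi> H s t \<le> 1)"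

lemma thin_homotopy_iff:
  "thin_homotopy M \<gamma>\<^sub>0 \<gamma>\<^sub>1 H \<longleftrightarrow> thin_square M H \<and>
     (\<forall>s\<in>{0..1}. H s 0 = \<gamma>\<^sub>0 s \<and> H s 1 = \<gamma>\<^sub>1 s) \<and>
     (\<forall>t\<in>{0..1}. H 0 t = \<gamma>\<^sub>0 0 \<and> H 1 t = \<gamma>\<^sub>0 1) \<and>
     (\<exists>\<epsilon>>0. \<forall>s\<in>{0..1}. \<forall>t\<in>{0..1}.
        (s < \<epsilon> \<longrightarrow> H s t = H 0 t) \<and> (s > 1 - \<epsilon> \<longrightarrow> H s t = H 1 t) \<and>
        (t < \<epsilon> \<longrightarrow> H s t = H s 0) \<and> (t > 1 - \<epsilon> \<longrightarrow> H s t = H s 1))"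
  unfolding thin_homotopy_def thin_square_def unit_square_def
  by (rule iffI; elim conjE; intro conjI; assumption)

lemma thin_squareD:
  assumes "thin_square M H"
  shows "smooth_on_set 2 unit_square M (\<lambda>x. H (x 0) (x 1))"
    and "\<lbrakk>s \<in> {0..1}; t \<in> {0..1}; (W, \<phi>) \<in> atlas M; H s t \<in> W\<rbrakk> \<Longrightarrow> rank_d \<phi> H s t \<le> 1"
proof -
  show "smooth_on_set 2 unit_square M (\<lambda>x. H (x 0) (x 1))"
    using assms by (simp add: thin_square_def)
  show "rank_d \<phi> H s t \<le> 1" if "s \<in> {0..1}" "t \<in> {0..1}" "(W, \<phi>) \<in> atlas M" "H s t \<in> W"
    using bspec[OF bspec[OF bspec[OF conjunct2[OF assms[unfolded thin_square_def]] that(1)] that(2)] that(3)] that(4)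
    by simp
qed

lemma square_chart_derivatives:
  assumes M: "manifold M" and H: "smooth_on_set 2 unit_square M (\<lambda>x. H (x 0) (x 1))"
    and st: "s \<in> {0..1}" "t \<in> {0..1}" and c: "(W, \<phi>) \<in> atlas M" "H s t \<in> W"
  shows "\<forall>\<^sub>F \<sigma> in at s within {0..1}. H \<sigma> t \<in> W"
    and "\<forall>\<^sub>F \<tau> in at t within {0..1}. H s \<tau> \<in> W"
    and "\<exists>ds. \<forall>j. ((\<lambda>\<sigma>. \<phi> (H \<sigma> t) j) has_real_derivative ds j) (at s within {0..1})"
    and "\<exists>dt. \<forall>j. ((\<lambda>\<tau>. \<phi> (H s \<tau>) j) has_real_derivative dt j) (at t within {0..1})"
proof -
  have x: "pt2 s t \<in> unit_square" using st by simp
  have c': "H (pt2 s t 0) (pt2 s t 1) \<in> W" using c by simp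
  have T0: "(pt2 s t)(0 := \<tau>) \<in> unit_square" if "\<tau> \<in> {0..1}" for \<tau> using that st by simp
  have T1: "(pt2 s t)(1 := \<tau>) \<in> unit_square" if "\<tau> \<in> {0..1}" for \<tau> using that st by simp
  note e0 = smooth_on_set_chart_line[OF M H x _ c(1) c', of 0 "{0..1}", OF _ T0]
  note e1 = smooth_on_set_chart_line[OF M H x _ c(1) c', of 1 "{0..1}", OF _ T1]
  show "\<forall>\<^sub>F \<sigma> in at s within {0..1}. H \<sigma> t \<in> W"
    "\<exists>ds. \<forall>j. ((\<lambda>\<sigma>. \<phi> (H \<sigma> t) j) has_real_derivative ds j) (at s within {0..1})"
    using e0 by simp_all
  show "\<forall>\<^sub>F \<tau> in at t within {0..1}. H s \<tau> \<in> W"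
    "\<exists>dt. \<forall>j. ((\<lambda>\<tau>. \<phi> (H s \<tau>) j) has_real_derivative dt j) (at t within {0..1})"
    using e1 by simp_all
qed

text \<open>A chain rule for agreement near \<open>s\<close> only, with \<open>a = 0\<close>
  allowed. The neighbourhood is cut down so that its affine image stays in \<open>{0..1}\<close>,
  where \<open>g\<close> is differentiable; cutting down does not change the limit at
  \<open>s\<close>.\<close>

lemma has_real_derivative_local_affine:
  assumes g: "(g has_real_derivative D) (at (a * s + b) within {0..1})"
    and s: "s \<in> {0..1}" and \<delta>: "\<delta> > 0"
    and eq: "\<And>\<sigma>. \<sigma> \<in> {0..1} \<Longrightarrow> \<bar>\<sigma> - s\<bar> < \<delta> \<Longrightarrow> a * \<sigma> + b \<in> {0..1} \<and> k \<sigma> = g (a * \<sigma> + b)"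
  shows "(k has_real_derivative a * D) (at s within {0..1})"
proof -
  let ?T = "{0..1} \<inter> ball s \<delta>"
  have at: "at s within ?T = at s within {0..1}"
    by (rule at_within_nhd[of s "ball s \<delta>"]) (use \<delta> in auto)
  have "(\<lambda>\<sigma>. a * \<sigma> + b) ` ?T \<subseteq> {0..1}"
  proof
    fix y assume "y \<in> (\<lambda>\<sigma>. a * \<sigma> + b) ` ?T"
    then obtain \<sigma> where \<sigma>: "\<sigma> \<in> {0..1}" "\<bar>\<sigma> - s\<bar> < \<delta>" "y = a * \<sigma> + b"
      by (auto simp: dist_real_def abs_minus_commute)
    show "y \<in> {0..1}" using eq[OF \<sigma>(1,2)] \<sigma>(3) by simp
  qed
  then have g': "(g has_real_derivative D) (at (a * s + b) within (\<lambda>\<sigma>. a * \<sigma> + b) ` ?T)"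
    by (rule DERIV_subset[OF g])
  have "((\<lambda>\<sigma>. a * \<sigma> + b) has_real_derivative a) (at s within ?T)"
    by (auto intro!: derivative_eq_intros)
  from DERIV_image_chain[OF g' this]
  have d: "((\<lambda>\<sigma>. g (a * \<sigma> + b)) has_real_derivative D * a) (at s within {0..1})"
    by (simp add: o_def at)
  have "\<forall>\<^sub>F \<sigma> in nhds s. \<bar>\<sigma> - s\<bar> < \<delta>"
    using \<delta> eventually_nhds_metric[of "\<lambda>\<sigma>. \<bar>\<sigma> - s\<bar> < \<delta>" s] by (auto simp: dist_real_def)
  then have e1: "\<forall>\<^sub>F \<sigma> in at s within {0..1}. k \<sigma> = g (a * \<sigma> + b)"
    unfolding eventually_at_filter by eventually_elim (simp add: eq)
  have e2: "k s = g (a * s + b)" using eq[of s] s \<delta> by simp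
  show ?thesis
    using iffD2[OF has_field_derivative_cong_eventually[OF e1 e2] d] by (simp add: mult.commute)
qed

text \<open>Both gluings of thin homotopies are, near each point of the square, affine
  reparametrisations of one of the two pieces: on the seam the pieces agree with a reparametrisation
  that is constant in the glued variable, because of the sitting instances.\<close>

lemma thin_square_local_affine:
  assumes M: "manifold M"
    and loc: "\<And>s t. s \<in> {0..1} \<Longrightarrow> t \<in> {0..1} \<Longrightarrow> \<exists>H a b c d \<delta>. thin_square M H \<and> \<delta> > 0 \<and>
      (\<forall>\<sigma>\<in>{0..1}. \<forall>\<tau>\<in>{0..1}. \<bar>\<sigma> - s\<bar> < \<delta> \<longrightarrow> \<bar>\<tau> - t\<bar> < \<delta> \<longrightarrow>
         a * \<sigma> + b \<in> {0..1} \<and> c * \<tau> + d \<in> {0..1} \<and> K \<sigma> \<tau> = H (a * \<sigma> + b) (c * \<tau> + d))"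
  shows "thin_square M K"
  unfolding thin_square_def smooth_on_set_def
proof (intro conjI ballI)
  show "unit_square \<subseteq> topspace (Euclidean_space 2)" by (auto simp: unit_square_def)
next
  fix x assume x: "x \<in> unit_square"
  have x01: "x 0 \<in> {0..1}" "x 1 \<in> {0..1}" using x by (auto simp: unit_square_def)
  obtain H a b c d \<delta> where H: "thin_square M H" and \<delta>: "\<delta> > 0"
    and eq: "\<forall>\<sigma>\<in>{0..1}. \<forall>\<tau>\<in>{0..1}. \<bar>\<sigma> - x 0\<bar> < \<delta> \<longrightarrow> \<bar>\<tau> - x 1\<bar> < \<delta> \<longrightarrow>
         a * \<sigma> + b \<in> {0..1} \<and> c * \<tau> + d \<in> {0..1} \<and> K \<sigma> \<tau> = H (a * \<sigma> + b) (c * \<tau> + d)"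
    using loc[OF x01] by (elim exE conjE)
  let ?A = "coord_affine 2 id (\<lambda>j. if j = 0 then a else c) (\<lambda>j. if j = 0 then b else d)"
  let ?V = "{y \<in> topspace (Euclidean_space 2). \<bar>y 0 - x 0\<bar> < \<delta>} \<inter>
            {y \<in> topspace (Euclidean_space 2). \<bar>y 1 - x 1\<bar> < \<delta>}"
  show "\<exists>V p. x \<in> V \<and> dplot (mfd_diff M) 2 V p \<and> (\<forall>y\<in>unit_square \<inter> V. K (y 0) (y 1) = p y)"
  proof (rule smooth_on_set_local_affine[OF thin_squareD(1)[OF H] _ _ x])
    show "openin (Euclidean_space 2) ?V"
      by (intro openin_Int openin_Euclidean_space_slab)
    show "x \<in> ?V" using x \<delta> by (auto simp: unit_square_def)
    show "inj_on id {..<2}" by simp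
    fix y assume y: "y \<in> unit_square" "y \<in> ?V"
    have "y 0 \<in> {0..1}" "y 1 \<in> {0..1}" "\<bar>y 0 - x 0\<bar> < \<delta>" "\<bar>y 1 - x 1\<bar> < \<delta>"
      using y by (auto simp: unit_square_def)
    then have "a * y 0 + b \<in> {0..1} \<and> c * y 1 + d \<in> {0..1} \<and> K (y 0) (y 1) = H (a * y 0 + b) (c * y 1 + d)"
      using eq by blast
    moreover have "?A y = pt2 (a * y 0 + b) (c * y 1 + d)"
      by (auto simp: coord_affine_def pt2_def fun_eq_iff less_2_cases_iff)
    ultimately show "?A y \<in> unit_square \<and> K (y 0) (y 1) = H (?A y 0) (?A y 1)"
      by simp
  qed
next
  fix s t :: real and C assume st: "s \<in> {0..1}" "t \<in> {0..1}" and C: "C \<in> atlas M"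
  obtain W \<phi> where [simp]: "C = (W, \<phi>)" by (cases C)
  obtain H a b c d \<delta> where H: "thin_square M H" and \<delta>: "\<delta> > 0"
    and eq: "\<forall>\<sigma>\<in>{0..1}. \<forall>\<tau>\<in>{0..1}. \<bar>\<sigma> - s\<bar> < \<delta> \<longrightarrow> \<bar>\<tau> - t\<bar> < \<delta> \<longrightarrow>
         a * \<sigma> + b \<in> {0..1} \<and> c * \<tau> + d \<in> {0..1} \<and> K \<sigma> \<tau> = H (a * \<sigma> + b) (c * \<tau> + d)"
    using loc[OF st] by (elim exE conjE)
  have e: "a * s + b \<in> {0..1}" "c * t + d \<in> {0..1}" "K s t = H (a * s + b) (c * t + d)"
    using eq[rule_format, OF st] \<delta> by auto
  have "rank_d \<phi> K s t \<le> 1" if W: "K s t \<in> W"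
  proof -
    have c: "(W, \<phi>) \<in> atlas M" "H (a * s + b) (c * t + d) \<in> W" using C W e by auto
    obtain ds where ds: "\<forall>j. ((\<lambda>\<sigma>. \<phi> (H \<sigma> (c * t + d)) j) has_real_derivative ds j) (at (a * s + b) within {0..1})"
      using square_chart_derivatives(3)[OF M thin_squareD(1)[OF H] e(1,2) c] by (elim exE)
    obtain dt where dt: "\<forall>j. ((\<lambda>\<tau>. \<phi> (H (a * s + b) \<tau>) j) has_real_derivative dt j) (at (c * t + d) within {0..1})"
      using square_chart_derivatives(4)[OF M thin_squareD(1)[OF H] e(1,2) c] by (elim exE)
    have ds': "((\<lambda>\<sigma>. \<phi> (K \<sigma> t) j) has_real_derivative a * ds j) (at s within {0..1})" for j
      by (rule has_real_derivative_local_affine[OF ds[rule_format] st(1) \<delta>]) (use eq st \<delta> in auto)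
    have dt': "((\<lambda>\<tau>. \<phi> (K s \<tau>) j) has_real_derivative c * dt j) (at t within {0..1})" for j
      by (rule has_real_derivative_local_affine[OF dt[rule_format] st(2) \<delta>]) (use eq st \<delta> in auto)
    have "rank_d \<phi> H (a * s + b) (c * t + d) \<le> 1"
      by (rule thin_squareD(2)[OF H e(1,2) c])
    then obtain \<alpha> \<beta> where ne: "\<alpha> \<noteq> 0 \<or> \<beta> \<noteq> 0" and dep: "\<And>j. \<alpha> * ds j + \<beta> * dt j = 0"
      unfolding rank_d_le_1_iff[of _ _ \<phi> H, OF e(1,2) ds[rule_format] dt[rule_format]] by blast
    \<comment> \<open>Reparametrisation scales the partial derivatives by \<open>a\<close> and
      \<open>c\<close>, so the coefficients are divided by these. If a factor is 0, that partial
      derivative vanishes and is a dependency by itself.\<close>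
    have "\<exists>\<alpha> \<beta>. (\<alpha> \<noteq> 0 \<or> \<beta> \<noteq> 0) \<and> (\<forall>j. \<alpha> * (a * ds j) + \<beta> * (c * dt j) = 0)"
    proof -
      consider "a = 0" | "c = 0" | "a \<noteq> 0" "c \<noteq> 0" by blast
      then show ?thesis
      proof cases
        case 1 then show ?thesis by (intro exI[of _ 1] exI[of _ 0]) simp
      next
        case 2 then show ?thesis by (intro exI[of _ 0] exI[of _ 1]) simp
      next
        case 3 then show ?thesis using ne dep by (intro exI[of _ "\<alpha> / a"] exI[of _ "\<beta> / c"]) auto
      qed
    qed
    then show ?thesis
      unfolding rank_d_le_1_iff[of _ _ \<phi> K, OF st ds' dt'] .
  qed
  then show "case C of (W, \<phi>) \<Rightarrow> K s t \<in> W \<longrightarrow> rank_d \<phi> K s t \<le> 1" by simp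
qed

text \<open>The two coordinate lines through \<open>(s, t)\<close> are curves through the same point
  \<open>H s t\<close>, so one matrix \<open>L\<close> acts on both partial derivatives and the
  coefficients \<open>\<alpha>\<close>, \<open>\<beta>\<close> survive.\<close>

lemma thin_square_compose:
  assumes M: "manifold M" and N: "manifold N" and f: "dsmooth (mfd_diff M) (mfd_diff N) f"
    and H: "thin_square M H"
  shows "thin_square N (\<lambda>s t. f (H s t))"
  unfolding thin_square_def
proof (intro conjI ballI)
  show fH: "smooth_on_set 2 unit_square N (\<lambda>x. f (H (x 0) (x 1)))"
    by (rule smooth_on_set_compose[OF f thin_squareD(1)[OF H]]) simp
  fix s t :: real and C assume st: "s \<in> {0..1}" "t \<in> {0..1}" and C: "C \<in> atlas N"
  obtain W' \<psi> where [simp]: "C = (W', \<psi>)" by (cases C)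
  have "rank_d \<psi> (\<lambda>s t. f (H s t)) s t \<le> 1" if W': "f (H s t) \<in> W'"
  proof -
    have d: "(W', \<psi>) \<in> atlas N" using C by simp
    have "H s t \<in> pts M"
      using smooth_on_set_in_pts[OF thin_squareD(1)[OF H], of "pt2 s t"] st by simp
    then obtain W \<phi> where c: "(W, \<phi>) \<in> atlas M" "H s t \<in> W"
      using manifold_chart_exists[OF M] by blast
    note h = square_chart_derivatives[OF M thin_squareD(1)[OF H] st c]
    note k = square_chart_derivatives(1,2)[OF N fH st d W']
    obtain ds where ds: "\<forall>j. ((\<lambda>\<sigma>. \<phi> (H \<sigma> t) j) has_real_derivative ds j) (at s within {0..1})"
      using h(3) by (elim exE)
    obtain dt where dt: "\<forall>j. ((\<lambda>\<tau>. \<phi> (H s \<tau>) j) has_real_derivative dt j) (at t within {0..1})"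
      using h(4) by (elim exE)
    obtain L where L: "\<forall>\<gamma> \<gamma>' u T. (\<forall>\<^sub>F \<tau> in at u within T. \<gamma> \<tau> \<in> W \<and> f (\<gamma> \<tau>) \<in> W') \<longrightarrow> \<gamma> u = H s t \<longrightarrow>
      (\<forall>i. ((\<lambda>\<tau>. \<phi> (\<gamma> \<tau>) i) has_real_derivative \<gamma>' i) (at u within T)) \<longrightarrow>
      (\<forall>j. ((\<lambda>\<tau>. \<psi> (f (\<gamma> \<tau>)) j) has_real_derivative (\<Sum>i<mdim M. L j i * \<gamma>' i)) (at u within T))"
      using dsmooth_chart_chain_rule[OF M f c d W'] by (elim exE)
    have ds': "((\<lambda>\<sigma>. \<psi> (f (H \<sigma> t)) j) has_real_derivative (\<Sum>i<mdim M. L j i * ds i)) (at s within {0..1})" for j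
      by (rule L[rule_format, of "\<lambda>\<sigma>. H \<sigma> t", OF eventually_conj[OF h(1) k(1)] refl ds[rule_format]])
    have dt': "((\<lambda>\<tau>. \<psi> (f (H s \<tau>)) j) has_real_derivative (\<Sum>i<mdim M. L j i * dt i)) (at t within {0..1})" for j
      by (rule L[rule_format, of "\<lambda>\<tau>. H s \<tau>", OF eventually_conj[OF h(2) k(2)] refl dt[rule_format]])
    have "rank_d \<phi> H s t \<le> 1"
      by (rule thin_squareD(2)[OF H st c])
    then obtain \<alpha> \<beta> where ne: "\<alpha> \<noteq> 0 \<or> \<beta> \<noteq> 0" and dep: "\<And>j. \<alpha> * ds j + \<beta> * dt j = 0"
      unfolding rank_d_le_1_iff[of _ _ \<phi> H, OF st ds[rule_format] dt[rule_format]] by blast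
    have "\<alpha> * (\<Sum>i<mdim M. L j i * ds i) + \<beta> * (\<Sum>i<mdim M. L j i * dt i) = 0" for j
    proof -
      have "\<alpha> * (\<Sum>i<mdim M. L j i * ds i) + \<beta> * (\<Sum>i<mdim M. L j i * dt i) =
          (\<Sum>i<mdim M. L j i * (\<alpha> * ds i + \<beta> * dt i))"
        by (simp add: sum_distrib_left sum.distrib algebra_simps)
      then show ?thesis by (simp add: dep)
    qed
    then show ?thesis
      unfolding rank_d_le_1_iff[of _ _ \<psi> "\<lambda>s t. f (H s t)", OF st ds' dt'] using ne by blast
  qed
  then show "case C of (W', \<psi>) \<Rightarrow> f (H s t) \<in> W' \<longrightarrow> rank_d \<psi> (\<lambda>s t. f (H s t)) s t \<le> 1" by simp
qed

section \<open>Paths with sitting instances\<close>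

definition unit_segment :: "(nat \<Rightarrow> real) set" where
  "unit_segment = {x \<in> topspace (Euclidean_space 1). x 0 \<in> {0..1}}"

lemma sitting_pathsI:
  assumes "\<gamma> \<in> {0..1} \<rightarrow>\<^sub>E pts M" and "smooth_on_set 1 unit_segment M (\<lambda>x. \<gamma> (x 0))" and "\<epsilon> > 0"
    and "\<And>t. t \<in> {0..1} \<Longrightarrow> t < \<epsilon> \<Longrightarrow> \<gamma> t = \<gamma> 0"
    and "\<And>t. t \<in> {0..1} \<Longrightarrow> t > 1 - \<epsilon> \<Longrightarrow> \<gamma> t = \<gamma> 1"
  shows "\<gamma> \<in> sitting_paths M"
proof -
  have "\<exists>\<epsilon>>0. \<forall>t\<in>{0..1}. (t < \<epsilon> \<longrightarrow> \<gamma> t = \<gamma> 0) \<and> (t > 1 - \<epsilon> \<longrightarrow> \<gamma> t = \<gamma> 1)"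
    by (intro exI[of _ \<epsilon>] conjI ballI impI assms(3-5))
  then show ?thesis
    using assms(1,2) by (simp add: sitting_paths_def unit_segment_def)
qed

lemma sitting_pathsD:
  assumes "\<gamma> \<in> sitting_paths M"
  shows "t \<in> {0..1} \<Longrightarrow> \<gamma> t \<in> pts M" and "\<gamma> \<in> extensional {0..1}"
    and "smooth_on_set 1 unit_segment M (\<lambda>x. \<gamma> (x 0))"
  using assms by (auto simp: sitting_paths_def unit_segment_def PiE_iff)

text \<open>The bound \<open>\<epsilon> \<le> 1\<close> makes \<open>t < \<epsilon>\<close> imply
  \<open>t \<le> 1\<close> and \<open>t > 1 - \<epsilon>\<close> imply \<open>0 \<le> t\<close>, so
  each collar needs only one further inequality.\<close>

lemma sitting_paths_collar:
  assumes "\<gamma> \<in> sitting_paths M"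
  obtains \<epsilon> where "0 < \<epsilon>" "\<epsilon> \<le> 1"
    and "\<And>t. 0 \<le> t \<Longrightarrow> t < \<epsilon> \<Longrightarrow> \<gamma> t = \<gamma> 0"
    and "\<And>t. t > 1 - \<epsilon> \<Longrightarrow> t \<le> 1 \<Longrightarrow> \<gamma> t = \<gamma> 1"
proof -
  obtain \<epsilon> where \<epsilon>: "\<epsilon> > 0"
    "\<forall>t\<in>{0..1}. (t < \<epsilon> \<longrightarrow> \<gamma> t = \<gamma> 0) \<and> (t > 1 - \<epsilon> \<longrightarrow> \<gamma> t = \<gamma> 1)"
    using assms by (auto simp: sitting_paths_def)
  show ?thesis
  proof (rule that[of "min \<epsilon> 1"])
    show "\<gamma> t = \<gamma> 0" if "0 \<le> t" "t < min \<epsilon> 1" for t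
      using bspec[OF \<epsilon>(2), of t] that by auto
    show "\<gamma> t = \<gamma> 1" if "t > 1 - min \<epsilon> 1" "t \<le> 1" for t
      using bspec[OF \<epsilon>(2), of t] that by auto
  qed (use \<epsilon> in auto)
qed

lemma sitting_paths_const:
  assumes "manifold M" "x \<in> pts M"
  shows "(\<lambda>t\<in>{0..1}. x) \<in> sitting_paths M"
proof (rule sitting_pathsI[of _ _ 1])
  show "smooth_on_set 1 unit_segment M (\<lambda>y. (\<lambda>t\<in>{0..1}. x) (y 0))"
    unfolding smooth_on_set_def
  proof (intro conjI ballI exI)
    show "dplot (mfd_diff M) 1 (topspace (Euclidean_space 1)) (\<lambda>u. x)"
      by (rule mfd_plot_const[OF assms openin_topspace])
  qed (auto simp: unit_segment_def)
qed (use assms in auto)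

lemma sitting_paths_compose:
  assumes f: "dsmooth (mfd_diff M) (mfd_diff N) f" and \<gamma>: "\<gamma> \<in> sitting_paths M"
  shows "compose {0..1} f \<gamma> \<in> sitting_paths N"
proof -
  obtain \<epsilon> where \<epsilon>: "0 < \<epsilon>" "\<epsilon> \<le> 1" "\<And>t. 0 \<le> t \<Longrightarrow> t < \<epsilon> \<Longrightarrow> \<gamma> t = \<gamma> 0"
    "\<And>t. t > 1 - \<epsilon> \<Longrightarrow> t \<le> 1 \<Longrightarrow> \<gamma> t = \<gamma> 1"
    using sitting_paths_collar[OF \<gamma>] by blast
  have fP: "f x \<in> pts N" if "x \<in> pts M" for x
    using dsmoothD(1)[OF f] that by (simp add: mfd_diff_sel)
  show ?thesis
  proof (rule sitting_pathsI[OF _ _ \<epsilon>(1)])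
    show "compose {0..1} f \<gamma> \<in> {0..1} \<rightarrow>\<^sub>E pts N"
      using fP sitting_pathsD(1)[OF \<gamma>] by (auto simp: compose_def)
    show "smooth_on_set 1 unit_segment N (\<lambda>x. compose {0..1} f \<gamma> (x 0))"
      by (rule smooth_on_set_compose[OF f sitting_pathsD(3)[OF \<gamma>]])
        (auto simp: unit_segment_def compose_def)
    show "compose {0..1} f \<gamma> t = compose {0..1} f \<gamma> 0" if "t \<in> {0..1}" "t < \<epsilon>" for t
      using that \<epsilon>(3)[of t] by (simp add: compose_def)
    show "compose {0..1} f \<gamma> t = compose {0..1} f \<gamma> 1" if "t \<in> {0..1}" "t > 1 - \<epsilon>" for t
      using that \<epsilon>(4)[of t] by (simp add: compose_def)
  qed
qed

lemma path_concat_simps [simp]: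
  "path_concat \<gamma> \<tau> 0 = \<tau> 0" "path_concat \<gamma> \<tau> 1 = \<gamma> 1"
  by (simp_all add: path_concat_def)

text \<open>Smoothness at time 1/2 is where sitting instances are used: the concatenation is
  constant there, with value \<open>\<tau> 1 = \<gamma> 0\<close>. Elsewhere it is an affine
  reparametrisation of one of the two paths.\<close>

lemma sitting_paths_path_concat:
  assumes \<gamma>: "\<gamma> \<in> sitting_paths M" and \<tau>: "\<tau> \<in> sitting_paths M" and eq: "\<tau> 1 = \<gamma> 0"
  shows "path_concat \<gamma> \<tau> \<in> sitting_paths M"
proof -
  obtain e1 where e1: "0 < e1" "e1 \<le> 1" "\<And>t. 0 \<le> t \<Longrightarrow> t < e1 \<Longrightarrow> \<gamma> t = \<gamma> 0"
    "\<And>t. t > 1 - e1 \<Longrightarrow> t \<le> 1 \<Longrightarrow> \<gamma> t = \<gamma> 1"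
    using sitting_paths_collar[OF \<gamma>] by blast
  obtain e2 where e2: "0 < e2" "e2 \<le> 1" "\<And>t. 0 \<le> t \<Longrightarrow> t < e2 \<Longrightarrow> \<tau> t = \<tau> 0"
    "\<And>t. t > 1 - e2 \<Longrightarrow> t \<le> 1 \<Longrightarrow> \<tau> t = \<tau> 1"
    using sitting_paths_collar[OF \<tau>] by blast
  \<comment> \<open>Double speed halves the collars.\<close>
  define e where "e = min e1 e2 / 2"
  have e: "0 < e" "2 * e \<le> e1" "2 * e \<le> e2" "2 * e \<le> 1" using e1 e2 by (auto simp: e_def)
  have loc: "\<exists>\<kappa> a b \<delta>. \<kappa> \<in> sitting_paths M \<and> \<delta> > 0 \<and> (\<forall>\<sigma>\<in>{0..1}. \<bar>\<sigma> - s\<bar> < \<delta> \<longrightarrow>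
      a * \<sigma> + b \<in> {0..1} \<and> path_concat \<gamma> \<tau> \<sigma> = \<kappa> (a * \<sigma> + b))" if s: "s \<in> {0..1}" for s :: real
  proof -
    consider "s < 1/2" | "s = 1/2" | "s > 1/2" by linarith
    then show ?thesis
    proof cases
      case 1
      then show ?thesis
        by - (rule exI[of _ \<tau>], rule exI[of _ 2], rule exI[of _ 0], rule exI[of _ "1/2 - s"], auto simp: \<tau> path_concat_def)
    next
      case 2
      have "path_concat \<gamma> \<tau> \<sigma> = \<tau> 1" if "\<bar>\<sigma> - s\<bar> < e" "\<sigma> \<in> {0..1}" for \<sigma>
        using that 2 e e1(3)[of "2 * \<sigma> - 1"] e2(4)[of "2 * \<sigma>"] eq by (auto simp: path_concat_def)
      then show ?thesis
        by - (rule exI[of _ \<tau>], rule exI[of _ 0], rule exI[of _ 1], rule exI[of _ e], auto simp: \<tau> e)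
    next
      case 3
      then show ?thesis
        by - (rule exI[of _ \<gamma>], rule exI[of _ 2], rule exI[of _ "-1"], rule exI[of _ "s - 1/2"], auto simp: \<gamma> path_concat_def)
    qed
  qed
  show ?thesis
  proof (rule sitting_pathsI[OF _ _ e(1)])
    show "path_concat \<gamma> \<tau> \<in> {0..1} \<rightarrow>\<^sub>E pts M"
      using sitting_pathsD(1)[OF \<gamma>] sitting_pathsD(1)[OF \<tau>] by (auto simp: path_concat_def)
    show "smooth_on_set 1 unit_segment M (\<lambda>x. path_concat \<gamma> \<tau> (x 0))"
      unfolding smooth_on_set_def
    proof (intro conjI ballI)
      show "unit_segment \<subseteq> topspace (Euclidean_space 1)" by (auto simp: unit_segment_def)
      fix x assume x: "x \<in> unit_segment"
      then have x0: "x 0 \<in> {0..1}" by (simp add: unit_segment_def)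
      obtain \<kappa> a b \<delta> where \<kappa>: "\<kappa> \<in> sitting_paths M" and \<delta>: "\<delta> > 0"
        and k: "\<forall>\<sigma>\<in>{0..1}. \<bar>\<sigma> - x 0\<bar> < \<delta> \<longrightarrow>
          a * \<sigma> + b \<in> {0..1} \<and> path_concat \<gamma> \<tau> \<sigma> = \<kappa> (a * \<sigma> + b)"
        using loc[OF x0] by (elim exE conjE)
      show "\<exists>V p. x \<in> V \<and> dplot (mfd_diff M) 1 V p \<and>
          (\<forall>y\<in>unit_segment \<inter> V. path_concat \<gamma> \<tau> (y 0) = p y)"
      proof (rule smooth_on_set_local_affine[OF sitting_pathsD(3)[OF \<kappa>] _ _ x])
        show "openin (Euclidean_space 1) {y \<in> topspace (Euclidean_space 1). \<bar>y 0 - x 0\<bar> < \<delta>}"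
          by (rule openin_Euclidean_space_slab)
        show "x \<in> {y \<in> topspace (Euclidean_space 1). \<bar>y 0 - x 0\<bar> < \<delta>}"
          using x \<delta> by (simp add: unit_segment_def)
        show "inj_on id {..<1}" by simp
        fix y assume "y \<in> unit_segment" "y \<in> {y \<in> topspace (Euclidean_space 1). \<bar>y 0 - x 0\<bar> < \<delta>}"
        then have "a * y 0 + b \<in> {0..1} \<and> path_concat \<gamma> \<tau> (y 0) = \<kappa> (a * y 0 + b)"
          using k by (simp add: unit_segment_def)
        then show "coord_affine 1 id (\<lambda>_. a) (\<lambda>_. b) y \<in> unit_segment \<and>
            path_concat \<gamma> \<tau> (y 0) = \<kappa> (coord_affine 1 id (\<lambda>_. a) (\<lambda>_. b) y 0)"
          by (simp add: unit_segment_def coord_affine_def topspace_Euclidean_space)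
      qed
    qed
    show "path_concat \<gamma> \<tau> t = path_concat \<gamma> \<tau> 0" if "t \<in> {0..1}" "t < e" for t
      using that e e2(3)[of "2 * t"] by (auto simp: path_concat_def)
    show "path_concat \<gamma> \<tau> t = path_concat \<gamma> \<tau> 1" if "t \<in> {0..1}" "1 - e < t" for t
      using that e e1(4)[of "2 * t - 1"] by (auto simp: path_concat_def)
  qed
qed

section \<open>Thin homotopy classes\<close>

lemma thin_homotopy_collar:
  assumes "thin_homotopy M \<gamma>\<^sub>0 \<gamma>\<^sub>1 H"
  obtains \<epsilon> where "0 < \<epsilon>" "\<epsilon> \<le> 1"
    and "\<And>s t. \<lbrakk>0 \<le> s; s < \<epsilon>; 0 \<le> t; t \<le> 1\<rbrakk> \<Longrightarrow> H s t = H 0 t"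
    and "\<And>s t. \<lbrakk>1 - \<epsilon> < s; s \<le> 1; 0 \<le> t; t \<le> 1\<rbrakk> \<Longrightarrow> H s t = H 1 t"
    and "\<And>s t. \<lbrakk>0 \<le> s; s \<le> 1; 0 \<le> t; t < \<epsilon>\<rbrakk> \<Longrightarrow> H s t = H s 0"
    and "\<And>s t. \<lbrakk>0 \<le> s; s \<le> 1; 1 - \<epsilon> < t; t \<le> 1\<rbrakk> \<Longrightarrow> H s t = H s 1"
proof -
  have "\<exists>\<epsilon>>0. \<forall>s\<in>{0..1}. \<forall>t\<in>{0..1}.
        (s < \<epsilon> \<longrightarrow> H s t = H 0 t) \<and> (s > 1 - \<epsilon> \<longrightarrow> H s t = H 1 t) \<and>
        (t < \<epsilon> \<longrightarrow> H s t = H s 0) \<and> (t > 1 - \<epsilon> \<longrightarrow> H s t = H s 1)"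
    using assms unfolding thin_homotopy_iff by (elim conjE)
  then obtain \<epsilon> where \<epsilon>: "\<epsilon> > 0" and h: "\<forall>s\<in>{0..1}. \<forall>t\<in>{0..1}.
        (s < \<epsilon> \<longrightarrow> H s t = H 0 t) \<and> (s > 1 - \<epsilon> \<longrightarrow> H s t = H 1 t) \<and>
        (t < \<epsilon> \<longrightarrow> H s t = H s 0) \<and> (t > 1 - \<epsilon> \<longrightarrow> H s t = H s 1)"
    by (elim exE conjE)
  have h': "(s < \<epsilon> \<longrightarrow> H s t = H 0 t) \<and> (s > 1 - \<epsilon> \<longrightarrow> H s t = H 1 t) \<and>
        (t < \<epsilon> \<longrightarrow> H s t = H s 0) \<and> (t > 1 - \<epsilon> \<longrightarrow> H s t = H s 1)"
    if "0 \<le> s" "s \<le> 1" "0 \<le> t" "t \<le> 1" for s t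
    using h[rule_format, of s t] that by simp
  show ?thesis
  proof (rule that[of "min \<epsilon> 1"])
    show "H s t = H 0 t" if "0 \<le> s" "s < min \<epsilon> 1" "0 \<le> t" "t \<le> 1" for s t
      using h'[of s t] that by (smt (verit))
    show "H s t = H 1 t" if "1 - min \<epsilon> 1 < s" "s \<le> 1" "0 \<le> t" "t \<le> 1" for s t
      using h'[of s t] that by (smt (verit))
    show "H s t = H s 0" if "0 \<le> s" "s \<le> 1" "0 \<le> t" "t < min \<epsilon> 1" for s t
      using h'[of s t] that by (smt (verit))
    show "H s t = H s 1" if "0 \<le> s" "s \<le> 1" "1 - min \<epsilon> 1 < t" "t \<le> 1" for s t
      using h'[of s t] that by (smt (verit))
  qed (use \<epsilon> in auto)
qed

lemma thin_homotopyI: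
  assumes "thin_square M H" and "0 < \<epsilon>"
    and "\<And>s. \<lbrakk>0 \<le> s; s \<le> 1\<rbrakk> \<Longrightarrow> H s 0 = \<gamma>\<^sub>0 s" "\<And>s. \<lbrakk>0 \<le> s; s \<le> 1\<rbrakk> \<Longrightarrow> H s 1 = \<gamma>\<^sub>1 s"
    and "\<And>t. \<lbrakk>0 \<le> t; t \<le> 1\<rbrakk> \<Longrightarrow> H 0 t = \<gamma>\<^sub>0 0" "\<And>t. \<lbrakk>0 \<le> t; t \<le> 1\<rbrakk> \<Longrightarrow> H 1 t = \<gamma>\<^sub>0 1"
    and "\<And>s t. \<lbrakk>0 \<le> s; s \<le> 1; s < \<epsilon>; 0 \<le> t; t \<le> 1\<rbrakk> \<Longrightarrow> H s t = H 0 t"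
    and "\<And>s t. \<lbrakk>0 \<le> s; 1 - \<epsilon> < s; s \<le> 1; 0 \<le> t; t \<le> 1\<rbrakk> \<Longrightarrow> H s t = H 1 t"
    and "\<And>s t. \<lbrakk>0 \<le> s; s \<le> 1; 0 \<le> t; t \<le> 1; t < \<epsilon>\<rbrakk> \<Longrightarrow> H s t = H s 0"
    and "\<And>s t. \<lbrakk>0 \<le> s; s \<le> 1; 0 \<le> t; 1 - \<epsilon> < t; t \<le> 1\<rbrakk> \<Longrightarrow> H s t = H s 1"
  shows "thin_homotopy M \<gamma>\<^sub>0 \<gamma>\<^sub>1 H"
  unfolding thin_homotopy_iff
proof (intro conjI ballI)
  show "thin_square M H" by (rule assms(1))
  show "\<exists>\<epsilon>>0. \<forall>s\<in>{0..1}. \<forall>t\<in>{0..1}.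
        (s < \<epsilon> \<longrightarrow> H s t = H 0 t) \<and> (s > 1 - \<epsilon> \<longrightarrow> H s t = H 1 t) \<and>
        (t < \<epsilon> \<longrightarrow> H s t = H s 0) \<and> (t > 1 - \<epsilon> \<longrightarrow> H s t = H s 1)"
  proof (intro exI[of _ \<epsilon>] conjI ballI impI)
    fix s t :: real assume "s \<in> {0..1}" "t \<in> {0..1}"
    then have st: "0 \<le> s" "s \<le> 1" "0 \<le> t" "t \<le> 1" by simp_all
    show "s < \<epsilon> \<Longrightarrow> H s t = H 0 t" "s > 1 - \<epsilon> \<Longrightarrow> H s t = H 1 t"
      "t < \<epsilon> \<Longrightarrow> H s t = H s 0" "t > 1 - \<epsilon> \<Longrightarrow> H s t = H s 1"
      using assms(7-10)[of s t] st by blast+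
  qed (rule assms(2))
qed (use assms(3-6) in simp_all)

lemma thin_homotopyD:
  assumes "thin_homotopy M \<gamma>\<^sub>0 \<gamma>\<^sub>1 H"
  shows "thin_square M H"
    and "\<lbrakk>0 \<le> s; s \<le> 1\<rbrakk> \<Longrightarrow> H s 0 = \<gamma>\<^sub>0 s" and "\<lbrakk>0 \<le> s; s \<le> 1\<rbrakk> \<Longrightarrow> H s 1 = \<gamma>\<^sub>1 s"
    and "\<lbrakk>0 \<le> t; t \<le> 1\<rbrakk> \<Longrightarrow> H 0 t = \<gamma>\<^sub>0 0" and "\<lbrakk>0 \<le> t; t \<le> 1\<rbrakk> \<Longrightarrow> H 1 t = \<gamma>\<^sub>0 1"
  using assms by (simp_all add: thin_homotopy_iff)

lemma thin_relI:
  assumes "\<gamma>\<^sub>0 \<in> sitting_paths M" "\<gamma>\<^sub>1 \<in> sitting_paths M" "\<gamma>\<^sub>0 0 = \<gamma>\<^sub>1 0" "\<gamma>\<^sub>0 1 = \<gamma>\<^sub>1 1"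
    and "thin_homotopy M \<gamma>\<^sub>0 \<gamma>\<^sub>1 H"
  shows "(\<gamma>\<^sub>0, \<gamma>\<^sub>1) \<in> thin_rel M"
  using assms by (auto simp: thin_rel_def)

lemma thin_relD:
  assumes "(\<gamma>\<^sub>0, \<gamma>\<^sub>1) \<in> thin_rel M"
  shows "\<gamma>\<^sub>0 \<in> sitting_paths M" and "\<gamma>\<^sub>1 \<in> sitting_paths M" and "\<gamma>\<^sub>0 0 = \<gamma>\<^sub>1 0" and "\<gamma>\<^sub>0 1 = \<gamma>\<^sub>1 1"
    and "\<exists>H. thin_homotopy M \<gamma>\<^sub>0 \<gamma>\<^sub>1 H"
  using assms by (auto simp: thin_rel_def)

text \<open>The homotopy that ignores \<open>t\<close>: its derivative in \<open>t\<close> is 0,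
  which already is a dependency, and its collars in \<open>s\<close> are those of
  \<open>\<gamma>\<close>.\<close>

lemma thin_rel_refl:
  assumes M: "manifold M" and \<gamma>: "\<gamma> \<in> sitting_paths M"
  shows "(\<gamma>, \<gamma>) \<in> thin_rel M"
proof -
  have smooth: "smooth_on_set 2 unit_square M (\<lambda>x. \<gamma> (x 0))"
    unfolding smooth_on_set_def
  proof (intro conjI ballI)
    show "unit_square \<subseteq> topspace (Euclidean_space 2)" by (auto simp: unit_square_def)
    fix x assume x: "x \<in> unit_square"
    show "\<exists>V p. x \<in> V \<and> dplot (mfd_diff M) 2 V p \<and> (\<forall>y\<in>unit_square \<inter> V. \<gamma> (y 0) = p y)"
    proof (rule smooth_on_set_local_affine[OF sitting_pathsD(3)[OF \<gamma>] openin_topspace _ x])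
      show "x \<in> topspace (Euclidean_space 2)" using x by (simp add: unit_square_def)
      show "inj_on id {..<1}" by simp
      fix y assume "y \<in> unit_square"
      then show "coord_affine 1 id (\<lambda>_. 1) (\<lambda>_. 0) y \<in> unit_segment \<and>
          \<gamma> (y 0) = \<gamma> (coord_affine 1 id (\<lambda>_. 1) (\<lambda>_. 0) y 0)"
        by (simp add: unit_square_def unit_segment_def coord_affine_def topspace_Euclidean_space)
    qed
  qed
  have rank: "rank_d \<phi> (\<lambda>s t. \<gamma> s) s t \<le> 1"
    if st: "s \<in> {0..1}" "t \<in> {0..1}" and c: "(W, \<phi>) \<in> atlas M" "\<gamma> s \<in> W" for s t W \<phi>
  proof -
    obtain ds where ds: "\<forall>j. ((\<lambda>\<sigma>. \<phi> (\<gamma> \<sigma>) j) has_real_derivative ds j) (at s within {0..1})"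
      using square_chart_derivatives(3)[of M "\<lambda>s t. \<gamma> s", OF M smooth st c] by (elim exE)
    have dt: "((\<lambda>\<tau>. \<phi> (\<gamma> s) j) has_real_derivative 0) (at t within {0..1})" for j
      by simp
    show ?thesis
      unfolding rank_d_le_1_iff[of s t \<phi> "\<lambda>s t. \<gamma> s", OF st ds[rule_format] dt]
      by (intro exI[of _ 0] exI[of _ 1]) simp
  qed
  have "thin_square M (\<lambda>s t. \<gamma> s)"
    unfolding thin_square_def using smooth rank by auto
  moreover obtain \<epsilon> where \<epsilon>: "0 < \<epsilon>" "\<epsilon> \<le> 1" "\<And>t. 0 \<le> t \<Longrightarrow> t < \<epsilon> \<Longrightarrow> \<gamma> t = \<gamma> 0"
    "\<And>t. t > 1 - \<epsilon> \<Longrightarrow> t \<le> 1 \<Longrightarrow> \<gamma> t = \<gamma> 1"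
    using sitting_paths_collar[OF \<gamma>] by blast
  ultimately have "thin_homotopy M \<gamma> \<gamma> (\<lambda>s t. \<gamma> s)"
    by (intro thin_homotopyI[of M _ \<epsilon>] refl) blast+
  then show ?thesis by (rule thin_relI[OF \<gamma> \<gamma> refl refl])
qed

text \<open>The homotopies are stacked in \<open>t\<close> along the common edge
  \<open>\<gamma>\<^sub>1\<close>. The second one fixes the endpoints of
  \<open>\<gamma>\<^sub>1\<close>, which are also those of \<open>\<gamma>\<^sub>0\<close>.\<close>

lemma thin_rel_trans:
  assumes M: "manifold M" and r1: "(\<gamma>\<^sub>0, \<gamma>\<^sub>1) \<in> thin_rel M" and r2: "(\<gamma>\<^sub>1, \<gamma>\<^sub>2) \<in> thin_rel M"
  shows "(\<gamma>\<^sub>0, \<gamma>\<^sub>2) \<in> thin_rel M"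
proof -
  obtain H where H: "thin_homotopy M \<gamma>\<^sub>0 \<gamma>\<^sub>1 H" using thin_relD(5)[OF r1] by blast
  obtain H' where H': "thin_homotopy M \<gamma>\<^sub>1 \<gamma>\<^sub>2 H'" using thin_relD(5)[OF r2] by blast
  obtain e1 where e1: "0 < e1" "e1 \<le> 1"
    "\<And>s t. \<lbrakk>0 \<le> s; s < e1; 0 \<le> t; t \<le> 1\<rbrakk> \<Longrightarrow> H s t = H 0 t"
    "\<And>s t. \<lbrakk>1 - e1 < s; s \<le> 1; 0 \<le> t; t \<le> 1\<rbrakk> \<Longrightarrow> H s t = H 1 t"
    "\<And>s t. \<lbrakk>0 \<le> s; s \<le> 1; 0 \<le> t; t < e1\<rbrakk> \<Longrightarrow> H s t = H s 0"
    "\<And>s t. \<lbrakk>0 \<le> s; s \<le> 1; 1 - e1 < t; t \<le> 1\<rbrakk> \<Longrightarrow> H s t = H s 1"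
    using thin_homotopy_collar[OF H] by blast
  obtain e2 where e2: "0 < e2" "e2 \<le> 1"
    "\<And>s t. \<lbrakk>0 \<le> s; s < e2; 0 \<le> t; t \<le> 1\<rbrakk> \<Longrightarrow> H' s t = H' 0 t"
    "\<And>s t. \<lbrakk>1 - e2 < s; s \<le> 1; 0 \<le> t; t \<le> 1\<rbrakk> \<Longrightarrow> H' s t = H' 1 t"
    "\<And>s t. \<lbrakk>0 \<le> s; s \<le> 1; 0 \<le> t; t < e2\<rbrakk> \<Longrightarrow> H' s t = H' s 0"
    "\<And>s t. \<lbrakk>0 \<le> s; s \<le> 1; 1 - e2 < t; t \<le> 1\<rbrakk> \<Longrightarrow> H' s t = H' s 1"
    using thin_homotopy_collar[OF H'] by blast
  \<comment> \<open>Half the common collar, for the variable that runs at double speed; the other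
    variable uses \<open>e \<le> e1\<close> and \<open>e \<le> e2\<close>.\<close>
  define e where "e = min e1 e2 / 2"
  have e: "0 < e" "2 * e \<le> e1" "2 * e \<le> e2" "2 * e \<le> 1" "e \<le> e1" "e \<le> e2"
    using e1(1,2) e2(1,2) by (auto simp: e_def)
  define K where "K s t = (if t \<le> 1/2 then H s (2 * t) else H' s (2 * t - 1))" for s t
  note h = thin_homotopyD[OF H] and h' = thin_homotopyD[OF H']
  have "thin_square M K"
  proof (rule thin_square_local_affine[OF M])
    fix s t :: real assume st: "s \<in> {0..1}" "t \<in> {0..1}"
    consider "t < 1/2" | "t = 1/2" | "t > 1/2" by linarith
    then show "\<exists>H a b c d \<delta>. thin_square M H \<and> \<delta> > 0 \<and>
      (\<forall>\<sigma>\<in>{0..1}. \<forall>\<tau>\<in>{0..1}. \<bar>\<sigma> - s\<bar> < \<delta> \<longrightarrow> \<bar>\<tau> - t\<bar> < \<delta> \<longrightarrow>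
         a * \<sigma> + b \<in> {0..1} \<and> c * \<tau> + d \<in> {0..1} \<and> K \<sigma> \<tau> = H (a * \<sigma> + b) (c * \<tau> + d))"
    proof cases
      case 1
      then show ?thesis
        by - (rule exI[of _ H], rule exI[of _ 1], rule exI[of _ 0], rule exI[of _ 2], rule exI[of _ 0], rule exI[of _ "1/2 - t"],
          auto simp: h(1) K_def)
    next
      case 2
      \<comment> \<open>Near the seam \<open>H\<close> is already at its end and \<open>H'\<close>
        still at its start, and both are \<open>\<gamma>\<^sub>1\<close> there.\<close>
      have "K \<sigma> \<tau> = H \<sigma> 1" if "\<sigma> \<in> {0..1}" "\<tau> \<in> {0..1}" "\<bar>\<tau> - t\<bar> < e" for \<sigma> \<tau>
        using that 2 e e1(6)[of \<sigma> "2 * \<tau>"] e2(5)[of \<sigma> "2 * \<tau> - 1"] h(3)[of \<sigma>] h'(2)[of \<sigma>]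
        by (auto simp: K_def)
      then show ?thesis
        by - (rule exI[of _ H], rule exI[of _ 1], rule exI[of _ 0], rule exI[of _ 0], rule exI[of _ 1], rule exI[of _ e],
          auto simp: h(1) e(1))
    next
      case 3
      then show ?thesis
        by - (rule exI[of _ H'], rule exI[of _ 1], rule exI[of _ 0], rule exI[of _ 2], rule exI[of _ "-1"], rule exI[of _ "t - 1/2"],
          auto simp: h'(1) K_def)
    qed
  qed
  then have "thin_homotopy M \<gamma>\<^sub>0 \<gamma>\<^sub>2 K"
  proof (rule thin_homotopyI[OF _ e(1)])
    show "K s 0 = \<gamma>\<^sub>0 s" "K s 1 = \<gamma>\<^sub>2 s" if "0 \<le> s" "s \<le> 1" for s
      using that h(2) h'(3) by (simp_all add: K_def)
    show "K 0 t = \<gamma>\<^sub>0 0" "K 1 t = \<gamma>\<^sub>0 1" if "0 \<le> t" "t \<le> 1" for t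
      using that h(4,5)[of "2 * t"] h'(4,5)[of "2 * t - 1"] thin_relD(3,4)[OF r1] by (auto simp: K_def)
    show "K s t = K 0 t" if "0 \<le> s" "s \<le> 1" "s < e" "0 \<le> t" "t \<le> 1" for s t
      using that e e1(3)[of s "2 * t"] e2(3)[of s "2 * t - 1"] by (auto simp: K_def)
    show "K s t = K 1 t" if "0 \<le> s" "1 - e < s" "s \<le> 1" "0 \<le> t" "t \<le> 1" for s t
      using that e e1(4)[of s "2 * t"] e2(4)[of s "2 * t - 1"] by (auto simp: K_def)
    show "K s t = K s 0" if "0 \<le> s" "s \<le> 1" "0 \<le> t" "t \<le> 1" "t < e" for s t
      using that e e1(5)[of s "2 * t"] by (auto simp: K_def)
    show "K s t = K s 1" if "0 \<le> s" "s \<le> 1" "0 \<le> t" "1 - e < t" "t \<le> 1" for s t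
      using that e e2(6)[of s "2 * t - 1"] by (auto simp: K_def)
  qed
  then show ?thesis
    using thin_relD(1-4)[OF r1] thin_relD(1-4)[OF r2] by (intro thin_relI) auto
qed

text \<open>Gluing side by side in \<open>s\<close>. This makes the composition of classes
  independent of representatives.\<close>

lemma thin_rel_path_concat:
  assumes M: "manifold M" and r: "(\<gamma>\<^sub>0, \<gamma>\<^sub>1) \<in> thin_rel M" and r': "(\<tau>\<^sub>0, \<tau>\<^sub>1) \<in> thin_rel M"
    and eq: "\<tau>\<^sub>0 1 = \<gamma>\<^sub>0 0"
  shows "(path_concat \<gamma>\<^sub>0 \<tau>\<^sub>0, path_concat \<gamma>\<^sub>1 \<tau>\<^sub>1) \<in> thin_rel M"
proof -
  obtain H where H: "thin_homotopy M \<gamma>\<^sub>0 \<gamma>\<^sub>1 H" using thin_relD(5)[OF r] by blast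
  obtain H' where H': "thin_homotopy M \<tau>\<^sub>0 \<tau>\<^sub>1 H'" using thin_relD(5)[OF r'] by blast
  obtain e1 where e1: "0 < e1" "e1 \<le> 1"
    "\<And>s t. \<lbrakk>0 \<le> s; s < e1; 0 \<le> t; t \<le> 1\<rbrakk> \<Longrightarrow> H s t = H 0 t"
    "\<And>s t. \<lbrakk>1 - e1 < s; s \<le> 1; 0 \<le> t; t \<le> 1\<rbrakk> \<Longrightarrow> H s t = H 1 t"
    "\<And>s t. \<lbrakk>0 \<le> s; s \<le> 1; 0 \<le> t; t < e1\<rbrakk> \<Longrightarrow> H s t = H s 0"
    "\<And>s t. \<lbrakk>0 \<le> s; s \<le> 1; 1 - e1 < t; t \<le> 1\<rbrakk> \<Longrightarrow> H s t = H s 1"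
    using thin_homotopy_collar[OF H] by blast
  obtain e2 where e2: "0 < e2" "e2 \<le> 1"
    "\<And>s t. \<lbrakk>0 \<le> s; s < e2; 0 \<le> t; t \<le> 1\<rbrakk> \<Longrightarrow> H' s t = H' 0 t"
    "\<And>s t. \<lbrakk>1 - e2 < s; s \<le> 1; 0 \<le> t; t \<le> 1\<rbrakk> \<Longrightarrow> H' s t = H' 1 t"
    "\<And>s t. \<lbrakk>0 \<le> s; s \<le> 1; 0 \<le> t; t < e2\<rbrakk> \<Longrightarrow> H' s t = H' s 0"
    "\<And>s t. \<lbrakk>0 \<le> s; s \<le> 1; 1 - e2 < t; t \<le> 1\<rbrakk> \<Longrightarrow> H' s t = H' s 1"
    using thin_homotopy_collar[OF H'] by blast
  define e where "e = min e1 e2 / 2"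
  have e: "0 < e" "2 * e \<le> e1" "2 * e \<le> e2" "2 * e \<le> 1" "e \<le> e1" "e \<le> e2"
    using e1(1,2) e2(1,2) by (auto simp: e_def)
  define K where "K s t = (if s \<le> 1/2 then H' (2 * s) t else H (2 * s - 1) t)" for s t
  note h = thin_homotopyD[OF H] and h' = thin_homotopyD[OF H']
  have "thin_square M K"
  proof (rule thin_square_local_affine[OF M])
    fix s t :: real assume st: "s \<in> {0..1}" "t \<in> {0..1}"
    consider "s < 1/2" | "s = 1/2" | "s > 1/2" by linarith
    then show "\<exists>H a b c d \<delta>. thin_square M H \<and> \<delta> > 0 \<and>
      (\<forall>\<sigma>\<in>{0..1}. \<forall>\<tau>\<in>{0..1}. \<bar>\<sigma> - s\<bar> < \<delta> \<longrightarrow> \<bar>\<tau> - t\<bar> < \<delta> \<longrightarrow>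
         a * \<sigma> + b \<in> {0..1} \<and> c * \<tau> + d \<in> {0..1} \<and> K \<sigma> \<tau> = H (a * \<sigma> + b) (c * \<tau> + d))"
    proof cases
      case 1
      then show ?thesis
        by - (rule exI[of _ H'], rule exI[of _ 2], rule exI[of _ 0], rule exI[of _ 1], rule exI[of _ 0], rule exI[of _ "1/2 - s"],
          auto simp: h'(1) K_def)
    next
      case 2
      \<comment> \<open>Thin homotopies fix endpoints, so on the seam both pieces have the value
        \<open>\<tau>\<^sub>0 1 = \<gamma>\<^sub>0 0\<close>.\<close>
      have "K \<sigma> \<tau> = H' 1 \<tau>" if "\<sigma> \<in> {0..1}" "\<tau> \<in> {0..1}" "\<bar>\<sigma> - s\<bar> < e" for \<sigma> \<tau>
        using that 2 e e1(3)[of "2 * \<sigma> - 1" \<tau>] e2(4)[of "2 * \<sigma>" \<tau>] h(4)[of \<tau>] h'(5)[of \<tau>] eq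
        by (auto simp: K_def)
      then show ?thesis
        by - (rule exI[of _ H'], rule exI[of _ 0], rule exI[of _ 1], rule exI[of _ 1], rule exI[of _ 0], rule exI[of _ e],
          auto simp: h'(1) e(1))
    next
      case 3
      then show ?thesis
        by - (rule exI[of _ H], rule exI[of _ 2], rule exI[of _ "-1"], rule exI[of _ 1], rule exI[of _ 0], rule exI[of _ "s - 1/2"],
          auto simp: h(1) K_def)
    qed
  qed
  then have "thin_homotopy M (path_concat \<gamma>\<^sub>0 \<tau>\<^sub>0) (path_concat \<gamma>\<^sub>1 \<tau>\<^sub>1) K"
  proof (rule thin_homotopyI[OF _ e(1)])
    show "K s 0 = path_concat \<gamma>\<^sub>0 \<tau>\<^sub>0 s" "K s 1 = path_concat \<gamma>\<^sub>1 \<tau>\<^sub>1 s" if "0 \<le> s" "s \<le> 1" for s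
      using that h(2,3)[of "2 * s - 1"] h'(2,3)[of "2 * s"] by (simp_all add: K_def path_concat_def)
    show "K 0 t = path_concat \<gamma>\<^sub>0 \<tau>\<^sub>0 0" "K 1 t = path_concat \<gamma>\<^sub>0 \<tau>\<^sub>0 1" if "0 \<le> t" "t \<le> 1" for t
      using that h(5)[of t] h'(4)[of t] by (simp_all add: K_def)
    show "K s t = K 0 t" if "0 \<le> s" "s \<le> 1" "s < e" "0 \<le> t" "t \<le> 1" for s t
      using that e e2(3)[of "2 * s" t] by (auto simp: K_def)
    show "K s t = K 1 t" if "0 \<le> s" "1 - e < s" "s \<le> 1" "0 \<le> t" "t \<le> 1" for s t
      using that e e1(4)[of "2 * s - 1" t] by (auto simp: K_def)
    show "K s t = K s 0" if "0 \<le> s" "s \<le> 1" "0 \<le> t" "t \<le> 1" "t < e" for s t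
      using that e e1(5)[of "2 * s - 1" t] e2(5)[of "2 * s" t] by (auto simp: K_def)
    show "K s t = K s 1" if "0 \<le> s" "s \<le> 1" "0 \<le> t" "1 - e < t" "t \<le> 1" for s t
      using that e e1(6)[of "2 * s - 1" t] e2(6)[of "2 * s" t] by (auto simp: K_def)
  qed
  then show ?thesis
    using thin_relD(1-4)[OF r] thin_relD(1-4)[OF r'] eq
    by (intro thin_relI sitting_paths_path_concat) auto
qed

text \<open>Makes \<open>thin_map\<close> well defined on classes.\<close>

lemma thin_rel_compose:
  assumes M: "manifold M" and N: "manifold N" and f: "dsmooth (mfd_diff M) (mfd_diff N) f"
    and r: "(\<gamma>\<^sub>0, \<gamma>\<^sub>1) \<in> thin_rel M"
  shows "(compose {0..1} f \<gamma>\<^sub>0, compose {0..1} f \<gamma>\<^sub>1) \<in> thin_rel N"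
proof -
  obtain H where H: "thin_homotopy M \<gamma>\<^sub>0 \<gamma>\<^sub>1 H" using thin_relD(5)[OF r] by blast
  obtain e where e: "0 < e" "e \<le> 1"
    "\<And>s t. \<lbrakk>0 \<le> s; s < e; 0 \<le> t; t \<le> 1\<rbrakk> \<Longrightarrow> H s t = H 0 t"
    "\<And>s t. \<lbrakk>1 - e < s; s \<le> 1; 0 \<le> t; t \<le> 1\<rbrakk> \<Longrightarrow> H s t = H 1 t"
    "\<And>s t. \<lbrakk>0 \<le> s; s \<le> 1; 0 \<le> t; t < e\<rbrakk> \<Longrightarrow> H s t = H s 0"
    "\<And>s t. \<lbrakk>0 \<le> s; s \<le> 1; 1 - e < t; t \<le> 1\<rbrakk> \<Longrightarrow> H s t = H s 1"
    using thin_homotopy_collar[OF H] by blast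
  note h = thin_homotopyD[OF H]
  have "thin_homotopy N (compose {0..1} f \<gamma>\<^sub>0) (compose {0..1} f \<gamma>\<^sub>1) (\<lambda>s t. f (H s t))"
  proof (rule thin_homotopyI[OF thin_square_compose[OF M N f h(1)] e(1)])
    show "f (H s t) = f (H 0 t)" if "0 \<le> s" "s \<le> 1" "s < e" "0 \<le> t" "t \<le> 1" for s t
      using e(3)[of s t] that by simp
    show "f (H s t) = f (H 1 t)" if "0 \<le> s" "1 - e < s" "s \<le> 1" "0 \<le> t" "t \<le> 1" for s t
      using e(4)[of s t] that by simp
    show "f (H s t) = f (H s 0)" if "0 \<le> s" "s \<le> 1" "0 \<le> t" "t \<le> 1" "t < e" for s t
      using e(5)[of s t] that by simp
    show "f (H s t) = f (H s 1)" if "0 \<le> s" "s \<le> 1" "0 \<le> t" "1 - e < t" "t \<le> 1" for s t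
      using e(6)[of s t] that by simp
  qed (simp_all add: h compose_def)
  then show ?thesis
    using thin_relD(1-4)[OF r] f by (intro thin_relI sitting_paths_compose) (auto simp: compose_def)
qed

section \<open>Classes of paths as arrows\<close>

abbreviation thin_class :: "'m mfd \<Rightarrow> (real \<Rightarrow> 'm) \<Rightarrow> (real \<Rightarrow> 'm) set" where
  "thin_class M \<gamma> \<equiv> thin_rel M `` {\<gamma>}"

lemma thin_class_self: "manifold M \<Longrightarrow> \<gamma> \<in> sitting_paths M \<Longrightarrow> \<gamma> \<in> thin_class M \<gamma>"
  by (simp add: thin_rel_refl)

text \<open>Transitivity absorbs everything related to a member of \<open>A\<close> into the class
  of \<open>\<gamma>\<close>, and \<open>\<gamma> \<in> A\<close> gives the other inclusion.
  Composition and \<open>thin_map\<close> are both defined as such images of sets of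
  representatives.\<close>

lemma thin_rel_Image_eq_thin_class:
  assumes M: "manifold M" and "\<gamma> \<in> A" and "\<And>\<gamma>'. \<gamma>' \<in> A \<Longrightarrow> (\<gamma>, \<gamma>') \<in> thin_rel M"
  shows "thin_rel M `` A = thin_class M \<gamma>"
  using assms(2,3) thin_rel_trans[OF M] by blast

lemma thin_class_in_Arr: "\<gamma> \<in> sitting_paths M \<Longrightarrow> thin_class M \<gamma> \<in> Arr (thin_gpd M)"
  by (simp add: thin_gpd_def quotientI)

lemma Arr_thin_gpdE:
  assumes "c \<in> Arr (thin_gpd M)"
  obtains \<gamma> where "\<gamma> \<in> sitting_paths M" "c = thin_class M \<gamma>"
  using assms by (auto simp: thin_gpd_def elim: quotientE)

text \<open>Related paths share their endpoints, so the representative picked by \<open>SOME\<close>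
  does not matter.\<close>

lemma thin_gpd_class:
  assumes M: "manifold M" and \<gamma>: "\<gamma> \<in> sitting_paths M"
  shows "Src (thin_gpd M) (thin_class M \<gamma>) = \<gamma> 0" and "Tgt (thin_gpd M) (thin_class M \<gamma>) = \<gamma> 1"
proof -
  have "(SOME \<delta>. \<delta> \<in> thin_class M \<gamma>) \<in> thin_class M \<gamma>"
    by (rule someI[of "\<lambda>\<delta>. \<delta> \<in> thin_class M \<gamma>", OF thin_class_self[OF M \<gamma>]])
  then have "(\<gamma>, SOME \<delta>. \<delta> \<in> thin_class M \<gamma>) \<in> thin_rel M" by blast
  then show "Src (thin_gpd M) (thin_class M \<gamma>) = \<gamma> 0" "Tgt (thin_gpd M) (thin_class M \<gamma>) = \<gamma> 1"
    using thin_relD(3,4) by (fastforce simp: thin_gpd_def)+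
qed

lemma Ident_thin_gpd: "Ident (thin_gpd M) x = thin_class M (\<lambda>t\<in>{0..1}. x)"
  by (simp add: thin_gpd_def)

lemma Comp_thin_class:
  assumes M: "manifold M" and \<gamma>: "\<gamma> \<in> sitting_paths M" and \<tau>: "\<tau> \<in> sitting_paths M"
    and eq: "\<tau> 1 = \<gamma> 0"
  shows "Comp (thin_gpd M) (thin_class M \<gamma>) (thin_class M \<tau>) = thin_class M (path_concat \<gamma> \<tau>)"
proof -
  have "thin_rel M `` {path_concat \<gamma>' \<tau>' |\<gamma>' \<tau>'. \<gamma>' \<in> thin_class M \<gamma> \<and> \<tau>' \<in> thin_class M \<tau>} =
      thin_class M (path_concat \<gamma> \<tau>)"
  proof (rule thin_rel_Image_eq_thin_class[OF M])
    show "path_concat \<gamma> \<tau> \<in> {path_concat \<gamma>' \<tau>' |\<gamma>' \<tau>'. \<gamma>' \<in> thin_class M \<gamma> \<and> \<tau>' \<in> thin_class M \<tau>}"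
      using thin_class_self[OF M \<gamma>] thin_class_self[OF M \<tau>] by blast
    fix \<kappa> assume "\<kappa> \<in> {path_concat \<gamma>' \<tau>' |\<gamma>' \<tau>'. \<gamma>' \<in> thin_class M \<gamma> \<and> \<tau>' \<in> thin_class M \<tau>}"
    then obtain \<gamma>' \<tau>' where "\<kappa> = path_concat \<gamma>' \<tau>'" "(\<gamma>, \<gamma>') \<in> thin_rel M" "(\<tau>, \<tau>') \<in> thin_rel M"
      by blast
    then show "(path_concat \<gamma> \<tau>, \<kappa>) \<in> thin_rel M"
      using thin_rel_path_concat[OF M, of \<gamma> \<gamma>' \<tau> \<tau>'] eq by simp
  qed
  then show ?thesis by (simp add: thin_gpd_def)
qed

lemma thin_gpd_closed:
  assumes M: "manifold M"
  shows "c \<in> Arr (thin_gpd M) \<Longrightarrow> Src (thin_gpd M) c \<in> pts M \<and> Tgt (thin_gpd M) c \<in> pts M"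
    and "x \<in> pts M \<Longrightarrow> Ident (thin_gpd M) x \<in> Arr (thin_gpd M)"
    and "\<lbrakk>c \<in> Arr (thin_gpd M); d \<in> Arr (thin_gpd M); Src (thin_gpd M) d = Tgt (thin_gpd M) c\<rbrakk> \<Longrightarrow>
      Comp (thin_gpd M) d c \<in> Arr (thin_gpd M)"
proof -
  show "Src (thin_gpd M) c \<in> pts M \<and> Tgt (thin_gpd M) c \<in> pts M" if c: "c \<in> Arr (thin_gpd M)"
    using c by (rule Arr_thin_gpdE) (simp add: thin_gpd_class[OF M] sitting_pathsD(1))
  show "Ident (thin_gpd M) x \<in> Arr (thin_gpd M)" if "x \<in> pts M"
    unfolding Ident_thin_gpd by (rule thin_class_in_Arr[OF sitting_paths_const[OF M that]])
  assume c: "c \<in> Arr (thin_gpd M)" and d: "d \<in> Arr (thin_gpd M)"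
    and eq: "Src (thin_gpd M) d = Tgt (thin_gpd M) c"
  obtain \<tau> where \<tau>: "\<tau> \<in> sitting_paths M" "c = thin_class M \<tau>" using c by (rule Arr_thin_gpdE)
  obtain \<gamma> where \<gamma>: "\<gamma> \<in> sitting_paths M" "d = thin_class M \<gamma>" using d by (rule Arr_thin_gpdE)
  have "\<tau> 1 = \<gamma> 0" using eq \<gamma> \<tau> by (simp add: thin_gpd_class[OF M])
  then show "Comp (thin_gpd M) d c \<in> Arr (thin_gpd M)"
    using \<gamma> \<tau> by (simp add: Comp_thin_class[OF M] thin_class_in_Arr sitting_paths_path_concat)
qed

section \<open>Functoriality of the thin fundamental groupoid\<close>

lemma man_cat_sel [simp]:
  "Obj man_cat = {M. manifold M}"
  "Src man_cat (M, f, N) = M"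
  "Tgt man_cat (M, f, N) = N"
  "Ident man_cat M = (M, \<lambda>x\<in>pts M. x, M)"
  "Comp man_cat (N', g, K) (M, f, N) = (M, compose (pts M) g f, K)"
  by (simp_all add: man_cat_def)

lemma man_catD:
  assumes "(M, f, N) \<in> Arr man_cat"
  shows "manifold M" and "manifold N" and "dsmooth (mfd_diff M) (mfd_diff N) f"
    and "x \<in> pts M \<Longrightarrow> f x \<in> pts N"
  using assms by (auto simp: man_cat_def dsmooth_def mfd_diff_sel(1))

lemma fobj_thin_map: "x \<in> pts M \<Longrightarrow> fobj (thin_map (M, f, N)) x = f x"
  by (simp add: thin_map_def)

lemma farr_thin_map_class:
  assumes f: "(M, f, N) \<in> Arr man_cat" and \<gamma>: "\<gamma> \<in> sitting_paths M"
  shows "farr (thin_map (M, f, N)) (thin_class M \<gamma>) = thin_class N (compose {0..1} f \<gamma>)"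
proof -
  have "thin_rel N `` (compose {0..1} f ` thin_class M \<gamma>) = thin_class N (compose {0..1} f \<gamma>)"
  proof (rule thin_rel_Image_eq_thin_class[OF man_catD(2)[OF f]])
    show "compose {0..1} f \<gamma> \<in> compose {0..1} f ` thin_class M \<gamma>"
      by (rule imageI[OF thin_class_self[OF man_catD(1)[OF f] \<gamma>]])
    show "(compose {0..1} f \<gamma>, \<gamma>') \<in> thin_rel N" if "\<gamma>' \<in> compose {0..1} f ` thin_class M \<gamma>" for \<gamma>'
      using that thin_rel_compose[OF man_catD(1-3)[OF f]] by auto
  qed
  then show ?thesis
    using thin_class_in_Arr[OF \<gamma>] by (simp add: thin_map_def)
qed

text \<open>An equality of paths, not only of classes: applying \<open>f\<close> leaves the
  parametrisation alone.\<close>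

lemma compose_path_concat:
  "compose {0..1} f (path_concat \<gamma> \<tau>) = path_concat (compose {0..1} f \<gamma>) (compose {0..1} f \<tau>)"
  by (auto simp: compose_def path_concat_def fun_eq_iff)

lemma is_functor_thin_map:
  assumes f: "(M, f, N) \<in> Arr man_cat"
  shows "is_functor (thin_gpd M) (thin_gpd N) (thin_map (M, f, N))"
    (is "is_functor ?C ?D ?F")
proof -
  note M = man_catD(1)[OF f] and N = man_catD(2)[OF f]
  have sit: "compose {0..1} f \<gamma> \<in> sitting_paths N" if "\<gamma> \<in> sitting_paths M" for \<gamma>
    by (rule sitting_paths_compose[OF man_catD(3)[OF f] that])
  show ?thesis
    unfolding is_functor_def
  proof (intro conjI ballI impI)
    show "fobj ?F \<in> Obj ?C \<rightarrow>\<^sub>E Obj ?D"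
      using man_catD(4)[OF f] by (auto simp: thin_map_def)
    show "farr ?F \<in> Arr ?C \<rightarrow>\<^sub>E Arr ?D"
    proof (rule PiE_I)
      show "farr ?F c \<in> Arr ?D" if "c \<in> Arr ?C" for c
        using that by (rule Arr_thin_gpdE) (simp add: farr_thin_map_class[OF f] thin_class_in_Arr sit)
    qed (simp add: thin_map_def)
    show "farr ?F (Ident ?C x) = Ident ?D (fobj ?F x)" if "x \<in> Obj ?C" for x
    proof -
      have x: "x \<in> pts M" using that by simp
      have "compose {0..1} f (\<lambda>t\<in>{0..1::real}. x) = (\<lambda>t\<in>{0..1}. f x)"
        by (auto simp: compose_def fun_eq_iff)
      then show ?thesis
        by (simp add: Ident_thin_gpd farr_thin_map_class[OF f sitting_paths_const[OF M x]] fobj_thin_map x)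
    qed
    fix c assume "c \<in> Arr ?C"
    then obtain \<tau> where \<tau>: "\<tau> \<in> sitting_paths M" "c = thin_class M \<tau>" by (rule Arr_thin_gpdE)
    show "Src ?D (farr ?F c) = fobj ?F (Src ?C c)" "Tgt ?D (farr ?F c) = fobj ?F (Tgt ?C c)"
      using \<tau> sit[OF \<tau>(1)]
      by (simp_all add: farr_thin_map_class[OF f] thin_gpd_class[OF M] thin_gpd_class[OF N]
          fobj_thin_map sitting_pathsD(1) compose_def)
    fix d assume "d \<in> Arr ?C" and eq: "Src ?C d = Tgt ?C c"
    then obtain \<gamma> where \<gamma>: "\<gamma> \<in> sitting_paths M" "d = thin_class M \<gamma>" by (elim Arr_thin_gpdE)
    have e: "\<tau> 1 = \<gamma> 0" using eq \<gamma> \<tau> by (simp add: thin_gpd_class[OF M])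
    have "farr ?F (Comp ?C d c) = thin_class N (compose {0..1} f (path_concat \<gamma> \<tau>))"
      using \<gamma> \<tau> e
      by (simp add: Comp_thin_class[OF M] farr_thin_map_class[OF f] sitting_paths_path_concat)
    also have "\<dots> = Comp ?D (farr ?F d) (farr ?F c)"
    proof -
      have "compose {0..1} f \<tau> 1 = compose {0..1} f \<gamma> 0" using e by (simp add: compose_eq)
      then show ?thesis
        using \<gamma> \<tau> sit
        by (simp add: compose_path_concat farr_thin_map_class[OF f] Comp_thin_class[OF N])
    qed
    finally show "farr ?F (Comp ?C d c) = Comp ?D (farr ?F d) (farr ?F c)" .
  qed
qed

section \<open>Strict functoriality in the map\<close>

lemma thin_map_id:
  assumes M: "manifold M"
  shows "thin_map (M, \<lambda>x\<in>pts M. x, M) = id_ftr (thin_gpd M)"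
proof (rule ftr.equality)
  have f: "(M, \<lambda>x\<in>pts M. x, M) \<in> Arr man_cat"
    using categoryD(3)[OF category_man_cat, of M] M by simp
  show "fobj (thin_map (M, \<lambda>x\<in>pts M. x, M)) = fobj (id_ftr (thin_gpd M))"
    by (auto simp: thin_map_def id_ftr_def)
  show "farr (thin_map (M, \<lambda>x\<in>pts M. x, M)) = farr (id_ftr (thin_gpd M))"
  proof (rule extensionalityI)
    show "farr (thin_map (M, \<lambda>x\<in>pts M. x, M)) \<in> extensional (Arr (thin_gpd M))"
      by (simp add: thin_map_def)
    show "farr (id_ftr (thin_gpd M)) \<in> extensional (Arr (thin_gpd M))"
      by (simp add: id_ftr_def)
    fix c assume c: "c \<in> Arr (thin_gpd M)"
    then obtain \<gamma> where \<gamma>: "\<gamma> \<in> sitting_paths M" "c = thin_class M \<gamma>" by (rule Arr_thin_gpdE)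
    have "compose {0..1} (\<lambda>x\<in>pts M. x) \<gamma> = \<gamma>"
      using sitting_pathsD(1,2)[OF \<gamma>(1)] by (auto simp: compose_def fun_eq_iff extensional_def)
    then show "farr (thin_map (M, \<lambda>x\<in>pts M. x, M)) c = farr (id_ftr (thin_gpd M)) c"
      using farr_thin_map_class[OF f \<gamma>(1)] \<gamma> c by (simp add: id_ftr_def)
  qed
qed simp

text \<open>On representatives this is associativity of composition of functions. The restriction in
  \<open>compose (pts M) g f\<close> has no effect because paths take their values in
  \<open>pts M\<close>.\<close>

lemma thin_map_comp:
  assumes f: "(M, f, N) \<in> Arr man_cat" and g: "(N, g, K) \<in> Arr man_cat"
  shows "thin_map (M, compose (pts M) g f, K) =
    comp_ftr (thin_gpd M) (thin_map (N, g, K)) (thin_map (M, f, N))"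
proof (rule ftr.equality)
  have gf: "(M, compose (pts M) g f, K) \<in> Arr man_cat"
    using categoryD(6)[OF category_man_cat f g] by simp
  show "fobj (thin_map (M, compose (pts M) g f, K)) =
      fobj (comp_ftr (thin_gpd M) (thin_map (N, g, K)) (thin_map (M, f, N)))"
    using man_catD(4)[OF f] by (auto simp: thin_map_def compose_def fun_eq_iff)
  show "farr (thin_map (M, compose (pts M) g f, K)) =
      farr (comp_ftr (thin_gpd M) (thin_map (N, g, K)) (thin_map (M, f, N)))"
  proof (rule extensionalityI)
    show "farr (thin_map (M, compose (pts M) g f, K)) \<in> extensional (Arr (thin_gpd M))"
      by (simp add: thin_map_def)
    show "farr (comp_ftr (thin_gpd M) (thin_map (N, g, K)) (thin_map (M, f, N))) \<in> extensional (Arr (thin_gpd M))"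
      by (simp add: compose_def)
    fix c assume c: "c \<in> Arr (thin_gpd M)"
    then obtain \<gamma> where \<gamma>: "\<gamma> \<in> sitting_paths M" "c = thin_class M \<gamma>" by (rule Arr_thin_gpdE)
    have "compose {0..1} (compose (pts M) g f) \<gamma> = compose {0..1} g (compose {0..1} f \<gamma>)"
      using sitting_pathsD(1)[OF \<gamma>(1)] by (auto simp: compose_def fun_eq_iff)
    then show "farr (thin_map (M, compose (pts M) g f, K)) c =
        farr (comp_ftr (thin_gpd M) (thin_map (N, g, K)) (thin_map (M, f, N))) c"
      using c \<gamma> farr_thin_map_class[OF gf \<gamma>(1)] farr_thin_map_class[OF f \<gamma>(1)]
        farr_thin_map_class[OF g sitting_paths_compose[OF man_catD(3)[OF f] \<gamma>(1)]]
      by (simp add: compose_eq)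
  qed
qed simp

section \<open>Smoothness on thin fundamental groups\<close>

lemma path_diff_compose_plot:
  assumes f: "(M, f, N) \<in> Arr man_cat" and q: "dplot (path_diff M) n U q"
  shows "dplot (path_diff N) n U (\<lambda>u. compose {0..1} f (q u))"
proof -
  note fd = man_catD(3)[OF f]
  have "openin (Euclidean_space n) U" and qU: "q \<in> U \<rightarrow> sitting_paths M"
    and s: "smooth_on_set (Suc n)
      {x \<in> topspace (Euclidean_space (Suc n)). x(n := 0) \<in> U \<and> x n \<in> {0..1}} M (\<lambda>x. q (x(n := 0)) (x n))"
    using q by (simp_all add: path_diff_def)
  moreover have "smooth_on_set (Suc n)
      {x \<in> topspace (Euclidean_space (Suc n)). x(n := 0) \<in> U \<and> x n \<in> {0..1}} N
      (\<lambda>x. compose {0..1} f (q (x(n := 0))) (x n))"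
    by (rule smooth_on_set_compose[OF fd s]) (simp add: compose_eq)
  moreover have "(\<lambda>u. compose {0..1} f (q u)) \<in> U \<rightarrow> sitting_paths N"
    using qU sitting_paths_compose[OF fd] by blast
  ultimately show ?thesis by (simp add: path_diff_def)
qed

text \<open>Plots of the quotient are maps with local lifts to plots of paths; composing the lifts
  with \<open>f\<close> gives local lifts in \<open>N\<close>.\<close>

lemma dsmooth_thin_pi1_thin_map:
  assumes f: "(M, f, N) \<in> Arr man_cat"
  shows "dsmooth (thin_pi1 M x) (thin_pi1 N (f x)) (farr (thin_map (M, f, N)))"
  unfolding dsmooth_def
proof (intro conjI allI impI)
  let ?F = "thin_map (M, f, N)"
  note F = is_functorD[OF is_functor_thin_map[OF f]]
  have loop: "farr ?F c \<in> Arr (thin_gpd N) \<and> Src (thin_gpd N) (farr ?F c) = f x \<and>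
      Tgt (thin_gpd N) (farr ?F c) = f x"
    if "c \<in> Arr (thin_gpd M)" "Src (thin_gpd M) c = x" "Tgt (thin_gpd M) c = x" for c
    using that F(2,5,6)[OF that(1)] thin_gpd_closed(1)[OF man_catD(1)[OF f] that(1)]
    by (simp add: fobj_thin_map)
  have set: "dset (thin_pi1 K y) = {c \<in> Arr (thin_gpd K). Src (thin_gpd K) c = y \<and> Tgt (thin_gpd K) c = y}"
    for K :: "'a mfd" and y
    by (auto simp: thin_pi1_def sub_diff_def thin_diff_def quot_diff_def path_diff_def thin_gpd_def)
  show "farr ?F \<in> dset (thin_pi1 M x) \<rightarrow> dset (thin_pi1 N (f x))"
    unfolding set using loop by blast
  fix n U p assume p: "dplot (thin_pi1 M x) n U p"
  have pU: "p ` U \<subseteq> {c \<in> Arr (thin_gpd M). Src (thin_gpd M) c = x \<and> Tgt (thin_gpd M) c = x}"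
    and U: "openin (Euclidean_space n) U"
    and lift: "\<forall>u\<in>U. \<exists>V q. u \<in> V \<and> V \<subseteq> U \<and> dplot (path_diff M) n V q \<and> (\<forall>v\<in>V. p v = thin_class M (q v))"
    using p by (simp_all add: thin_pi1_def sub_diff_def thin_diff_def quot_diff_def)
  have "\<exists>V q. u \<in> V \<and> V \<subseteq> U \<and> dplot (path_diff N) n V q \<and> (\<forall>v\<in>V. (farr ?F \<circ> p) v = thin_class N (q v))"
    if u: "u \<in> U" for u
  proof -
    obtain V q where V: "u \<in> V" "V \<subseteq> U" "dplot (path_diff M) n V q" "\<forall>v\<in>V. p v = thin_class M (q v)"
      using bspec[OF lift u] by (elim exE conjE)
    have qV: "q v \<in> sitting_paths M" if "v \<in> V" for v
      using V(3) that by (auto simp: path_diff_def)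
    have "\<forall>v\<in>V. (farr ?F \<circ> p) v = thin_class N (compose {0..1} f (q v))"
      using V(4) farr_thin_map_class[OF f qV] by simp
    then show ?thesis
      using V(1,2) path_diff_compose_plot[OF f V(3)]
      by (intro exI[of _ V] exI[of _ "\<lambda>u. compose {0..1} f (q u)"]) blast
  qed
  moreover have "(farr ?F \<circ> p) ` U \<subseteq>
      {c \<in> Arr (thin_gpd N). Src (thin_gpd N) c = f x \<and> Tgt (thin_gpd N) c = f x}"
    using pU loop by fastforce
  ultimately show "dplot (thin_pi1 N (f x)) n U (farr ?F \<circ> p)"
    using U by (simp add: thin_pi1_def sub_diff_def thin_diff_def quot_diff_def)
qed

section \<open>Pullback of transport functors\<close>

text \<open>\<open>comp_ftr\<close> restricts to arrows, so the pulled back functor agrees with the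
  plain composite of functions on arrows only, which is where the plots in question take their
  values.\<close>

lemma aut_diff_plot_cong:
  assumes p: "dplot (aut_diff G X) n U p" and eq: "\<And>u. u \<in> U \<Longrightarrow> p u = q u"
  shows "dplot (aut_diff G X) n U q"
proof -
  let ?A = "{a \<in> Arr (tors_cat G). Src (tors_cat G) a = X \<and> Tgt (tors_cat G) a = X}"
  have pA: "p \<in> U \<rightarrow> ?A" and pd: "\<And>x. x \<in> pts (tmfd X) \<Longrightarrow>
      dplot (mfd_diff (lie_mfd G)) n U (\<lambda>u. torsor_diff G X x (fst (snd (p u)) x))"
    using p by (simp_all add: aut_diff_def Let_def)
  have "q \<in> U \<rightarrow> ?A" using pA eq by (auto simp: Pi_iff)
  moreover have "dplot (mfd_diff (lie_mfd G)) n U (\<lambda>u. torsor_diff G X x (fst (snd (q u)) x))"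
    if "x \<in> pts (tmfd X)" for x
    by (rule mfd_plot_cong[OF pd[OF that]]) (simp add: eq)
  ultimately show ?thesis by (simp add: aut_diff_def Let_def)
qed

lemma is_functor_pullback_obj:
  assumes f: "(M, f, N) \<in> Arr man_cat" and F: "is_functor (thin_gpd N) D F"
  shows "is_functor (thin_gpd M) D (comp_ftr (thin_gpd M) F (thin_map (M, f, N)))"
  using thin_gpd_closed[OF man_catD(1)[OF f]]
  by (intro is_functor_comp_ftr[OF _ _ _ is_functor_thin_map[OF f] F]) simp_all

text \<open>On loops at \<open>x\<close> the pullback is a composite of two smooth maps: from the
  thin fundamental group at \<open>x\<close> to that at \<open>f x\<close>, and from there to the
  automorphisms of the fibre of \<open>F\<close> over \<open>f x\<close>.\<close>

lemma is_transport_pullback_obj: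
  assumes f: "(M, f, N) \<in> Arr man_cat" and F: "is_transport G N F"
  shows "is_transport G M (comp_ftr (thin_gpd M) F (thin_map (M, f, N)))"
  unfolding is_transport_def
proof (intro conjI ballI)
  let ?\<Phi> = "thin_map (M, f, N)"
  show "is_functor (thin_gpd M) (tors_cat G) (comp_ftr (thin_gpd M) F ?\<Phi>)"
    by (rule is_functor_pullback_obj[OF f is_transport_functor[OF F]])
  fix x assume x: "x \<in> pts M"
  have ob: "fobj (comp_ftr (thin_gpd M) F ?\<Phi>) x = fobj F (f x)"
    using x by (simp add: compose_eq fobj_thin_map)
  have s: "dsmooth (thin_pi1 N (f x)) (aut_diff G (fobj F (f x))) (farr F)"
    using F man_catD(4)[OF f x] by (simp add: is_transport_def)
  note t = dsmooth_thin_pi1_thin_map[OF f, of x]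
  have arr: "farr (comp_ftr (thin_gpd M) F ?\<Phi>) c = farr F (farr ?\<Phi> c)" if "c \<in> Arr (thin_gpd M)" for c
    using that by (simp add: compose_eq)
  show "dsmooth (thin_pi1 M x) (aut_diff G (fobj (comp_ftr (thin_gpd M) F ?\<Phi>) x))
      (farr (comp_ftr (thin_gpd M) F ?\<Phi>))"
    unfolding dsmooth_def ob
  proof (intro conjI allI impI)
    show "farr (comp_ftr (thin_gpd M) F ?\<Phi>) \<in> dset (thin_pi1 M x) \<rightarrow> dset (aut_diff G (fobj F (f x)))"
    proof
      fix c assume c: "c \<in> dset (thin_pi1 M x)"
      then have "c \<in> Arr (thin_gpd M)" by (simp add: thin_pi1_def sub_diff_def)
      then show "farr (comp_ftr (thin_gpd M) F ?\<Phi>) c \<in> dset (aut_diff G (fobj F (f x)))"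
        using dsmoothD(1)[OF s dsmoothD(1)[OF t c]] arr by simp
    qed
    fix n U p assume p: "dplot (thin_pi1 M x) n U p"
    then have pU: "p u \<in> Arr (thin_gpd M)" if "u \<in> U" for u
      using that by (auto simp: thin_pi1_def sub_diff_def)
    show "dplot (aut_diff G (fobj F (f x))) n U (farr (comp_ftr (thin_gpd M) F ?\<Phi>) \<circ> p)"
    proof (rule aut_diff_plot_cong[OF dsmoothD(2)[OF s dsmoothD(2)[OF t p]]])
      show "(farr F \<circ> (farr ?\<Phi> \<circ> p)) u = (farr (comp_ftr (thin_gpd M) F ?\<Phi>) \<circ> p) u" if "u \<in> U" for u
        using arr[OF pU[OF that]] by simp
    qed
  qed
qed

text \<open>Naturality at \<open>c\<close> is naturality of \<open>\<eta>\<close> at the image of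
  \<open>c\<close> under \<open>thin_map (M, f, N)\<close>.\<close>

lemma is_nat_transf_pullback:
  assumes f: "(M, f, N) \<in> Arr man_cat" and \<eta>: "is_nat_transf (thin_gpd N) D F \<eta> F'"
  shows "is_nat_transf (thin_gpd M) D (comp_ftr (thin_gpd M) F (thin_map (M, f, N)))
    (\<lambda>x\<in>pts M. \<eta> (f x)) (comp_ftr (thin_gpd M) F' (thin_map (M, f, N)))"
  unfolding is_nat_transf_def
proof (intro conjI ballI)
  note e = is_nat_transfD[OF \<eta>]
  note fP = man_catD(4)[OF f]
  note T = is_functorD[OF is_functor_thin_map[OF f]]
  show "(\<lambda>x\<in>pts M. \<eta> (f x)) \<in> Obj (thin_gpd M) \<rightarrow>\<^sub>E Arr D"
    using e(1) fP by auto
  fix x assume "x \<in> Obj (thin_gpd M)"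
  then show "Src D ((\<lambda>x\<in>pts M. \<eta> (f x)) x) = fobj (comp_ftr (thin_gpd M) F (thin_map (M, f, N))) x"
    "Tgt D ((\<lambda>x\<in>pts M. \<eta> (f x)) x) = fobj (comp_ftr (thin_gpd M) F' (thin_map (M, f, N))) x"
    using e(3,4) fP by (simp_all add: compose_eq fobj_thin_map)
next
  fix c assume c: "c \<in> Arr (thin_gpd M)"
  note e = is_nat_transfD[OF \<eta>]
  note T = is_functorD[OF is_functor_thin_map[OF f]]
  have st: "Src (thin_gpd M) c \<in> pts M" "Tgt (thin_gpd M) c \<in> pts M"
    using thin_gpd_closed(1)[OF man_catD(1)[OF f] c] by simp_all
  show "Comp D ((\<lambda>x\<in>pts M. \<eta> (f x)) (Tgt (thin_gpd M) c))
       (farr (comp_ftr (thin_gpd M) F (thin_map (M, f, N))) c) =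
     Comp D (farr (comp_ftr (thin_gpd M) F' (thin_map (M, f, N))) c)
       ((\<lambda>x\<in>pts M. \<eta> (f x)) (Src (thin_gpd M) c))"
    using e(5)[OF T(2)[OF c]] T(5,6)[OF c] st c by (simp add: compose_eq fobj_thin_map)
qed

lemma pullback_sel:
  "fobj (pullback G (M, f, N)) =
     (\<lambda>F\<in>Obj (trans_cat G N). comp_ftr (thin_gpd M) F (thin_map (M, f, N)))"
  "farr (pullback G (M, f, N)) = (\<lambda>(F, \<eta>, F')\<in>Arr (trans_cat G N).
     (comp_ftr (thin_gpd M) F (thin_map (M, f, N)), \<lambda>x\<in>pts M. \<eta> (f x),
      comp_ftr (thin_gpd M) F' (thin_map (M, f, N))))"
  by (simp_all add: pullback_def Let_def)

lemma groupoid_trans_cat_manifold: "manifold M \<Longrightarrow> groupoid (trans_cat G M)"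
  by (rule groupoid_trans_cat) (rule thin_gpd_closed(1))

lemma is_functor_pullback:
  fixes G :: "'g lie" and M N :: "'m mfd"
  assumes f: "(M, f, N) \<in> Arr man_cat"
  shows "is_functor (trans_cat G N :: (('m, 't, 'g) trans_obj, ('m, 't, 'g) trans_arr) cat)
    (trans_cat G M) (pullback G (M, f, N))"
    (is "is_functor ?N ?M ?P")
  unfolding is_functor_def
proof (intro conjI ballI impI)
  note fP = man_catD(4)[OF f]
  have cat: "category ?N"
    by (rule category_trans_cat[OF thin_gpd_closed(1)[OF man_catD(2)[OF f]]])
  have arr: "(comp_ftr (thin_gpd M) F (thin_map (M, f, N)), \<lambda>x\<in>pts M. \<eta> (f x),
      comp_ftr (thin_gpd M) F' (thin_map (M, f, N))) \<in> Arr ?M"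
    if "(F, \<eta>, F') \<in> Arr ?N" for F \<eta> F'
    using that is_transport_pullback_obj[OF f, of G F] is_transport_pullback_obj[OF f, of G F']
      is_nat_transf_pullback[OF f, of "tors_cat G" F \<eta> F'] by simp
  show "fobj ?P \<in> Obj ?N \<rightarrow>\<^sub>E Obj ?M"
    using is_transport_pullback_obj[OF f] by (auto simp: pullback_sel)
  show "farr ?P \<in> Arr ?N \<rightarrow>\<^sub>E Arr ?M"
  proof (rule PiE_I)
    fix a assume a: "a \<in> Arr ?N"
    obtain F \<eta> F' where [simp]: "a = (F, \<eta>, F')" by (cases a) auto
    show "farr ?P a \<in> Arr ?M"
      using a arr[of F \<eta> F'] unfolding pullback_sel by (simp del: trans_cat_sel(6))
  qed (simp add: pullback_sel)
  show "farr ?P (Ident ?N F) = Ident ?M (fobj ?P F)"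
    if F: "F \<in> Obj ?N" for F
  proof -
    have "Ident ?N F \<in> Arr ?N"
      by (rule categoryD(3)[OF cat F])
    then have "farr ?P (Ident ?N F) =
        (comp_ftr (thin_gpd M) F (thin_map (M, f, N)),
         \<lambda>x\<in>pts M. (\<lambda>x\<in>pts N. Ident (tors_cat G) (fobj F x)) (f x),
         comp_ftr (thin_gpd M) F (thin_map (M, f, N)))"
      by (simp only: trans_cat_sel(4) pullback_sel(2) restrict_apply' prod.case)
    \<comment> \<open>The inner restriction to \<open>pts N\<close> disappears because
      \<open>f\<close> maps \<open>pts M\<close> into \<open>pts N\<close>.\<close>
    also have "\<dots> = Ident ?M (fobj ?P F)"
      using F fP by (auto simp: pullback_sel compose_eq fobj_thin_map fun_eq_iff)
    finally show ?thesis .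
  qed
  fix a assume a: "a \<in> Arr ?N"
  obtain F \<eta> F' where [simp]: "a = (F, \<eta>, F')" by (cases a) auto
  note a' = a[simplified]
  show "Src ?M (farr ?P a) = fobj ?P (Src ?N a)"
    "Tgt ?M (farr ?P a) = fobj ?P (Tgt ?N a)"
    using a' by (simp_all add: pullback_sel)
  fix b assume b: "b \<in> Arr ?N" and eq: "Src ?N b = Tgt ?N a"
  obtain E \<theta> E' where b_def: "b = (E, \<theta>, E')" by (cases b) auto
  have [simp]: "E = F'" using eq b_def by simp
  have [simp]: "b = (F', \<theta>, E')" using b_def by simp
  note b' = b[simplified]
  have ba: "Comp ?N b a \<in> Arr ?N"
    by (rule categoryD(6)[OF cat a b eq])
  have "farr ?P (Comp ?N b a) =
      (comp_ftr (thin_gpd M) F (thin_map (M, f, N)),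
       \<lambda>x\<in>pts M. (\<lambda>x\<in>pts N. Comp (tors_cat G) (\<theta> x) (\<eta> x)) (f x),
       comp_ftr (thin_gpd M) E' (thin_map (M, f, N)))"
    using ba by (simp only: \<open>a = (F, \<eta>, F')\<close> \<open>b = (F', \<theta>, E')\<close> trans_cat_sel(5)
        pullback_sel(2) restrict_apply' prod.case)
  also have "\<dots> = Comp ?M (farr ?P b) (farr ?P a)"
    using a' b' fP by (auto simp: pullback_sel fun_eq_iff)
  finally show "farr ?P (Comp ?N b a) = Comp ?M (farr ?P b) (farr ?P a)" .
qed

lemma pullback_id:
  fixes G :: "'g lie" and M :: "'m mfd"
  assumes M: "manifold M"
  shows "pullback G (M, \<lambda>x\<in>pts M. x, M) =
    id_ftr (trans_cat G M :: (('m, 't, 'g) trans_obj, ('m, 't, 'g) trans_arr) cat)"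
    (is "?P = id_ftr ?T")
proof (rule ftr.equality)
  have id: "comp_ftr (thin_gpd M) F (thin_map (M, \<lambda>x\<in>pts M. x, M)) = F" if "is_transport G M F" for F :: "('m, 't, 'g) trans_obj"
    unfolding thin_map_id[OF M] by (rule comp_ftr_id_right[OF is_transport_functor[OF that]])
  show "fobj ?P = fobj (id_ftr ?T)"
    by (auto simp: pullback_sel id_ftr_def id fun_eq_iff)
  have nat: "(\<lambda>x\<in>pts M. \<eta> ((\<lambda>x\<in>pts M. x) x)) = \<eta>" if "is_nat_transf (thin_gpd M) D F \<eta> F'" for D F \<eta> F'
    using is_nat_transfD(2)[OF that] by (auto simp: fun_eq_iff extensional_def)
  show "farr ?P = farr (id_ftr ?T)"
  proof (rule extensionalityI)
    fix a assume a: "a \<in> Arr ?T"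
    obtain F \<eta> F' where [simp]: "a = (F, \<eta>, F')" by (cases a) auto
    note a' = a[simplified]
    show "farr ?P a = farr (id_ftr ?T) a"
      using a' nat[of "tors_cat G" F \<eta> F'] id by (simp add: pullback_sel id_ftr_def del: restrict_apply add: restrict_apply')
  qed (simp_all add: pullback_sel id_ftr_def)
qed simp

text \<open>Precomposition reverses the order: functors on \<open>K\<close> are pulled back along
  \<open>g\<close> first. The equality is strict because \<open>thin_map_comp\<close> and
  associativity of functor composition are.\<close>

lemma pullback_comp:
  fixes G :: "'g lie" and M N K :: "'m mfd"
  assumes f: "(M, f, N) \<in> Arr man_cat" and g: "(N, g, K) \<in> Arr man_cat"
  shows "pullback G (M, compose (pts M) g f, K) =
    comp_ftr (trans_cat G K :: (('m, 't, 'g) trans_obj, ('m, 't, 'g) trans_arr) cat)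
      (pullback G (M, f, N)) (pullback G (N, g, K))"
    (is "?GF = comp_ftr ?K ?F ?G")
proof (rule ftr.equality)
  have comp: "comp_ftr (thin_gpd M) F (thin_map (M, compose (pts M) g f, K)) =
      comp_ftr (thin_gpd M) (comp_ftr (thin_gpd N) F (thin_map (N, g, K))) (thin_map (M, f, N))"
    for F :: "('m, 't, 'g) trans_obj"
    unfolding thin_map_comp[OF f g] by (rule comp_ftr_assoc[OF is_functor_thin_map[OF f], symmetric])
  show "fobj ?GF =
      fobj (comp_ftr ?K ?F ?G)"
  proof (rule extensionalityI)
    fix F assume F: "F \<in> Obj ?K"
    then show "fobj ?GF F =
        fobj (comp_ftr ?K ?F ?G) F"
      using is_transport_pullback_obj[OF g, of G F] by (simp add: pullback_sel comp compose_eq)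
  qed (simp_all add: pullback_sel compose_def[of "Collect _"])
  show "farr ?GF =
      farr (comp_ftr ?K ?F ?G)"
  proof (rule extensionalityI)
    fix a assume a: "a \<in> Arr ?K"
    obtain F \<eta> F' where [simp]: "a = (F, \<eta>, F')" by (cases a) auto
    note a' = a[simplified]
    have ga: "farr ?G a = (comp_ftr (thin_gpd N) F (thin_map (N, g, K)),
        \<lambda>x\<in>pts N. \<eta> (g x), comp_ftr (thin_gpd N) F' (thin_map (N, g, K)))"
      using a' by (simp add: pullback_sel)
    have "farr ?G a \<in> Arr (trans_cat G N)"
      by (rule is_functorD(2)[OF is_functor_pullback[OF g] a])
    from this[unfolded ga] have "farr ?F (farr ?G a) =
        (comp_ftr (thin_gpd M) (comp_ftr (thin_gpd N) F (thin_map (N, g, K))) (thin_map (M, f, N)),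
         \<lambda>x\<in>pts M. (\<lambda>x\<in>pts N. \<eta> (g x)) (f x),
         comp_ftr (thin_gpd M) (comp_ftr (thin_gpd N) F' (thin_map (N, g, K))) (thin_map (M, f, N)))"
      unfolding ga by (simp only: pullback_sel(2) restrict_apply' prod.case)
    also have "\<dots> = farr ?GF a"
      using a' man_catD(4)[OF f] by (auto simp: pullback_sel comp compose_eq fun_eq_iff)
    finally show "farr ?GF a =
        farr (comp_ftr ?K ?F ?G) a"
      using a by (simp add: compose_eq)
  qed (simp_all add: pullback_sel compose_def[of "Arr _"])
qed simp

section \<open>The presheaf of groupoids\<close>

theorem lemma5p1:
  fixes G :: "'g lie"
  assumes "lie_group G"
  shows "category (man_cat :: ('m mfd, 'm man_arr) cat) \<and>
    category (gpd_cat :: ((('m, 't, 'g) trans_obj, ('m, 't, 'g) trans_arr) cat,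
                          (('m, 't, 'g) trans_obj, ('m, 't, 'g) trans_arr) gpd_arr) cat) \<and>
    (\<exists>Trans :: ('m mfd, 'm man_arr,
                (('m, 't, 'g) trans_obj, ('m, 't, 'g) trans_arr) cat,
                (('m, 't, 'g) trans_obj, ('m, 't, 'g) trans_arr) gpd_arr) ftr.
       is_functor (op_cat man_cat) gpd_cat Trans \<and>
       (\<forall>M. manifold M \<longrightarrow> fobj Trans M = trans_cat G M) \<and>
       (\<forall>M f N. (M, f, N) \<in> Arr man_cat \<longrightarrow>
          farr Trans (M, f, N) = (trans_cat G N, pullback G (M, f, N), trans_cat G M)))"
proof (intro conjI exI)
  let ?man = "man_cat :: ('m mfd, 'm man_arr) cat"
  let ?gpd = "gpd_cat :: ((('m, 't, 'g) trans_obj, ('m, 't, 'g) trans_arr) cat,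
                          (('m, 't, 'g) trans_obj, ('m, 't, 'g) trans_arr) gpd_arr) cat"
  \<comment> \<open>Functors are extensional, hence the restrictions; the image of a map from
    \<open>M\<close> to \<open>N\<close> starts at the groupoid over \<open>N\<close>.\<close>
  let ?Trans = "\<lparr>fobj = (\<lambda>M\<in>Obj ?man. trans_cat G M),
      farr = (\<lambda>(M, f, N)\<in>Arr ?man. (trans_cat G N, pullback G (M, f, N), trans_cat G M))\<rparr> ::
    ('m mfd, 'm man_arr,
     (('m, 't, 'g) trans_obj, ('m, 't, 'g) trans_arr) cat,
     (('m, 't, 'g) trans_obj, ('m, 't, 'g) trans_arr) gpd_arr) ftr"
  show "category ?man" by (rule category_man_cat)
  show "category ?gpd" by (rule category_gpd_cat)
  show "\<forall>M. manifold M \<longrightarrow> fobj ?Trans M = trans_cat G M" by simp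
  show "\<forall>M f N. (M, f, N) \<in> Arr ?man \<longrightarrow>
      farr ?Trans (M, f, N) = (trans_cat G N, pullback G (M, f, N), trans_cat G M)" by simp
  show "is_functor (op_cat ?man) ?gpd ?Trans"
    unfolding is_functor_def
  proof (intro conjI ballI impI)
    show "fobj ?Trans \<in> Obj (op_cat ?man) \<rightarrow>\<^sub>E Obj ?gpd"
      using groupoid_trans_cat_manifold by (auto simp: op_cat_def gpd_cat_def)
    show "farr ?Trans \<in> Arr (op_cat ?man) \<rightarrow>\<^sub>E Arr ?gpd"
    proof (rule PiE_I)
      fix a assume "a \<in> Arr (op_cat ?man)"
      moreover obtain M f N where [simp]: "a = (M, f, N)" by (cases a) auto
      ultimately have f: "(M, f, N) \<in> Arr ?man" by (simp add: op_cat_def)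
      then show "farr ?Trans a \<in> Arr ?gpd"
        by (simp add: gpd_cat_def is_functor_pullback[OF f]
            groupoid_trans_cat_manifold[OF man_catD(1)[OF f]] groupoid_trans_cat_manifold[OF man_catD(2)[OF f]])
    qed (simp add: op_cat_def)
    show "farr ?Trans (Ident (op_cat ?man) M) = Ident ?gpd (fobj ?Trans M)"
      if "M \<in> Obj (op_cat ?man)" for M
    proof -
      have M: "manifold M" using that by (simp add: op_cat_def)
      then have "(M, \<lambda>x\<in>pts M. x, M) \<in> Arr ?man"
        using categoryD(3)[OF category_man_cat, of M] by simp
      then show ?thesis
        using M pullback_id[OF M, of G] by (simp add: op_cat_def gpd_cat_def)
    qed
    fix a assume a: "a \<in> Arr (op_cat ?man)"
    obtain N f K where [simp]: "a = (N, f, K)" by (cases a) auto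
    have f: "(N, f, K) \<in> Arr ?man" using a by (simp add: op_cat_def)
    show "Src ?gpd (farr ?Trans a) = fobj ?Trans (Src (op_cat ?man) a)"
      "Tgt ?gpd (farr ?Trans a) = fobj ?Trans (Tgt (op_cat ?man) a)"
      using f man_catD(1,2)[OF f] by (simp_all add: op_cat_def gpd_cat_def)
    fix b assume b: "b \<in> Arr (op_cat ?man)" and eq: "Src (op_cat ?man) b = Tgt (op_cat ?man) a"
    obtain M g N' where b_def: "b = (M, g, N')" by (cases b) auto
    have [simp]: "b = (M, g, N)" using eq b_def by (simp add: op_cat_def)
    have g: "(M, g, N) \<in> Arr ?man" using b by (simp add: op_cat_def)
    \<comment> \<open>In the opposite category, \<open>b\<close> after \<open>a\<close> is the map
      \<open>f\<close> after \<open>g\<close>; correspondingly, functors on \<open>K\<close> are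
      pulled back along \<open>f\<close> first and then along \<open>g\<close>.\<close>
    have "(M, compose (pts M) f g, K) \<in> Arr ?man"
      using categoryD(6)[OF category_man_cat g f] by simp
    then show "farr ?Trans (Comp (op_cat ?man) b a) = Comp ?gpd (farr ?Trans b) (farr ?Trans a)"
      using f g pullback_comp[OF g f, of G] by (simp add: op_cat_def gpd_cat_def)
  qed
qed

end
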